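(* Let $b>1$ and, for each integer $n>b$, let $X=X^{(n)}=(X_1,\ldots,X_n)$ be uniformly distributed on $K=K_{n,b}$. (i) Suppose $1<b\le2$, and let $Z_1,Z_2,\ldots$ be i.i.d. with the probability density on $[0,\infty)$ proportional to $\exp(-rx^2-sx)$, where $r,s\in\mathbb{R}$ are the unique numbers for which this density has first moment $1$ and second moment $b$. Then there is a constant $C$ depending only on $b$ such that for all integers $n>b$ and $1\le k\le n$, $$\sup_{t_1,\ldots,t_k\in\mathbb{R}}\bigl|\mathbb{P}(X_1\le t_1,\ldots,X_k\le t_k)-\mathbb{P}(Z_1\le t_1,\ldots,Z_k\le t_k)\bigr|\le Ck\sqrt{\frac{\log n}{n}}.$$ (ii) Suppose $b>2$, and let $Z_1,Z_2,\ldots$ be i.i.d. exponential random variables with mean $1$. Then there is a constant $C$ depending only on $b$ such that for all integers $n>b$ and $1\le k\le n$, $$\sup_{t_1,\ldots,t_k\in\mathbb{R}}\bigl|\mathbb{P}(X_1\le t_1,\ldots,X_k\le t_k)-\mathbb{P}(Z_1\le t_1,\ldots,Z_k\le t_k)\bigr|\le Ckn^{-1/4}.$$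
   Context: $\mathbb{R}_+$ denotes the set of (strictly) positive real numbers. For real $b>1$ and an integer $n>b$ (which makes the set non-empty), $$K=K_{n,b}:=\Bigl\{x=(x_1,\ldots,x_n)\in\mathbb{R}_+^n:\ \sum_{i=1}^n x_i=n,\ \sum_{i=1}^n x_i^2=nb\Bigr\}.$$ The uniform distribution on $K$ is the limit of normalized Lebesgue measures on thin shells around $K$ as the thickness tends to zero; equivalently, the set $\{x\in\mathbb{R}^n:\sum x_i=n,\ \sum x_i^2=nb\}$ is a sphere centered at $(1,\ldots,1)$ in the hyperplane $\{\sum x_i=n\}$, $K$ is a relatively open non-empty subset of it, and the uniform distribution on $K$ is the rotation-invariant probability measure of this sphere conditioned on (restricted to and normalized on) $K$. For $1<b\le2$ it is a known fact (established in the same paper) that there exist unique $r,s\in\mathbb{R}$ such that $\exp(-rx^2-sx)$ is integrable on $[0,\infty)$ and the probability density proportional to it has first moment $1$ and second moment $b$. *)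

theory Defs
  imports "HOL-Probability.Probability"
begin

text \<open>
  Points of $n$-space are extensional functions in \<open>{..<n} \<rightarrow>\<^sub>E UNIV\<close>; the coordinates
  $x_1, \dots, x_n$ are \<open>x 0, \<dots>, x (n - 1)\<close>.
\<close>

definition K :: "nat \<Rightarrow> real \<Rightarrow> (nat \<Rightarrow> real) set" where
  "K n b = {x \<in> {..<n} \<rightarrow>\<^sub>E {0<..}. (\<Sum>i<n. x i) = real n \<and> (\<Sum>i<n. (x i)\<^sup>2) = real n * b}"

definition K_sphere :: "nat \<Rightarrow> real \<Rightarrow> (nat \<Rightarrow> real) set" where
  "K_sphere n b = {x \<in> {..<n} \<rightarrow>\<^sub>E UNIV. (\<Sum>i<n. x i) = real n \<and> (\<Sum>i<n. (x i)\<^sup>2) = real n * b}"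

definition mat_app :: "nat \<Rightarrow> (nat \<Rightarrow> nat \<Rightarrow> real) \<Rightarrow> (nat \<Rightarrow> real) \<Rightarrow> (nat \<Rightarrow> real)" where
  "mat_app n Q x = (\<lambda>i\<in>{..<n}. \<Sum>j<n. Q i j * x j)"

text \<open>
  The rotations of the sphere about its centre $(1,\dots,1)$ within the hyperplane
  $\sum x_i = n$ are the orthogonal matrices that fix $(1,\dots,1)$. Determinant $-1$ is
  allowed: for $n = 2$ the sphere consists of two points, and only the reflection
  exchanging them forces equal masses. For larger $n$ this makes no difference.
\<close>

definition sphere_rotation :: "nat \<Rightarrow> (nat \<Rightarrow> nat \<Rightarrow> real) \<Rightarrow> bool" where
  "sphere_rotation n Q \<longleftrightarrow>
     (\<forall>i<n. \<forall>j<n. (\<Sum>l<n. Q l i * Q l j) = (if i = j then 1 else 0)) \<and>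
     (\<forall>i<n. (\<Sum>j<n. Q i j) = 1)"

definition uniform_on_sphere :: "nat \<Rightarrow> real \<Rightarrow> (nat \<Rightarrow> real) measure \<Rightarrow> bool" where
  "uniform_on_sphere n b \<sigma> \<longleftrightarrow>
     prob_space \<sigma> \<and> sets \<sigma> = sets (\<Pi>\<^sub>M i\<in>{..<n}. (borel :: real measure)) \<and>
     (AE x in \<sigma>. x \<in> K_sphere n b) \<and>
     (\<forall>Q. sphere_rotation n Q \<longrightarrow> distr \<sigma> \<sigma> (mat_app n Q) = \<sigma>)"

text \<open>
  \<open>uniform_measure \<sigma> A\<close> is \<open>\<sigma>\<close> conditioned on \<open>A\<close>.
\<close>

definition uniform_on_K :: "nat \<Rightarrow> real \<Rightarrow> (nat \<Rightarrow> real) measure \<Rightarrow> bool" where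
  "uniform_on_K n b \<mu> \<longleftrightarrow> (\<exists>\<sigma>. uniform_on_sphere n b \<sigma> \<and> \<mu> = uniform_measure \<sigma> (K n b))"

definition gibbs_weight :: "real \<Rightarrow> real \<Rightarrow> real \<Rightarrow> real" where
  "gibbs_weight r s x = indicator {0..} x * exp (- r * x\<^sup>2 - s * x)"

definition gibbs_measure :: "real \<Rightarrow> real \<Rightarrow> real measure" where
  "gibbs_measure r s =
     density lborel (\<lambda>x. ennreal (gibbs_weight r s x / (\<integral>y. gibbs_weight r s y \<partial>lborel)))"

definition gibbs_params :: "real \<Rightarrow> real \<Rightarrow> real \<Rightarrow> bool" where
  "gibbs_params b r s \<longleftrightarrow>
     integrable lborel (gibbs_weight r s) \<and>
     has_bochner_integral (gibbs_measure r s) (\<lambda>x. x) 1 \<and>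
     has_bochner_integral (gibbs_measure r s) (\<lambda>x. x\<^sup>2) b"

definition exp1_measure :: "real measure" where
  "exp1_measure = density lborel (\<lambda>x. ennreal (exponential_density 1 x))"

definition iid_law :: "real measure \<Rightarrow> (nat \<Rightarrow> real) measure" where
  "iid_law D = (\<Pi>\<^sub>M i\<in>(UNIV :: nat set). D)"

definition joint_cdf :: "nat \<Rightarrow> (nat \<Rightarrow> real) measure \<Rightarrow> (nat \<Rightarrow> real) \<Rightarrow> real" where
  "joint_cdf k \<mu> t = measure \<mu> {x \<in> space \<mu>. \<forall>i<k. x i \<le> t i}"

text \<open>
  Only \<open>t 0, \<dots>, t (k - 1)\<close> matter below, so the supremum over all sequences \<open>t\<close> is the
  supremum over $k$ real numbers. For probability measures the set is bounded by 1.
\<close>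

definition cdf_distance :: "nat \<Rightarrow> (nat \<Rightarrow> real) measure \<Rightarrow> (nat \<Rightarrow> real) measure \<Rightarrow> real" where
  "cdf_distance k \<mu> \<nu> = (SUP t. \<bar>joint_cdf k \<mu> t - joint_cdf k \<nu> t\<bar>)"

end

theory Submission
  imports Defs "HOL-Real_Asymp.Real_Asymp"
begin

text \<open>
  Let $Z_1, Z_2, \dots$ be independent with a density proportional to $\exp(-rx^2-sx)$ on
  $[0,\infty)$; for \<open>b > 2\<close> this is the exponential density, $r = 0$ and $s = 1$. The density of
  $(Z_1,\dots,Z_n)$ depends on the point only through the sum and the sum of squares of its
  coordinates, so it is constant on \<open>K n b\<close>, and the uniform distribution on \<open>K n b\<close> is the law of
  $(Z_1,\dots,Z_n)$ conditioned on the two constraints. Conditioning on an event of probability $p$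
  multiplies probabilities by at most $1/p$. Hoeffding's inequality bounds the probability that the
  empirical distribution function of $n$ independent variables is off by $\delta$ at a given point
  by $2\exp(-2n\delta^2)$. Hence, under the uniform distribution on \<open>K n b\<close>, the empirical
  distribution function is within $\delta$ of its limit as soon as $n\delta^2$ exceeds a multiple of
  $\log(1/p_n)$, where $p_n$ is the probability of a thin shell around the constraint set. With
  $p_n \ge c n^{-7}$ this gives $\delta$ of order $\sqrt{\log n/n}$, and with
  $p_n \ge \exp(-C\sqrt n)$ it gives $\delta$ of order $n^{-1/4}$. Exchangeability finally turns
  the bound for the empirical distribution function into one for the joint distribution function of
  $k$ coordinates, at the price of a factor $k$ (\<open>exchangeable_joint_cdf\<close>).

  The constraint set is a null set, so the conditioning is carried out in a thin shell of $n$-space.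
  The shell projects to the sphere by an affine normalisation of the coordinates, and Lebesgue
  measure on the shell is compared with the uniform measure on the sphere by integrating one
  rotation-invariant relation in both orders (\<open>sphere_shell_comparison\<close>). This is all that is used
  of the sphere; \<open>empirical_cdf_deviation\<close> combines it with Hoeffding's inequality.

  The lower bounds for $p_n$ rest on a local limit estimate by Fourier analysis
  (\<open>local_lower_bound\<close>): the sum and the sum of squares of $N$ variables fall into a window of
  constant size around their means, or around any point at bounded distance from the means, with
  probability at least $c/N$. Two further coordinates then solve both constraints exactly, up to a
  box whose side is a power of $1/n$ (\<open>core_completion\<close>). For \<open>b > 2\<close> the exponential
  variables have second moment 2, which is too small; two coordinates of order $\sqrt n$ supply the
  missing sum of squares, and of order $\sqrt n$ others are forced to be small so that the sum comes
  out right, which costs a factor $\exp(-C\sqrt n)$ (\<open>exp1_core_prob\<close>).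

  In the case \<open>b \<le> 2\<close> the constant must not depend on \<open>r\<close> and \<open>s\<close>, so the uniqueness of these
  parameters enters (\<open>gibbs_params_unique\<close>).
\<close>

section \<open>Smoothing kernels on the line\<close>

definition unit_uniform :: "real measure" where
  "unit_uniform = density lborel (indicator {0..1})"

text \<open>
  The difference of two independent uniform variables has the characteristic function
  \<open>\<bar>\<phi>\<bar>\<^sup>2\<close>, where \<open>\<phi>\<close> belongs to the uniform distribution, and the sum of two such differences has
  \<open>\<bar>\<phi>\<bar>\<^sup>4\<close>. Both are nonnegative, so they can serve as test functions in place of the indicator of a
  window. Both laws have compact support, which confines Fourier integrals to a neighbourhood of the
  origin. The faster decay of \<open>\<bar>\<phi>\<bar>\<^sup>4\<close> allows its tail to be bounded by a small multiple of \<open>\<bar>\<phi>\<bar>\<^sup>2\<close>.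
\<close>
definition tri_kernel :: "real measure" where
  "tri_kernel = convolution unit_uniform (distr unit_uniform borel uminus)"

definition smooth_kernel :: "real measure" where
  "smooth_kernel = convolution tri_kernel tri_kernel"

lemma real_distribution_unit_uniform: "real_distribution unit_uniform"
  unfolding unit_uniform_def
  by (intro real_distribution.intro real_distribution_axioms.intro prob_spaceI) (auto simp: emeasure_density)

lemma real_distribution_convolution:
  assumes "real_distribution M" "real_distribution N"
  shows "real_distribution (convolution M N)"
proof -
  interpret M: real_distribution M by fact
  interpret N: real_distribution N by fact
  interpret P: pair_prob_space M N ..
  show ?thesis unfolding convolution_def
    by (intro real_distribution.intro real_distribution_axioms.intro P.prob_space_distr) (auto simp: borel_measurable_add)
qed

lemma real_distribution_uminus:
  assumes "real_distribution M" shows "real_distribution (distr M borel uminus)"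
proof -
  interpret M: real_distribution M by fact
  show ?thesis
    by (intro real_distribution.intro real_distribution_axioms.intro M.prob_space_distr) auto
qed

lemma real_distribution_tri: "real_distribution tri_kernel"
  unfolding tri_kernel_def by (intro real_distribution_convolution real_distribution_uminus real_distribution_unit_uniform)
lemma real_distribution_smooth: "real_distribution smooth_kernel"
  unfolding smooth_kernel_def by (intro real_distribution_convolution real_distribution_tri)

lemma integral_product_prob:
  fixes f :: "'a \<Rightarrow> complex" and g :: "'b \<Rightarrow> complex"
  assumes "prob_space M" "prob_space N" "f \<in> borel_measurable M" "g \<in> borel_measurable N"
    "\<And>x. norm (f x) \<le> 1" "\<And>x. norm (g x) \<le> 1"
  shows "(\<integral>z. f (fst z) * g (snd z) \<partial>(M \<Otimes>\<^sub>M N)) = (\<integral>x. f x \<partial>M) * (\<integral>y. g y \<partial>N)"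
proof -
  interpret M: prob_space M by fact
  interpret N: prob_space N by fact
  interpret P: pair_prob_space M N ..
  note [measurable] = assms(3,4)
  have "integrable (M \<Otimes>\<^sub>M N) (\<lambda>z. f (fst z) * g (snd z))"
    by (rule P.integrable_const_bound[of _ 1]) (auto simp: norm_mult intro!: mult_le_one assms)
  then have "(\<integral>z. f (fst z) * g (snd z) \<partial>(M \<Otimes>\<^sub>M N)) = (\<integral>x. (\<integral>y. f x * g y \<partial>N) \<partial>M)"
    by (subst P.integral_fst'[symmetric]) (auto simp: split_def)
  then show ?thesis by simp
qed

lemma char_convolution:
  assumes "real_distribution M" "real_distribution N"
  shows "char (convolution M N) t = char M t * char N t"
proof -
  interpret M: real_distribution M by fact
  interpret N: real_distribution N by fact
  have [measurable_cong]: "sets M = sets borel" "sets N = sets borel" by simp_all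
  have "char (convolution M N) t = (\<integral>z. iexp (t * fst z) * iexp (t * snd z) \<partial>(M \<Otimes>\<^sub>M N))"
    unfolding char_def convolution_def
    by (subst integral_distr) (auto simp: split_def algebra_simps exp_add[symmetric] complex_eq_iff intro!: Bochner_Integration.integral_cong)
  also have "\<dots> = char M t * char N t"
    unfolding char_def
    by (rule integral_product_prob[OF M.prob_space_axioms N.prob_space_axioms]) auto
  finally show ?thesis .
qed

lemma char_uminus:
  assumes "real_distribution M"
  shows "char (distr M borel uminus) t = cnj (char M t)"
proof -
  interpret M: real_distribution M by fact
  have "char (distr M borel uminus) t = (\<integral>x. cnj (iexp (t * x)) \<partial>M)"
    unfolding char_def by (subst integral_distr) (auto simp: exp_cnj intro!: Bochner_Integration.integral_cong)
  then show ?thesis unfolding char_def by simp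
qed

definition tri_char :: "real \<Rightarrow> real" where "tri_char x = (cmod (char unit_uniform x))\<^sup>2"

lemma char_tri: "char tri_kernel x = of_real (tri_char x)"
  unfolding tri_kernel_def tri_char_def
  by (simp add: char_convolution char_uminus real_distribution_unit_uniform real_distribution_uminus complex_norm_square del: of_real_power)

lemma char_smooth: "char smooth_kernel x = of_real ((tri_char x)\<^sup>2)"
  unfolding smooth_kernel_def
  by (simp add: char_convolution char_tri real_distribution_tri power2_eq_square)

lemma tri_char_nonneg: "0 \<le> tri_char x" by (simp add: tri_char_def)
lemma tri_char_le_1: "tri_char x \<le> 1"
  unfolding tri_char_def using real_distribution.cmod_char_le_1[OF real_distribution_unit_uniform, of x]
  by (simp add: power_le_one)

lemma char_unit_uniform: 
  assumes "x \<noteq> 0" shows "char unit_uniform x = (iexp x - 1) / (\<i> * x)"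
proof -
  have "char unit_uniform x = (\<integral>t. indicator {0..1} t *\<^sub>R iexp (x * t) \<partial>lborel)"
    unfolding char_def unit_uniform_def
    using integral_density[of "\<lambda>t. iexp (x * t)" lborel "indicator {0..1} :: real \<Rightarrow> real"]
    by (simp add: ennreal_indicator)
  also have "\<dots> = iexp (x * 1) / (\<i> * x) - iexp (x * 0) / (\<i> * x)"
  proof (rule integral_FTC_atLeastAtMost)
    fix t :: real
    have "((\<lambda>z. exp (\<i> * (x * z)) / (\<i> * x)) has_field_derivative exp (\<i> * (x * t)) * (\<i> * x) / (\<i> * x)) (at (of_real t))"
      by (auto intro!: derivative_eq_intros simp: mult_ac)
    from has_vector_derivative_real_field[OF this, of "{0..1}"]
    have "((\<lambda>t. iexp (x * t) / (\<i> * x)) has_vector_derivative (iexp (x * t) * (\<i> * x) / (\<i> * x))) (at t within {0..1})"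
      by simp
    then show "((\<lambda>t. iexp (x * t) / (\<i> * x)) has_vector_derivative iexp (x * t)) (at t within {0..1})"
      using assms by simp
  qed (auto intro!: continuous_intros)
  finally show ?thesis using assms by (simp add: field_simps)
qed

text \<open>
  The integral of the exponential over the unit interval is at most \<open>2 / \<bar>x\<bar>\<close>.
\<close>
lemma tri_char_decay: "tri_char x * x\<^sup>2 \<le> 4"
proof (cases "x = 0")
  case False
  have "cmod (iexp x - 1) \<le> 2" 
    using norm_triangle_ineq4[of "iexp x" 1] by simp
  then have "(cmod (iexp x - 1))\<^sup>2 \<le> 2\<^sup>2" by (intro power_mono) auto
  with False show ?thesis
    by (simp add: tri_char_def char_unit_uniform norm_divide norm_mult power_divide power_mult_distrib)
qed simp

text \<open>
  A density bounded by 1 stays bounded by 1 after convolution, because Lebesgue measure is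
  translation invariant.
\<close>
lemma nn_integral_convolution_le:
  assumes "real_distribution M" "real_distribution N"
    and dom: "\<And>f. f \<in> borel_measurable borel \<Longrightarrow> (\<integral>\<^sup>+x. f x \<partial>M) \<le> (\<integral>\<^sup>+x. f x \<partial>lborel)"
    and [measurable]: "f \<in> borel_measurable borel"
  shows "(\<integral>\<^sup>+x. f x \<partial>(convolution M N)) \<le> (\<integral>\<^sup>+x. f x \<partial>lborel)"
proof -
  interpret M: real_distribution M by fact
  interpret N: real_distribution N by fact
  have [measurable_cong]: "sets M = sets borel" "sets N = sets borel" by simp_all
  interpret P: pair_prob_space M N ..
  have "(\<integral>\<^sup>+x. f x \<partial>(convolution M N)) = (\<integral>\<^sup>+y. \<integral>\<^sup>+x. f (x + y) \<partial>M \<partial>N)"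
    unfolding convolution_def
    by (subst nn_integral_distr) (auto simp: split_def P.nn_integral_snd[symmetric])
  also have "\<dots> \<le> (\<integral>\<^sup>+y. \<integral>\<^sup>+x. f (y + x) \<partial>lborel \<partial>N)"
    by (intro nn_integral_mono) (auto intro!: order_trans[OF dom] simp: add.commute)
  also have "\<dots> = (\<integral>\<^sup>+y. \<integral>\<^sup>+x. f x \<partial>lborel \<partial>N)"
  proof (rule nn_integral_cong)
    fix y
    have "(\<integral>\<^sup>+x. f (y + x) \<partial>lborel) = (\<integral>\<^sup>+x. f x \<partial>distr lborel borel ((+) y))"
      by (subst nn_integral_distr) auto
    then show "(\<integral>\<^sup>+x. f (y + x) \<partial>lborel) = (\<integral>\<^sup>+x. f x \<partial>lborel)"
      by (simp add: lborel_distr_plus)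
  qed
  also have "\<dots> = (\<integral>\<^sup>+x. f x \<partial>lborel)" using N.emeasure_space_1 by simp
  finally show ?thesis .
qed

lemma unit_uniform_dom: 
  assumes [measurable]: "f \<in> borel_measurable borel" shows "(\<integral>\<^sup>+x. f x \<partial>unit_uniform) \<le> (\<integral>\<^sup>+x. f x \<partial>lborel)"
  unfolding unit_uniform_def
  by (subst nn_integral_density) (auto intro!: nn_integral_mono split: split_indicator)

lemma tri_dom: "f \<in> borel_measurable borel \<Longrightarrow> (\<integral>\<^sup>+x. f x \<partial>tri_kernel) \<le> (\<integral>\<^sup>+x. f x \<partial>lborel)"
  unfolding tri_kernel_def
  by (intro nn_integral_convolution_le unit_uniform_dom real_distribution_uminus real_distribution_unit_uniform)

lemma smooth_dom: "f \<in> borel_measurable borel \<Longrightarrow> (\<integral>\<^sup>+x. f x \<partial>smooth_kernel) \<le> (\<integral>\<^sup>+x. f x \<partial>lborel)"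
  unfolding smooth_kernel_def
  by (intro nn_integral_convolution_le tri_dom real_distribution_tri)

lemma AE_convolution_bounded:
  assumes "real_distribution M" "real_distribution N" "AE x in M. \<bar>x\<bar> \<le> a" "AE x in N. \<bar>x\<bar> \<le> b"
  shows "AE x in convolution M N. \<bar>x\<bar> \<le> a + b"
proof -
  interpret M: real_distribution M by fact
  interpret N: real_distribution N by fact
  have [measurable_cong]: "sets M = sets borel" "sets N = sets borel" by simp_all
  interpret P: pair_prob_space M N ..
  have "AE x in M. AE y in N. \<bar>x + y\<bar> \<le> a + b"
    using assms(3) apply eventually_elim using assms(4) apply eventually_elim by auto
  then have "AE z in M \<Otimes>\<^sub>M N. \<bar>fst z + snd z\<bar> \<le> a + b"
  proof (intro P.AE_pair_measure)
    have "{z::real \<times> real. \<bar>fst z + snd z\<bar> \<le> a + b} \<in> sets (borel \<Otimes>\<^sub>M borel)"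
      unfolding borel_prod by (intro borel_closed closed_Collect_le continuous_intros)
    also have "sets (borel \<Otimes>\<^sub>M borel) = sets (M \<Otimes>\<^sub>M N)"
      by (intro sets_pair_measure_cong) auto
    finally show "{x \<in> space (M \<Otimes>\<^sub>M N). \<bar>fst x + snd x\<bar> \<le> a + b} \<in> sets (M \<Otimes>\<^sub>M N)"
      by (simp add: space_pair_measure)
  qed simp
  then show ?thesis unfolding convolution_def by (subst AE_distr_iff) (auto simp: split_def)
qed

lemma unit_uniform_bdd: "AE x in unit_uniform. 0 \<le> x \<and> x \<le> 1"
  unfolding unit_uniform_def by (subst AE_density) (auto intro!: AE_I2 split: split_indicator)

lemma tri_bdd: "AE x in tri_kernel. \<bar>x\<bar> \<le> 2"
proof -
  have 1: "AE x in unit_uniform. \<bar>x\<bar> \<le> 1" using unit_uniform_bdd by eventually_elim auto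
  have "AE x in distr unit_uniform borel uminus. \<bar>x\<bar> \<le> 1"
    using 1 by (subst AE_distr_iff) (auto simp: unit_uniform_def)
  from AE_convolution_bounded[OF real_distribution_unit_uniform real_distribution_uminus[OF real_distribution_unit_uniform] 1 this]
  show ?thesis unfolding tri_kernel_def by simp
qed

lemma smooth_bdd: "AE x in smooth_kernel. \<bar>x\<bar> \<le> 4"
  using AE_convolution_bounded[OF real_distribution_tri real_distribution_tri tri_bdd tri_bdd]
  unfolding smooth_kernel_def by simp

lemma emeasure_convolution_ge:
  assumes "real_distribution M" "real_distribution N" "A \<in> sets borel" "B \<in> sets borel"
    and "\<And>y. y \<in> B \<Longrightarrow> emeasure M {x. x + y \<in> A} \<ge> c"
  shows "emeasure (convolution M N) A \<ge> c * emeasure N B"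
proof -
  interpret M: real_distribution M by fact
  interpret N: real_distribution N by fact
  have [measurable_cong]: "sets M = sets borel" "sets N = sets borel" by simp_all
  note [measurable] = assms(3,4)
  interpret P: pair_prob_space M N ..
  have "c * emeasure N B = (\<integral>\<^sup>+y. c * indicator B y \<partial>N)"
    by (simp add: nn_integral_cmult_indicator)
  also have "\<dots> \<le> (\<integral>\<^sup>+y. emeasure M {x. x + y \<in> A} \<partial>N)"
    using assms(5) by (intro nn_integral_mono) (auto split: split_indicator)
  also have "\<dots> = (\<integral>\<^sup>+y. \<integral>\<^sup>+x. indicator A (x + y) \<partial>M \<partial>N)"
  proof (intro nn_integral_cong)
    fix y
    have "(\<integral>\<^sup>+x. indicator A (x + y) \<partial>M) = (\<integral>\<^sup>+x. indicator {x. x + y \<in> A} x \<partial>M)"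
      by (intro nn_integral_cong) (auto split: split_indicator)
    then show "emeasure M {x. x + y \<in> A} = (\<integral>\<^sup>+x. indicator A (x + y) \<partial>M)" by simp
  qed
  also have "\<dots> = emeasure (convolution M N) A"
    unfolding convolution_def
    by (subst nn_integral_indicator[symmetric], simp, subst nn_integral_distr) (auto simp: split_def P.nn_integral_snd[symmetric])
  finally show ?thesis .
qed

lemma emeasure_unit_uniform_ge:
  assumes "0 \<le> a" "a \<le> b" "b \<le> 1" "{a..b} \<subseteq> A" "A \<in> sets borel"
  shows "emeasure unit_uniform A \<ge> ennreal (b - a)"
proof -
  have "ennreal (b - a) = emeasure lborel {a..b}" using assms by simp
  also have "\<dots> \<le> emeasure lborel ({0..1} \<inter> A)" using assms by (intro emeasure_mono) auto
  also have "\<dots> = emeasure unit_uniform A" unfolding unit_uniform_def using assms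
    by (simp add: emeasure_density indicator_inter_arith[symmetric])
  finally show ?thesis .
qed

lemma tri_ge:
  assumes "-1/4 \<le> a" "a \<le> b" "b \<le> 1/4"
  shows "emeasure tri_kernel {a..b} \<ge> ennreal ((b - a) / 2)"
proof -
  have *: "ennreal (b - a) * emeasure (distr unit_uniform borel uminus) {-3/4..-1/4} \<le> emeasure tri_kernel {a..b}"
    unfolding tri_kernel_def
  proof (rule emeasure_convolution_ge[OF real_distribution_unit_uniform real_distribution_uminus[OF real_distribution_unit_uniform]])
    \<comment> \<open>For these \<open>y\<close> the set \<open>{a - y..b - y}\<close> is contained in the unit interval.\<close>
    fix y :: real assume y: "y \<in> {-3/4..-1/4}"
    have "ennreal ((b - y) - (a - y)) \<le> emeasure unit_uniform {x. x + y \<in> {a..b}}"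
      using y assms by (intro emeasure_unit_uniform_ge) auto
    then show "ennreal (b - a) \<le> emeasure unit_uniform {x. x + y \<in> {a..b}}" by simp
  qed auto
  have "emeasure (distr unit_uniform borel uminus) {-3/4..-1/4} = emeasure unit_uniform {1/4..3/4}"
  proof (subst emeasure_distr)
    have "uminus -` {-3/4..-1/4} = {1/4..3/4::real}" by auto
    then show "emeasure unit_uniform (uminus -` {- 3 / 4..- 1 / 4} \<inter> space unit_uniform) = emeasure unit_uniform {1/4..3/4}"
      by (simp add: unit_uniform_def)
  qed (auto simp: unit_uniform_def)
  also have "\<dots> \<ge> ennreal (3/4 - 1/4)"
    by (intro emeasure_unit_uniform_ge) auto
  finally have "ennreal (1/2) \<le> emeasure (distr unit_uniform borel uminus) {-3/4..-1/4}" by simp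
  then have "ennreal (b - a) * ennreal (1/2) \<le> ennreal (b - a) * emeasure (distr unit_uniform borel uminus) {-3/4..-1/4}"
    by (intro mult_left_mono) auto
  from order_trans[OF this *] show ?thesis using assms by (simp add: ennreal_mult[symmetric] del: ennreal_half)
qed

lemma smooth_ge:
  assumes "-1/8 \<le> a" "a \<le> b" "b \<le> 1/8"
  shows "emeasure smooth_kernel {a..b} \<ge> ennreal ((b - a) / 16)"
proof -
  have *: "ennreal ((b - a)/2) * emeasure tri_kernel {-1/8..1/8} \<le> emeasure smooth_kernel {a..b}"
    unfolding smooth_kernel_def
  proof (rule emeasure_convolution_ge[OF real_distribution_tri real_distribution_tri])
    fix y :: real assume y: "y \<in> {-1/8..1/8}"
    have "{x. x + y \<in> {a..b}} = {a - y..b - y}" by auto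
    then show "ennreal ((b - a)/2) \<le> emeasure tri_kernel {x. x + y \<in> {a..b}}"
      using y assms tri_ge[of "a - y" "b - y"] by simp
  qed auto
  have "ennreal (1/8) \<le> emeasure tri_kernel {-1/8..1/8}" using tri_ge[of "-1/8" "1/8"] by simp
  then have "ennreal ((b - a)/2) * ennreal (1/8) \<le> ennreal ((b - a)/2) * emeasure tri_kernel {-1/8..1/8}"
    by (intro mult_left_mono) auto
  from order_trans[OF this *] show ?thesis using assms by (simp add: ennreal_mult[symmetric])
qed

section \<open>A local lower bound for sums of independent pairs\<close>

lemma integral_PiM_iexp_sum:
  fixes g :: "real \<Rightarrow> real"
  assumes "prob_space D" "g \<in> borel_measurable D"
  shows "(\<integral>y. iexp (\<Sum>i<N. g (y i)) \<partial>PiM {..<N} (\<lambda>_. D)) = (\<integral>z. iexp (g z) \<partial>D) ^ N"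
proof -
  interpret D: prob_space D by fact
  interpret product_prob_space "\<lambda>_. D" ..
  note [measurable] = assms(2)
  have "(\<integral>y. iexp (\<Sum>i<N. g (y i)) \<partial>PiM {..<N} (\<lambda>_. D)) = (\<integral>y. (\<Prod>i<N. iexp (g (y i))) \<partial>PiM {..<N} (\<lambda>_. D))"
    by (simp add: exp_sum sum_distrib_left)
  also have "\<dots> = (\<Prod>i<N. \<integral>z. iexp (g z) \<partial>D)"
    by (rule product_integral_prod) (auto intro!: D.integrable_iexp)
  finally show ?thesis by simp
qed

text \<open>
  Second-order Taylor expansion under the integral; the linear term vanishes since \<open>g\<close> is centred.
\<close>
lemma char_quadratic:
  fixes g :: "'a \<Rightarrow> real"
  assumes "prob_space D" and [measurable]: "g \<in> borel_measurable D"
    and "integrable D (\<lambda>z. \<bar>g z\<bar> ^ 3)" "integrable D (\<lambda>z. (g z)\<^sup>2)" "integrable D g" "(\<integral>z. g z \<partial>D) = 0"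
  shows "cmod ((\<integral>z. iexp (g z) \<partial>D) - of_real (1 - (\<integral>z. (g z)\<^sup>2 \<partial>D) / 2)) \<le> (\<integral>z. \<bar>g z\<bar> ^ 3 \<partial>D)"
proof -
  interpret D: prob_space D by fact
  have "(\<integral>z. iexp (g z) \<partial>D) - of_real (1 - (\<integral>z. (g z)\<^sup>2 \<partial>D) / 2) =
     (\<integral>z. iexp (g z) - (1 + \<i> * g z - of_real ((g z)\<^sup>2) / 2) \<partial>D)"
  proof -
    have "integrable D (\<lambda>z. complex_of_real ((g z)\<^sup>2))" "integrable D (\<lambda>z. complex_of_real (g z))"
      by (intro integrable_of_real assms)+
    moreover have "(\<integral>z. complex_of_real (g z) \<partial>D) = of_real 0" using integral_of_real[OF assms(5), where 'a=complex] assms(6) by simp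
    moreover have "(\<integral>z. complex_of_real ((g z)\<^sup>2) \<partial>D) = of_real (\<integral>z. (g z)\<^sup>2 \<partial>D)" by (rule integral_of_real[OF assms(4)])
    ultimately show ?thesis
      using D.prob_space assms(5) by (simp add: D.integrable_iexp del: of_real_power)
  qed
  also have "cmod \<dots> \<le> (\<integral>z. \<bar>g z\<bar> ^ 3 \<partial>D)"
  proof (rule order_trans[OF integral_norm_bound integral_mono])
    have "integrable D (\<lambda>z. complex_of_real ((g z)\<^sup>2))" "integrable D (\<lambda>z. complex_of_real (g z))"
      by (intro integrable_of_real assms)+
    then show "integrable D (\<lambda>z. cmod (iexp (g z) - (1 + \<i> * g z - of_real ((g z)\<^sup>2) / 2)))"
      by (intro integrable_norm) (auto simp: D.integrable_iexp simp del: of_real_power)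
    fix z
    have "cmod (iexp (g z) - (1 + \<i> * g z - of_real ((g z)\<^sup>2) / 2)) \<le> \<bar>g z\<bar> ^ 3 / fact 3"
      using iexp_approx1[of "g z" 2] by (simp add: numeral_2_eq_2 numeral_3_eq_3 algebra_simps power2_eq_square)
    also have "\<dots> \<le> \<bar>g z\<bar> ^ 3" by (simp add: fact_numeral)
    finally show "cmod (iexp (g z) - (1 + \<i> * g z - of_real ((g z)\<^sup>2) / 2)) \<le> \<bar>g z\<bar> ^ 3" .
  qed fact
  finally show ?thesis .
qed

lemma norm_power_minus_one:
  fixes z :: complex
  shows "cmod ((1 + z) ^ n - 1) \<le> exp (n * cmod z) - 1"
proof -
  have "cmod ((1 + z) ^ n - 1) \<le> (1 + cmod z) ^ n - 1"
  proof (induction n)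
    case (Suc n)
    have "(1 + z) ^ Suc n - 1 = (1 + z) * ((1 + z) ^ n - 1) + z" by (simp add: algebra_simps)
    also have "cmod \<dots> \<le> cmod (1 + z) * cmod ((1 + z) ^ n - 1) + cmod z"
      by (metis norm_mult norm_triangle_ineq)
    also have "\<dots> \<le> (1 + cmod z) * ((1 + cmod z) ^ n - 1) + cmod z"
      using norm_triangle_ineq[of 1 z] by (intro add_right_mono mult_mono Suc) auto
    finally show ?case by (simp add: algebra_simps)
  qed simp
  also have "(1 + cmod z) ^ n \<le> exp (cmod z) ^ n"
    by (intro power_mono) auto
  also have "exp (cmod z) ^ n = exp (n * cmod z)" by (simp add: exp_of_nat_mult)
  finally show ?thesis by simp
qed

text \<open>
  Near the origin the characteristic function of a centred variable is a positive number \<open>a\<close> up to a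
  cubic error. As long as \<open>n\<close> times this error is small, the \<open>n\<close>-th power stays in a sector around the
  positive axis. This positivity makes it unnecessary to evaluate the limiting Gaussian integral.
\<close>
lemma Re_power_phase:
  fixes w :: complex and a e :: real
  assumes "1/2 \<le> a" "cmod (w - of_real a) \<le> e" "n * e \<le> 1/10" "\<bar>p\<bar> \<le> 1/4"
  shows "Re (w ^ n * iexp p) \<ge> a ^ n / 4"
proof -
  define z where "z = (w - of_real a) / of_real a"
  have w: "w = of_real a * (1 + z)" using assms(1) by (simp add: z_def field_simps)
  have "e \<ge> 0" using assms(2) norm_ge_zero order_trans by blast
  then have "e * 1 \<le> e * (2 * a)" using assms(1) by (intro mult_left_mono) auto
  then have "cmod z \<le> 2 * e" using assms(1,2)
    by (simp add: z_def norm_divide divide_simps)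
  then have "n * cmod z \<le> 1/5" using assms(3) mult_left_mono[of "cmod z" "2*e" n] by simp
  then have "exp (n * cmod z) \<le> exp (1/5)" by simp
  also have "exp (1/5::real) \<le> 1 + 1/5 + (1/5)\<^sup>2" by (rule exp_bound) auto
  finally have 1: "cmod ((1 + z) ^ n - 1) \<le> 1/4"
    using norm_power_minus_one[of z n] by (simp add: power2_eq_square)
  have 2: "cmod (iexp p - 1) \<le> 1/4" using iexp_approx1[of p 0] assms(4) by simp
  have "(1 + z) ^ n * iexp p - 1 = ((1 + z) ^ n - 1) * iexp p + (iexp p - 1)" by (simp add: algebra_simps)
  also have "cmod \<dots> \<le> 1/2" using norm_triangle_ineq[of "((1 + z) ^ n - 1) * iexp p" "iexp p - 1"] 1 2
    by (simp add: norm_mult)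
  finally have "\<bar>Re ((1 + z) ^ n * iexp p - 1)\<bar> \<le> 1/2" using abs_Re_le_cmod order_trans by blast
  then have "Re ((1 + z) ^ n * iexp p) \<ge> 1/2" unfolding minus_complex.sel one_complex.sel by linarith
  moreover have "Re (w ^ n * iexp p) = a ^ n * Re ((1 + z) ^ n * iexp p)"
    unfolding w power_mult_distrib by (simp add: mult.assoc flip: of_real_power)
  ultimately have "Re (w ^ n * iexp p) \<ge> a ^ n * (1/2)" using assms(1) by (simp only:) (intro mult_left_mono, auto)
  moreover have "a ^ n \<ge> 0" using assms(1) by simp
  ultimately show ?thesis by linarith
qed

lemma nn_integral_gauss_le:
  assumes "k > 0" shows "(\<integral>\<^sup>+x. ennreal (exp (- k * x\<^sup>2)) \<partial>lborel) = ennreal (sqrt (pi / k))"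
proof -
  define s where "s = 1 / sqrt (2 * k)"
  have s: "s > 0" "s\<^sup>2 = 1 / (2 * k)" using assms by (auto simp: s_def power_divide)
  have "ennreal (exp (- k * x\<^sup>2)) = ennreal (sqrt (pi / k)) * ennreal (normal_density 0 s x)" for x
  proof -
    have "2 * pi * s\<^sup>2 = pi / k" "- (x - 0)\<^sup>2 / (2 * s\<^sup>2) = - k * x\<^sup>2" using assms by (simp_all add: s field_simps)
    then have "normal_density 0 s x = 1 / sqrt (pi / k) * exp (- k * x\<^sup>2)" unfolding normal_density_def by simp
    then show ?thesis using assms by (simp flip: ennreal_mult)
  qed
  then have "(\<integral>\<^sup>+x. ennreal (exp (- k * x\<^sup>2)) \<partial>lborel) = ennreal (sqrt (pi / k)) * (\<integral>\<^sup>+x. ennreal (normal_density 0 s x) \<partial>lborel)"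
    by (simp add: nn_integral_cmult)
  also have "(\<integral>\<^sup>+x. ennreal (normal_density 0 s x) \<partial>lborel) = 1"
    using prob_space.emeasure_space_1[OF prob_space_normal_density[OF s(1), of 0]] by (simp add: emeasure_density)
  finally show ?thesis by simp
qed

definition joint_char :: "real measure \<Rightarrow> (real \<Rightarrow> real) \<Rightarrow> (real \<Rightarrow> real) \<Rightarrow> real \<Rightarrow> real \<Rightarrow> complex" where
  "joint_char D f g u v = (\<integral>z. iexp (u * f z + v * g z) \<partial>D)"

lemma joint_char_measurable [measurable]:
  assumes "prob_space D" and [measurable]: "f \<in> borel_measurable D" "g \<in> borel_measurable D"
  shows "(\<lambda>p. joint_char D f g (fst p) (snd p)) \<in> borel_measurable (borel \<Otimes>\<^sub>M borel)"
proof -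
  interpret prob_space D by fact
  show ?thesis unfolding joint_char_def by measurable
qed

lemma cmod_joint_char_le_1:
  assumes "prob_space D"
  shows "cmod (joint_char D f g u v) \<le> 1"
proof -
  interpret prob_space D by fact
  have "cmod (joint_char D f g u v) \<le> (\<integral>z. cmod (iexp (u * f z + v * g z)) \<partial>D)"
    unfolding joint_char_def by (rule integral_norm_bound)
  then show ?thesis by (simp add: prob_space del: of_real_add of_real_mult)
qed

text \<open>
  Fubini's theorem exchanges the law of the sums with the law of the frequencies.
\<close>
lemma smoothed_integral:
  assumes "real_distribution M1" "real_distribution M2"
    and D: "prob_space D" and [measurable]: "f \<in> borel_measurable D" "g \<in> borel_measurable D"
  shows "(\<integral>y. char M1 ((\<Sum>i<N. f (y i)) - o1) * char M2 ((\<Sum>i<N. g (y i)) - o2) \<partial>PiM {..<N} (\<lambda>_. D)) =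
    (\<integral>p. joint_char D f g (fst p) (snd p) ^ N * iexp (- (fst p * o1 + snd p * o2)) \<partial>(M1 \<Otimes>\<^sub>M M2))"
proof -
  interpret D: prob_space D by fact
  interpret M1: real_distribution M1 by fact
  interpret M2: real_distribution M2 by fact
  have [measurable_cong]: "sets M1 = sets borel" "sets M2 = sets borel" by simp_all
  interpret M: pair_prob_space M1 M2 ..
  let ?P = "PiM {..<N} (\<lambda>_. D)"
  interpret P: prob_space ?P by (intro prob_space_PiM D)
  interpret PM: pair_prob_space ?P "M1 \<Otimes>\<^sub>M M2" ..
  let ?F = "\<lambda>y. (\<Sum>i<N. f (y i)) - o1" and ?G = "\<lambda>y. (\<Sum>i<N. g (y i)) - o2"
  have [measurable]: "?F \<in> borel_measurable ?P" "?G \<in> borel_measurable ?P" by measurable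
  have "(\<integral>y. char M1 (?F y) * char M2 (?G y) \<partial>?P)
      = (\<integral>y. (\<integral>p. iexp (?F y * fst p + ?G y * snd p) \<partial>(M1 \<Otimes>\<^sub>M M2)) \<partial>?P)"
  proof (rule Bochner_Integration.integral_cong[OF refl])
    fix y
    have "char M1 (?F y) * char M2 (?G y) = (\<integral>p. iexp (?F y * fst p) * iexp (?G y * snd p) \<partial>(M1 \<Otimes>\<^sub>M M2))"
      unfolding char_def by (rule integral_product_prob[symmetric]) (auto intro: M1.prob_space_axioms M2.prob_space_axioms)
    also have "\<dots> = (\<integral>p. iexp (?F y * fst p + ?G y * snd p) \<partial>(M1 \<Otimes>\<^sub>M M2))"
      by (intro Bochner_Integration.integral_cong[OF refl]) (simp add: exp_add[symmetric] distrib_left)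
    finally show "char M1 (?F y) * char M2 (?G y) = (\<integral>p. iexp (?F y * fst p + ?G y * snd p) \<partial>(M1 \<Otimes>\<^sub>M M2))" .
  qed
  also have "\<dots> = (\<integral>p. (\<integral>y. iexp (?F y * fst p + ?G y * snd p) \<partial>?P) \<partial>(M1 \<Otimes>\<^sub>M M2))"
  proof (rule PM.Fubini_integral[symmetric])
    show "integrable (?P \<Otimes>\<^sub>M (M1 \<Otimes>\<^sub>M M2)) (\<lambda>(y, p). iexp (?F y * fst p + ?G y * snd p))"
      by (rule PM.integrable_const_bound[of _ 1]) (auto simp: split_def)
  qed
  also have "\<dots> = (\<integral>p. joint_char D f g (fst p) (snd p) ^ N * iexp (- (fst p * o1 + snd p * o2)) \<partial>(M1 \<Otimes>\<^sub>M M2))"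
  proof (rule Bochner_Integration.integral_cong[OF refl])
    fix p
    have "(\<integral>y. iexp (?F y * fst p + ?G y * snd p) \<partial>?P) =
       (\<integral>y. iexp (\<Sum>i<N. fst p * f (y i) + snd p * g (y i)) * iexp (- (fst p * o1 + snd p * o2)) \<partial>?P)"
      by (intro Bochner_Integration.integral_cong[OF refl])
         (simp add: exp_add[symmetric] sum.distrib sum_distrib_left algebra_simps)
    also have "\<dots> = (\<integral>y. iexp (\<Sum>i<N. fst p * f (y i) + snd p * g (y i)) \<partial>?P) * iexp (- (fst p * o1 + snd p * o2))"
      by simp
    also have "(\<integral>y. iexp (\<Sum>i<N. fst p * f (y i) + snd p * g (y i)) \<partial>?P) = joint_char D f g (fst p) (snd p) ^ N"
      unfolding joint_char_def by (rule integral_PiM_iexp_sum[OF D]) simp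
    finally show "(\<integral>y. iexp (?F y * fst p + ?G y * snd p) \<partial>?P) = joint_char D f g (fst p) (snd p) ^ N * iexp (- (fst p * o1 + snd p * o2))" .
  qed
  finally show ?thesis .
qed

text \<open>
  The Gaussian bound for the characteristic function has integral of order \<open>1 / N\<close> over the plane of
  frequencies, for every position \<open>(o1, o2)\<close> of the test function.
\<close>
lemma smoothed_upper:
  fixes N :: nat
  assumes D: "prob_space D" and [measurable]: "f \<in> borel_measurable D" "g \<in> borel_measurable D"
    and c: "c > 0" and bound: "\<And>u v. \<bar>u\<bar> \<le> 4 \<Longrightarrow> \<bar>v\<bar> \<le> 4 \<Longrightarrow> cmod (joint_char D f g u v) \<le> exp (- c * (u\<^sup>2 + v\<^sup>2))"
    and M1: "real_distribution M1" "AE u in M1. \<bar>u\<bar> \<le> 4" "\<And>h. h \<in> borel_measurable borel \<Longrightarrow> (\<integral>\<^sup>+x. h x \<partial>M1) \<le> (\<integral>\<^sup>+x. h x \<partial>lborel)"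
    and M2: "real_distribution M2" "AE u in M2. \<bar>u\<bar> \<le> 4" "\<And>h. h \<in> borel_measurable borel \<Longrightarrow> (\<integral>\<^sup>+x. h x \<partial>M2) \<le> (\<integral>\<^sup>+x. h x \<partial>lborel)"
    and "N > 0"
  shows "cmod (\<integral>y. char M1 ((\<Sum>i<N. f (y i)) - o1) * char M2 ((\<Sum>i<N. g (y i)) - o2) \<partial>PiM {..<N} (\<lambda>_. D)) \<le> pi / (c * N)"
proof -
  interpret M1: real_distribution M1 by fact
  interpret M2: real_distribution M2 by fact
  have [measurable_cong]: "sets M1 = sets borel" "sets M2 = sets borel" by simp_all
  interpret M: pair_prob_space M1 M2 ..
  note joint_char_measurable[OF D assms(2,3), measurable]
  let ?k = "c * N"
  have k: "?k > 0" using c \<open>N > 0\<close> by simp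
  let ?J = "\<lambda>p. joint_char D f g (fst p) (snd p) ^ N * iexp (- (fst p * o1 + snd p * o2))"
  have "ennreal (cmod (\<integral>p. ?J p \<partial>(M1 \<Otimes>\<^sub>M M2))) \<le> (\<integral>\<^sup>+p. cmod (?J p) \<partial>(M1 \<Otimes>\<^sub>M M2))"
    by (intro integral_norm_bound_ennreal M.integrable_const_bound[of _ 1])
       (auto simp: norm_mult norm_power intro!: power_le_one cmod_joint_char_le_1[OF D])
  also have "\<dots> = (\<integral>\<^sup>+u. \<integral>\<^sup>+v. cmod (joint_char D f g u v) ^ N \<partial>M2 \<partial>M1)"
    by (subst M2.nn_integral_fst[symmetric]) (auto simp: norm_mult norm_power)
  also have "\<dots> \<le> (\<integral>\<^sup>+u. \<integral>\<^sup>+v. ennreal (exp (- ?k * u\<^sup>2)) * ennreal (exp (- ?k * v\<^sup>2)) \<partial>M2 \<partial>M1)"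
  proof (rule nn_integral_mono_AE)
    show "AE u in M1. (\<integral>\<^sup>+v. cmod (joint_char D f g u v) ^ N \<partial>M2) \<le> (\<integral>\<^sup>+v. ennreal (exp (- ?k * u\<^sup>2)) * ennreal (exp (- ?k * v\<^sup>2)) \<partial>M2)"
      using M1(2)
    proof eventually_elim
      case (elim u)
      show ?case
      proof (rule nn_integral_mono_AE)
        show "AE v in M2. ennreal (cmod (joint_char D f g u v) ^ N) \<le> ennreal (exp (- ?k * u\<^sup>2)) * ennreal (exp (- ?k * v\<^sup>2))"
          using M2(2)
        proof eventually_elim
          case (elim v)
          have "cmod (joint_char D f g u v) ^ N \<le> exp (- c * (u\<^sup>2 + v\<^sup>2)) ^ N"
            using bound \<open>\<bar>u\<bar> \<le> 4\<close> elim by (intro power_mono) auto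
          also have "\<dots> = exp (- ?k * u\<^sup>2) * exp (- ?k * v\<^sup>2)"
            by (simp add: exp_of_nat_mult[symmetric] exp_add[symmetric] algebra_simps)
          finally show ?case by (simp flip: ennreal_mult)
        qed
      qed
    qed
  qed
  also have "\<dots> = (\<integral>\<^sup>+u. ennreal (exp (- ?k * u\<^sup>2)) \<partial>M1) * (\<integral>\<^sup>+v. ennreal (exp (- ?k * v\<^sup>2)) \<partial>M2)"
    by (simp add: nn_integral_cmult nn_integral_multc)
  also have "\<dots> \<le> ennreal (sqrt (pi / ?k)) * ennreal (sqrt (pi / ?k))"
    unfolding nn_integral_gauss_le[OF k, symmetric] by (intro mult_mono M1(3) M2(3)) auto
  also have "\<dots> = ennreal (pi / ?k)" using k by (simp flip: ennreal_mult)
  finally have "cmod (\<integral>p. ?J p \<partial>(M1 \<Otimes>\<^sub>M M2)) \<le> pi / ?k" using k by (subst (asm) ennreal_le_iff) auto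
  then show ?thesis unfolding smoothed_integral[OF M1(1) M2(1) D assms(2,3)] .
qed

text \<open>
  The plane of frequencies is split into a square of side \<open>2 * s\<close>, where the real part of the
  integrand is at least \<open>1/8\<close>, a larger square of side \<open>2 * \<tau>\<close>, where it is nonnegative, and the rest,
  where the integrand is exponentially small.
\<close>
lemma smoothed_lower:
  fixes N :: nat
  assumes D: "prob_space D" and [measurable]: "f \<in> borel_measurable D" "g \<in> borel_measurable D"
    and bound: "\<And>u v. \<bar>u\<bar> \<le> 4 \<Longrightarrow> \<bar>v\<bar> \<le> 4 \<Longrightarrow> cmod (joint_char D f g u v) \<le> exp (- c * (u\<^sup>2 + v\<^sup>2))"
    and c: "c > 0"
    and s: "0 \<le> s" "s \<le> 1/8" "s \<le> \<tau>" "\<tau> \<le> 4"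
    and near: "\<And>u v. \<bar>u\<bar> \<le> \<tau> \<Longrightarrow> \<bar>v\<bar> \<le> \<tau> \<Longrightarrow> Re (joint_char D f g u v ^ N * iexp (- (u * o1 + v * o2))) \<ge> 0"
    and vnear: "\<And>u v. \<bar>u\<bar> \<le> s \<Longrightarrow> \<bar>v\<bar> \<le> s \<Longrightarrow> Re (joint_char D f g u v ^ N * iexp (- (u * o1 + v * o2))) \<ge> 1/8"
  shows "(\<integral>y. (tri_char ((\<Sum>i<N. f (y i)) - o1))\<^sup>2 * (tri_char ((\<Sum>i<N. g (y i)) - o2))\<^sup>2 \<partial>PiM {..<N} (\<lambda>_. D))
     \<ge> s\<^sup>2 / 512 - exp (- c * N * \<tau>\<^sup>2)"
proof -
  let ?S = "smooth_kernel"
  interpret S: real_distribution ?S by (rule real_distribution_smooth)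
  have [measurable_cong]: "sets ?S = sets borel" by simp
  interpret M: pair_prob_space ?S ?S ..
  note joint_char_measurable[OF D assms(2,3), measurable]
  let ?J = "\<lambda>p. joint_char D f g (fst p) (snd p) ^ N * iexp (- (fst p * o1 + snd p * o2))"
  let ?I = "\<integral>y. (tri_char ((\<Sum>i<N. f (y i)) - o1))\<^sup>2 * (tri_char ((\<Sum>i<N. g (y i)) - o2))\<^sup>2 \<partial>PiM {..<N} (\<lambda>_. D)"
  have AE: "AE p in ?S \<Otimes>\<^sub>M ?S. \<bar>fst p\<bar> \<le> 4 \<and> \<bar>snd p\<bar> \<le> 4"
  proof (rule M.AE_pair_measure)
    show "AE x in ?S. AE y in ?S. \<bar>fst (x, y)\<bar> \<le> 4 \<and> \<bar>snd (x, y)\<bar> \<le> 4"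
      using smooth_bdd by eventually_elim (use smooth_bdd in eventually_elim, auto)
  qed measurable
  have int: "integrable (?S \<Otimes>\<^sub>M ?S) ?J"
    by (intro M.integrable_const_bound[of _ 1])
       (auto simp: norm_mult norm_power intro!: power_le_one cmod_joint_char_le_1[OF D])
  have "of_real ?I = (\<integral>y. char ?S ((\<Sum>i<N. f (y i)) - o1) * char ?S ((\<Sum>i<N. g (y i)) - o2) \<partial>PiM {..<N} (\<lambda>_. D))"
    unfolding char_smooth of_real_mult[symmetric] by (rule integral_complex_of_real[symmetric])
  also have "\<dots> = (\<integral>p. ?J p \<partial>(?S \<Otimes>\<^sub>M ?S))"
    by (rule smoothed_integral) (auto intro: real_distribution_smooth D)
  finally have "Re (of_real ?I) = Re (\<integral>p. ?J p \<partial>(?S \<Otimes>\<^sub>M ?S))" by (rule arg_cong)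
  then have I: "?I = (\<integral>p. Re (?J p) \<partial>(?S \<Otimes>\<^sub>M ?S))" by (simp only: integral_Re[OF int] Re_complex_of_real)
  let ?B = "{-s..s}"
  let ?E = "exp (- c * N * \<tau>\<^sup>2)"
  have "s\<^sup>2 / 512 - ?E = 1/8 * (s/8 * (s/8)) - ?E" by (simp add: power2_eq_square)
  also have "\<dots> \<le> 1/8 * (S.prob ?B * S.prob ?B) - ?E"
  proof -
    have "ennreal (s/8) \<le> S.prob ?B" using smooth_ge[of "-s" s] s by (simp add: S.emeasure_eq_measure)
    then have "s/8 \<le> S.prob ?B" by simp
    then show ?thesis using s by (intro diff_right_mono mult_left_mono mult_mono) auto
  qed
  also have "\<dots> = (\<integral>p. 1/8 * indicator (?B \<times> ?B) p - ?E \<partial>(?S \<Otimes>\<^sub>M ?S))"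
    using S.emeasure_pair_measure_Times[of ?B ?S ?B] 
    by (subst Bochner_Integration.integral_diff)
       (auto simp: M.prob_space M.emeasure_eq_measure S.emeasure_eq_measure ennreal_mult[symmetric] intro!: M.integrable_const_bound[of _ 1])
  also have "\<dots> \<le> (\<integral>p. Re (?J p) \<partial>(?S \<Otimes>\<^sub>M ?S))"
  proof (rule integral_mono_AE)
    show "integrable (?S \<Otimes>\<^sub>M ?S) (\<lambda>p. 1/8 * indicator (?B \<times> ?B) p - ?E)"
    proof (rule M.integrable_const_bound[of _ 2])
      have "?E \<le> 1" "0 \<le> ?E" using c by auto
      moreover have "\<bar>1/8 * x - y\<bar> \<le> 2" if "0 \<le> x" "x \<le> 1" "0 \<le> y" "y \<le> 1" for x y :: real
        using that by linarith
      ultimately have "norm (1/8 * indicator (?B \<times> ?B) p - ?E) \<le> 2" for p :: "real \<times> real"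
        unfolding real_norm_def by (simp add: indicator_def)
      then show "AE p in ?S \<Otimes>\<^sub>M ?S. norm (1/8 * indicator (?B \<times> ?B) p - ?E) \<le> 2" by simp
    qed measurable
    show "integrable (?S \<Otimes>\<^sub>M ?S) (\<lambda>p. Re (?J p))" using int by (rule integrable_Re)
    show "AE p in ?S \<Otimes>\<^sub>M ?S. 1/8 * indicator (?B \<times> ?B) p - ?E \<le> Re (?J p)"
      using AE
    proof eventually_elim
      case (elim p)
      obtain u v where p: "p = (u, v)" by (cases p)
      consider "\<bar>u\<bar> \<le> s" "\<bar>v\<bar> \<le> s" | "\<bar>u\<bar> \<le> \<tau>" "\<bar>v\<bar> \<le> \<tau>" "p \<notin> ?B \<times> ?B" | "\<bar>u\<bar> > \<tau> \<or> \<bar>v\<bar> > \<tau>" "p \<notin> ?B \<times> ?B"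
        using p s by (auto simp: abs_le_iff) linarith
      then show ?case
      proof cases
        case 1 
        then have "Re (?J p) \<ge> 1/8" using vnear p by simp
        moreover have "1/8 * indicator (?B \<times> ?B) p \<le> (1/8::real)" by (simp add: indicator_def)
        moreover have "?E > 0" by (rule exp_gt_zero)
        ultimately show ?thesis by linarith
      next
        case 2 
        then have "Re (?J p) \<ge> 0" using near p by simp
        moreover have "?E > 0" by (rule exp_gt_zero)
        moreover have "indicator (?B \<times> ?B) p = (0::real)" using 2(3) by (rule indicator_simps(2))
        ultimately show ?thesis by linarith
      next
        case 3
        have t: "\<tau>\<^sup>2 \<le> u\<^sup>2 + v\<^sup>2"
        proof -
          have "\<bar>\<tau>\<bar> \<le> \<bar>u\<bar> \<or> \<bar>\<tau>\<bar> \<le> \<bar>v\<bar>" using 3 s by linarith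
          then have "\<tau>\<^sup>2 \<le> u\<^sup>2 \<or> \<tau>\<^sup>2 \<le> v\<^sup>2" by (simp add: abs_le_square_iff)
          then show ?thesis using zero_le_power2[of u] zero_le_power2[of v] by linarith
        qed
        have "cmod (joint_char D f g u v) \<le> exp (- c * \<tau>\<^sup>2)"
          using order_trans[OF bound[of u v]] elim p t c by simp
        then have "cmod (?J p) \<le> exp (- c * \<tau>\<^sup>2) ^ N"
          by (simp add: norm_mult norm_power p power_mono)
        also have "\<dots> = ?E" by (simp add: exp_of_nat_mult[symmetric] algebra_simps)
        finally have "- ?E \<le> Re (?J p)" using abs_Re_le_cmod[of "?J p"] by linarith
        then show ?thesis using 3 by simp
      qed
    qed
  qed
  finally show ?thesis using I by simp
qed

definition window_prob :: "real measure \<Rightarrow> (real \<Rightarrow> real) \<Rightarrow> (real \<Rightarrow> real) \<Rightarrow> nat \<Rightarrow> real \<Rightarrow> real \<Rightarrow> real \<Rightarrow> real" where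
  "window_prob D f g N o1 o2 R = measure (PiM {..<N} (\<lambda>_. D)) {y \<in> space (PiM {..<N} (\<lambda>_. D)).
     \<bar>(\<Sum>i<N. f (y i)) - o1\<bar> \<le> R \<and> \<bar>(\<Sum>i<N. g (y i)) - o2\<bar> \<le> R}"

text \<open>
  The test function is at most 1 inside the window. Where the first coordinate is outside the window,
  \<open>\<bar>\<phi>\<bar>\<^sup>4 \<le> 4 / R\<^sup>2 * \<bar>\<phi>\<bar>\<^sup>2\<close>, and likewise for the second, so the contribution of the outside is of the
  same order \<open>1 / N\<close> as the main term, but with a factor \<open>1 / R\<^sup>2\<close> that a large constant \<open>R\<close> makes
  negligible.
\<close>
lemma smoothed_prob:
  fixes N :: nat
  assumes D: "prob_space D" and [measurable]: "f \<in> borel_measurable D" "g \<in> borel_measurable D"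
    and c: "c > 0" and bound: "\<And>u v. \<bar>u\<bar> \<le> 4 \<Longrightarrow> \<bar>v\<bar> \<le> 4 \<Longrightarrow> cmod (joint_char D f g u v) \<le> exp (- c * (u\<^sup>2 + v\<^sup>2))"
    and N: "N > 0" and R: "R > 0"
    and low: "(\<integral>y. (tri_char ((\<Sum>i<N. f (y i)) - o1))\<^sup>2 * (tri_char ((\<Sum>i<N. g (y i)) - o2))\<^sup>2 \<partial>PiM {..<N} (\<lambda>_. D)) \<ge> L"
  shows "window_prob D f g N o1 o2 R
    \<ge> L - 8 * pi / (R\<^sup>2 * c * N)"
proof -
  let ?P = "PiM {..<N} (\<lambda>_. D)"
  interpret P: prob_space ?P by (intro prob_space_PiM D)
  define F where "F y = (\<Sum>i<N. f (y i)) - o1" for y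
  define G where "G y = (\<Sum>i<N. g (y i)) - o2" for y
  have [measurable]: "F \<in> borel_measurable ?P" "G \<in> borel_measurable ?P" unfolding F_def G_def by measurable
  have [measurable]: "tri_char \<in> borel_measurable borel"
    unfolding tri_char_def using real_distribution.char_measurable[OF real_distribution_unit_uniform] by measurable
  have tri2: "0 \<le> (tri_char x)\<^sup>2" "(tri_char x)\<^sup>2 \<le> 1" "(tri_char x)\<^sup>2 \<le> tri_char x" for x
    using tri_char_nonneg[of x] tri_char_le_1[of x] power_le_one[of "tri_char x" 2] by (auto simp: power2_eq_square mult_left_le)
  have int: "integrable ?P (\<lambda>y. h1 (F y) * h2 (G y))" if "h1 \<in> borel_measurable borel" "h2 \<in> borel_measurable borel" "\<And>x. \<bar>h1 x\<bar> \<le> 1" "\<And>x. \<bar>h2 x\<bar> \<le> 1" for h1 h2 :: "real \<Rightarrow> real"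
  proof -
    note [measurable] = that(1,2)
    show ?thesis by (rule P.integrable_const_bound[of _ 1]) (auto simp: abs_mult intro!: mult_le_one that)
  qed
  have up1: "(\<integral>y. tri_char (F y) * (tri_char (G y))\<^sup>2 \<partial>?P) \<le> pi / (c * N)"
  proof -
    have "cmod (\<integral>y. char tri_kernel (F y) * char smooth_kernel (G y) \<partial>?P) \<le> pi / (c * N)"
      unfolding F_def G_def
      by (rule smoothed_upper[OF D assms(2,3) c bound]) (use N in \<open>auto intro: real_distribution_tri real_distribution_smooth tri_dom smooth_dom smooth_bdd AE_mp[OF tri_bdd]\<close>)
    then show ?thesis unfolding char_tri char_smooth of_real_mult[symmetric] integral_complex_of_real by simp
  qed
  have up2: "(\<integral>y. (tri_char (F y))\<^sup>2 * tri_char (G y) \<partial>?P) \<le> pi / (c * N)"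
  proof -
    have "cmod (\<integral>y. char smooth_kernel (F y) * char tri_kernel (G y) \<partial>?P) \<le> pi / (c * N)"
      unfolding F_def G_def
      by (rule smoothed_upper[OF D assms(2,3) c bound]) (use N in \<open>auto intro: real_distribution_tri real_distribution_smooth tri_dom smooth_dom smooth_bdd AE_mp[OF tri_bdd]\<close>)
    then show ?thesis unfolding char_tri char_smooth of_real_mult[symmetric] integral_complex_of_real by simp
  qed
  let ?B = "{y \<in> space ?P. \<bar>F y\<bar> \<le> R \<and> \<bar>G y\<bar> \<le> R}"
  have far: "(tri_char x)\<^sup>2 \<le> 4 / R\<^sup>2 * tri_char x" if "\<bar>x\<bar> > R" for x
  proof -
    have "R\<^sup>2 \<le> x\<^sup>2" using that R power_mono[of R "\<bar>x\<bar>" 2] by simp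
    then have "tri_char x * R\<^sup>2 \<le> 4" using tri_char_decay[of x] mult_left_mono[OF _ tri_char_nonneg[of x]] by force
    then have "tri_char x \<le> 4 / R\<^sup>2" using R by (simp add: field_simps)
    from mult_right_mono[OF this tri_char_nonneg[of x]] show ?thesis by (simp add: power2_eq_square)
  qed
  have "L \<le> (\<integral>y. (tri_char (F y))\<^sup>2 * (tri_char (G y))\<^sup>2 \<partial>?P)" using low by (simp add: F_def G_def)
  also have "\<dots> \<le> (\<integral>y. indicator ?B y + (4 / R\<^sup>2 * (tri_char (F y) * (tri_char (G y))\<^sup>2) + 4 / R\<^sup>2 * ((tri_char (F y))\<^sup>2 * tri_char (G y))) \<partial>?P)"
  proof (rule integral_mono_AE)
    show "integrable ?P (\<lambda>y. (tri_char (F y))\<^sup>2 * (tri_char (G y))\<^sup>2)"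
      by (rule int) (auto simp: tri2)
    show "integrable ?P (\<lambda>y. indicator ?B y + (4 / R\<^sup>2 * (tri_char (F y) * (tri_char (G y))\<^sup>2) + 4 / R\<^sup>2 * ((tri_char (F y))\<^sup>2 * tri_char (G y))))"
      by (intro Bochner_Integration.integrable_add integrable_mult_right int) (auto simp: tri2 tri_char_nonneg tri_char_le_1 intro!: P.integrable_const_bound[of _ 1])
    show "AE y in ?P. (tri_char (F y))\<^sup>2 * (tri_char (G y))\<^sup>2 \<le> indicator ?B y + (4 / R\<^sup>2 * (tri_char (F y) * (tri_char (G y))\<^sup>2) + 4 / R\<^sup>2 * ((tri_char (F y))\<^sup>2 * tri_char (G y)))"
    proof (intro AE_I2)
      fix y assume y: "y \<in> space ?P"
      have p1: "0 \<le> 4 / R\<^sup>2 * (tri_char (F y) * (tri_char (G y))\<^sup>2)" and p2: "0 \<le> 4 / R\<^sup>2 * ((tri_char (F y))\<^sup>2 * tri_char (G y))"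
        by (auto simp: tri_char_nonneg)
      have ind: "0 \<le> (indicator ?B y :: real)" by (rule indicator_pos_le)
      consider "y \<in> ?B" | "\<bar>F y\<bar> > R" | "\<bar>G y\<bar> > R" using y by force
      then show "(tri_char (F y))\<^sup>2 * (tri_char (G y))\<^sup>2 \<le> indicator ?B y + (4 / R\<^sup>2 * (tri_char (F y) * (tri_char (G y))\<^sup>2) + 4 / R\<^sup>2 * ((tri_char (F y))\<^sup>2 * tri_char (G y)))"
      proof cases
        case 1
        then show ?thesis using p1 p2 mult_le_one[OF tri2(2)[of "F y"] tri2(1)[of "G y"] tri2(2)] by simp
      next
        case 2
        have "(tri_char (F y))\<^sup>2 * (tri_char (G y))\<^sup>2 \<le> (4 / R\<^sup>2 * tri_char (F y)) * (tri_char (G y))\<^sup>2"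
          by (intro mult_right_mono far 2) auto
        also have "\<dots> = 4 / R\<^sup>2 * (tri_char (F y) * (tri_char (G y))\<^sup>2)" by (simp only: mult.assoc)
        finally show ?thesis using p2 ind by linarith
      next
        case 3
        have "(tri_char (F y))\<^sup>2 * (tri_char (G y))\<^sup>2 \<le> (tri_char (F y))\<^sup>2 * (4 / R\<^sup>2 * tri_char (G y))"
          by (intro mult_left_mono far 3) auto
        also have "\<dots> = 4 / R\<^sup>2 * ((tri_char (F y))\<^sup>2 * tri_char (G y))" by (simp only: mult.assoc mult.left_commute)
        finally show ?thesis using p1 ind by linarith
      qed
    qed
  qed
  also have "\<dots> = P.prob ?B + (4 / R\<^sup>2 * (\<integral>y. tri_char (F y) * (tri_char (G y))\<^sup>2 \<partial>?P) + 4 / R\<^sup>2 * (\<integral>y. (tri_char (F y))\<^sup>2 * tri_char (G y) \<partial>?P))"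
  proof -
    have "integrable ?P (\<lambda>y. tri_char (F y) * (tri_char (G y))\<^sup>2)" "integrable ?P (\<lambda>y. (tri_char (F y))\<^sup>2 * tri_char (G y))"
      by (intro int; auto simp: tri2 tri_char_nonneg tri_char_le_1)+
    moreover have "integrable ?P (indicator ?B :: _ \<Rightarrow> real)" by (auto intro!: P.integrable_const_bound[of _ 1])
    moreover have "(\<integral>y. indicator ?B y \<partial>?P) = P.prob ?B" 
    proof -
      have "?B \<inter> space ?P = ?B" by blast
      then show ?thesis using Bochner_Integration.integral_indicator[of ?P ?B] P.emeasure_finite by (simp del: Int_Collect)
    qed
    ultimately show ?thesis by simp
  qed
  also have "\<dots> \<le> P.prob ?B + (4 / R\<^sup>2 * (pi / (c * N)) + 4 / R\<^sup>2 * (pi / (c * N)))"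
    by (intro add_left_mono add_mono mult_left_mono up1 up2) auto
  also have "\<dots> = P.prob ?B + 8 * pi / (R\<^sup>2 * c * N)" using R c N by (simp add: field_simps)
  finally show ?thesis unfolding F_def G_def window_prob_def by simp
qed

text \<open>
  The quantifiers matter: the radius \<open>R\<close> and the constant \<open>c'\<close> are fixed before the bound \<open>O1\<close> for the
  offset of the window. Later the offset is chosen much larger than \<open>R\<close>, so that the error \<open>R\<close> is small
  compared with the sums that the last two coordinates have to supply.
\<close>
lemma local_lower_bound:
  assumes D: "prob_space D" and [measurable]: "f \<in> borel_measurable D" "g \<in> borel_measurable D"
    and c: "c > 0" and bound: "\<And>u v. \<bar>u\<bar> \<le> 4 \<Longrightarrow> \<bar>v\<bar> \<le> 4 \<Longrightarrow> cmod (joint_char D f g u v) \<le> exp (- c * (u\<^sup>2 + v\<^sup>2))"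
    and C2: "C2 > 0" and C3: "C3 > 0"
    and taylor: "\<And>u v. \<bar>u\<bar> \<le> 4 \<Longrightarrow> \<bar>v\<bar> \<le> 4 \<Longrightarrow> cmod (joint_char D f g u v - of_real (a u v)) \<le> C3 * (\<bar>u\<bar> + \<bar>v\<bar>) ^ 3"
    and a: "\<And>u v. \<bar>u\<bar> \<le> 4 \<Longrightarrow> \<bar>v\<bar> \<le> 4 \<Longrightarrow> 1/2 \<le> a u v"  "\<And>u v. 1 - C2 * (u\<^sup>2 + v\<^sup>2) \<le> a u v"
  shows "\<exists>R>0. \<exists>c'>0. \<forall>O1. \<exists>N0. \<forall>N\<ge>N0. \<forall>o1 o2. \<bar>o1\<bar> \<le> O1 \<longrightarrow> \<bar>o2\<bar> \<le> O1 \<longrightarrow>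
    window_prob D f g N o1 o2 R
    \<ge> c' / real N"
proof -
  \<comment> \<open>With this scale the main term is at least \<open>1/2\<close> on the square of side \<open>2 * s0 / sqrt N\<close>.\<close>
  define s0 where "s0 = 1 / (2 * sqrt C2)"
  have s0: "s0 > 0" "C2 * s0\<^sup>2 = 1/4" using C2 by (auto simp: s0_def field_simps power2_eq_square)
  \<comment> \<open>The tail of the test function is then a quarter of the main term.\<close>
  define R where "R = sqrt (16384 * pi / (c * s0\<^sup>2))"
  have R: "R > 0" "R\<^sup>2 = 16384 * pi / (c * s0\<^sup>2)" using c s0 by (auto simp: R_def)
  have main: "\<exists>N0. \<forall>N\<ge>N0. \<forall>o1 o2. \<bar>o1\<bar> \<le> O1 \<longrightarrow> \<bar>o2\<bar> \<le> O1 \<longrightarrow>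
    window_prob D f g N o1 o2 R
    \<ge> (s0\<^sup>2 / 1024) / real N" for O1
  proof -
    \<comment> \<open>At this scale the phase error \<open>N * tau ^ 3\<close> tends to zero while \<open>N * tau\<^sup>2\<close> tends to infinity.\<close>
    define tau where "tau N = real N powr (-2/5)" for N
    have e1: "eventually (\<lambda>N. exp (- c * real N * (tau N)\<^sup>2) \<le> s0\<^sup>2 / 2048 / real N) at_top"
    proof -
      have "((\<lambda>N::nat. exp (- c * real N * (tau N)\<^sup>2) * real N) \<longlongrightarrow> 0) at_top"
        unfolding tau_def using c by real_asymp
      then have "eventually (\<lambda>N::nat. exp (- c * real N * (tau N)\<^sup>2) * real N < s0\<^sup>2 / 2048) at_top"
        using s0 by (intro order_tendstoD) auto
      then show ?thesis using eventually_gt_at_top[of 0] by eventually_elim (simp add: field_simps)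
    qed
    have e2: "eventually (\<lambda>N. real N * (C3 * (2 * tau N) ^ 3) < 1/10) at_top"
    proof (rule order_tendstoD)
      show "((\<lambda>N::nat. real N * (C3 * (2 * tau N) ^ 3)) \<longlongrightarrow> 0) at_top"
        unfolding tau_def by real_asymp
    qed auto
    have e3: "eventually (\<lambda>N. 2 * tau N * \<bar>O1\<bar> < 1/4) at_top"
    proof (rule order_tendstoD)
      show "((\<lambda>N::nat. 2 * tau N * \<bar>O1\<bar>) \<longlongrightarrow> 0) at_top"
        unfolding tau_def by real_asymp
    qed auto
    have e4: "eventually (\<lambda>N. s0 / sqrt (real N) \<le> tau N) at_top"
    proof -
      have "((\<lambda>N::nat. (s0 / sqrt (real N)) / tau N) \<longlongrightarrow> 0) at_top"
        unfolding tau_def by real_asymp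
      then have "eventually (\<lambda>N::nat. (s0 / sqrt (real N)) / tau N < 1) at_top"
        by (intro order_tendstoD) auto
      then show ?thesis using eventually_gt_at_top[of 0] by eventually_elim (simp add: tau_def field_simps)
    qed
    have e5: "eventually (\<lambda>N. tau N < 1/8) at_top"
    proof (rule order_tendstoD)
      show "((\<lambda>N::nat. tau N) \<longlongrightarrow> 0) at_top" unfolding tau_def by real_asymp
    qed auto
    have "eventually (\<lambda>N. \<forall>o1 o2. \<bar>o1\<bar> \<le> O1 \<longrightarrow> \<bar>o2\<bar> \<le> O1 \<longrightarrow>
    window_prob D f g N o1 o2 R
    \<ge> (s0\<^sup>2 / 1024) / real N) at_top"
      using e1 e2 e3 e4 e5 eventually_gt_at_top[of 0]
    proof eventually_elim
      case (elim N)
      define s where "s = s0 / sqrt (real N)"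
      define t where "t = tau N"
      have s: "0 \<le> s" "s \<le> t" "t \<le> 1/8" using elim s0 by (auto simp: s_def t_def)
      then have s18: "s \<le> 1/8" by linarith
      have s2: "s\<^sup>2 = s0\<^sup>2 / N" by (simp add: s_def power_divide)
      show ?case
      proof (intro allI impI)
        fix o1 o2 :: real assume o: "\<bar>o1\<bar> \<le> O1" "\<bar>o2\<bar> \<le> O1"
        have ph: "Re (joint_char D f g u v ^ N * iexp (- (u * o1 + v * o2))) \<ge> a u v ^ N / 4"
          if uv: "\<bar>u\<bar> \<le> t" "\<bar>v\<bar> \<le> t" for u v
        proof (rule Re_power_phase)
          have uv4: "\<bar>u\<bar> \<le> 4" "\<bar>v\<bar> \<le> 4" using uv s by auto
          show "1/2 \<le> a u v" using a(1) uv4 .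
          have "cmod (joint_char D f g u v - of_real (a u v)) \<le> C3 * (\<bar>u\<bar> + \<bar>v\<bar>) ^ 3" by (rule taylor[OF uv4])
          also have "\<dots> \<le> C3 * (2 * t) ^ 3" using uv C3 by (intro mult_left_mono power_mono) auto
          finally show "cmod (joint_char D f g u v - of_real (a u v)) \<le> C3 * (2 * t) ^ 3" .
          show "real N * (C3 * (2 * t) ^ 3) \<le> 1/10" using elim by (simp add: t_def)
          have "\<bar>u * o1 + v * o2\<bar> \<le> \<bar>u\<bar> * \<bar>o1\<bar> + \<bar>v\<bar> * \<bar>o2\<bar>" by (metis abs_mult abs_triangle_ineq)
          also have "\<dots> \<le> t * \<bar>O1\<bar> + t * \<bar>O1\<bar>" using uv o s by (intro add_mono mult_mono) auto
          also have "\<dots> \<le> 1/4" using elim by (simp add: t_def mult_ac)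
          finally show "\<bar>- (u * o1 + v * o2)\<bar> \<le> 1/4" by (simp only: abs_minus_cancel)
        qed
        have "(\<integral>y. (tri_char ((\<Sum>i<N. f (y i)) - o1))\<^sup>2 * (tri_char ((\<Sum>i<N. g (y i)) - o2))\<^sup>2 \<partial>PiM {..<N} (\<lambda>_. D))
           \<ge> s\<^sup>2 / 512 - exp (- c * N * t\<^sup>2)"
        proof (rule smoothed_lower[OF D assms(2,3) bound c])
          fix u v assume uv: "\<bar>u\<bar> \<le> t" "\<bar>v\<bar> \<le> t"
          have "0 \<le> a u v ^ N / 4" using a(1)[of u v] uv s by simp
          then show "0 \<le> Re (joint_char D f g u v ^ N * iexp (- (u * o1 + v * o2)))" using ph[OF uv] by linarith
        next
          fix u v assume uv: "\<bar>u\<bar> \<le> s" "\<bar>v\<bar> \<le> s"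
          have "u\<^sup>2 \<le> s\<^sup>2" "v\<^sup>2 \<le> s\<^sup>2" using uv s by (auto simp: abs_le_square_iff[symmetric])
          then have "C2 * (u\<^sup>2 + v\<^sup>2) \<le> C2 * (2 * s\<^sup>2)" using C2 by (intro mult_left_mono) auto
          also have "\<dots> = 1 / (2 * N)" using s0(2) elim by (simp add: s2 field_simps)
          finally have "1 + - (1 / (2 * real N)) \<le> a u v" using a(2)[of u v] by linarith
          then have "(1 + - (1 / (2 * real N))) ^ N \<le> a u v ^ N" using elim by (intro power_mono) (auto simp: field_simps)
          moreover have "1 + real N * - (1 / (2 * real N)) \<le> (1 + - (1 / (2 * real N))) ^ N"
            using elim by (intro Bernoulli_inequality) (auto simp: field_simps)
          ultimately have "1/2 \<le> a u v ^ N" using elim by simp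
          then show "1/8 \<le> Re (joint_char D f g u v ^ N * iexp (- (u * o1 + v * o2)))" using ph[of u v] uv s by linarith
        qed (use s s18 in auto)
        from smoothed_prob[OF D assms(2,3) c bound _ R(1) this]
        have "window_prob D f g N o1 o2 R
           \<ge> s\<^sup>2 / 512 - exp (- c * N * t\<^sup>2) - 8 * pi / (R\<^sup>2 * c * N)" using elim by simp
        moreover have "8 * pi / (R\<^sup>2 * c * N) = s0\<^sup>2 / 2048 / N" using c s0 by (simp add: R(2))
        moreover have "exp (- c * N * t\<^sup>2) \<le> s0\<^sup>2 / 2048 / real N" using elim by (simp add: t_def)
        moreover have "s\<^sup>2 / 512 = s0\<^sup>2 / 512 / N" by (simp add: s2)
        moreover have "s0\<^sup>2 / 512 / N - s0\<^sup>2 / 2048 / N - s0\<^sup>2 / 2048 / N = s0\<^sup>2 / 1024 / N" using elim by (simp add: field_simps)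
        ultimately show "(s0\<^sup>2 / 1024) / real N \<le> window_prob D f g N o1 o2 R"
          by linarith
      qed
    qed
    then show ?thesis by (simp add: eventually_at_top_linorder)
  qed
  show ?thesis using R(1) s0 main by (intro exI[of _ R] exI[of _ "s0\<^sup>2 / 1024"] conjI) auto
qed

section \<open>Gibbs densities\<close>

lemma gibbs_weight_nonneg: "0 \<le> gibbs_weight r s x"
  by (simp add: gibbs_weight_def)

lemma gibbs_weight_measurable [measurable]: "gibbs_weight r s \<in> borel_measurable borel"
  unfolding gibbs_weight_def by measurable

lemma nonneg_bounded_below_not_integrable:
  assumes "integrable lborel (f :: real \<Rightarrow> real)" "\<And>x. x \<ge> 0 \<Longrightarrow> f x \<ge> c" "\<And>x. f x \<ge> 0" "c > 0"
  shows False
proof -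
  have "(\<integral>\<^sup>+x. f x \<partial>lborel) < \<infinity>"
    using assms by (simp add: nn_integral_eq_integral)
  moreover have "(\<integral>\<^sup>+x. f x \<partial>lborel) \<ge> (\<integral>\<^sup>+x. ennreal c * indicator {0..real n} x \<partial>lborel)" for n
    by (intro nn_integral_mono) (auto split: split_indicator intro!: ennreal_leI assms)
  ultimately have "ennreal (c * real n) < \<infinity> \<and> ennreal (c * real n) \<le> (\<integral>\<^sup>+x. f x \<partial>lborel)" for n
    using assms(4) by (auto simp: nn_integral_cmult_indicator ennreal_mult intro: le_less_trans)
  moreover obtain B where "B \<ge> 0" "(\<integral>\<^sup>+x. f x \<partial>lborel) = ennreal B"
    using assms by (metis ennreal_cases nn_integral_eq_integral AE_I2 integral_nonneg_AE)
  ultimately have "c * real n \<le> B" for n using assms(4) by (simp add: ennreal_le_iff)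
  then show False using assms(4) reals_Archimedean3[of c] by (metis le_less_trans linorder_not_less mult.commute)
qed

text \<open>
  Integrability forces \<open>r > 0\<close>, or \<open>r = 0\<close> and \<open>s > 0\<close>; otherwise completing the square bounds the
  weight away from zero on the half-line. If \<open>r > 0\<close>, completing the square shows an exponential tail
  of rate 1.
\<close>
lemma gibbs_weight_tail:
  assumes "integrable lborel (gibbs_weight r s)"
  shows "\<exists>C>0. \<exists>\<alpha>>0. \<forall>x. gibbs_weight r s x \<le> C * (indicator {0..} x * exp (- \<alpha> * x))"
proof -
  consider "r > 0" | "r \<le> 0" "s > 0" "r = 0" | "r \<le> 0" "r = 0 \<longrightarrow> s \<le> 0" by linarith
  then show ?thesis
  proof cases
    case 1
    have "- r * x\<^sup>2 - s * x \<le> (s - 1)\<^sup>2 / (4 * r) + - 1 * x" for x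
    proof -
      have "0 \<le> (2 * r * x + (s - 1))\<^sup>2" by simp
      then show ?thesis using 1 by (simp add: field_simps power2_eq_square)
    qed
    then have "exp (- r * x\<^sup>2 - s * x) \<le> exp ((s - 1)\<^sup>2 / (4 * r)) * exp (- 1 * x)" for x
      by (simp flip: exp_add)
    then show ?thesis
      by (intro exI[of _ "exp ((s - 1)\<^sup>2 / (4 * r))"] conjI exI[of _ "1::real"] allI)
         (auto simp: gibbs_weight_def split: split_indicator)
  next
    case 2
    then show ?thesis by (intro exI[of _ 1] exI[of _ s]) (auto simp: gibbs_weight_def)
  next
    case 3
    have "\<exists>c. \<forall>x\<ge>0. c \<le> - r * x\<^sup>2 - s * x"
    proof (cases "r = 0")
      case True
      then show ?thesis using 3 by (intro exI[of _ 0]) (auto simp: mult_nonpos_nonneg)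
    next
      case False
      then have "r < 0" using 3 by simp
      have "s\<^sup>2 / (4 * r) \<le> - r * x\<^sup>2 - s * x" for x
      proof -
        have "0 \<le> (2 * r * x + s)\<^sup>2" by simp
        then show ?thesis using \<open>r < 0\<close> by (simp add: field_simps power2_eq_square)
      qed
      then show ?thesis by auto
    qed
    then obtain c where "\<And>x. x \<ge> 0 \<Longrightarrow> c \<le> - r * x\<^sup>2 - s * x" by auto
    then have "\<And>x. x \<ge> 0 \<Longrightarrow> gibbs_weight r s x \<ge> exp c" by (simp add: gibbs_weight_def)
    from nonneg_bounded_below_not_integrable[OF assms this gibbs_weight_nonneg] show ?thesis by simp
  qed
qed

locale gibbs =
  fixes r s :: real
  assumes int_weight: "integrable lborel (gibbs_weight r s)"
begin

definition Zc :: real where "Zc = (\<integral>y. gibbs_weight r s y \<partial>lborel)"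

abbreviation D :: "real measure" where "D \<equiv> gibbs_measure r s"

lemma Zc_pos: "Zc > 0"
proof -
  have "Zc \<noteq> 0"
  proof
    assume "Zc = 0"
    then have "AE x in lborel. gibbs_weight r s x = 0"
      using integral_nonneg_eq_0_iff_AE[OF int_weight] by (auto simp: Zc_def gibbs_weight_nonneg)
    then have "AE x in lborel. x \<notin> {0..1::real}" by eventually_elim (auto simp: gibbs_weight_def)
    then have "emeasure lborel {0..1::real} = 0" by (subst (asm) AE_iff_measurable[of "{0..1}"]) auto
    then show False by simp
  qed
  moreover have "Zc \<ge> 0" unfolding Zc_def by (intro integral_nonneg_AE) (simp add: gibbs_weight_nonneg)
  ultimately show ?thesis by simp
qed

lemma D_density: "D = density lborel (\<lambda>x. ennreal (gibbs_weight r s x / Zc))"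
  by (simp add: gibbs_measure_def Zc_def)

lemma sets_D [simp, measurable_cong]: "sets D = sets borel" by (simp add: D_density)
lemma space_D [simp]: "space D = UNIV" by (simp add: D_density)

lemma prob_space_D: "prob_space D"
proof
  have "emeasure D (space D) = (\<integral>\<^sup>+x. gibbs_weight r s x / Zc \<partial>lborel)"
    by (simp add: D_density emeasure_density)
  also have "\<dots> = ennreal (\<integral>x. gibbs_weight r s x / Zc \<partial>lborel)"
    using Zc_pos int_weight by (intro nn_integral_eq_integral) (auto simp: gibbs_weight_nonneg)
  also have "\<dots> = 1" using Zc_pos by (simp add: Zc_def)
  finally show "emeasure D (space D) = 1" .
qed

sublocale D: real_distribution D
  by (intro real_distribution.intro real_distribution_axioms.intro prob_space_D) auto

lemma AE_D_nonneg: "AE x in D. 0 \<le> x"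
  unfolding D_density by (subst AE_density) (auto simp: gibbs_weight_def split: split_indicator)

lemma integrable_D_iff:
  fixes f :: "real \<Rightarrow> real"
  assumes [measurable]: "f \<in> borel_measurable borel"
  shows "integrable D f \<longleftrightarrow> integrable lborel (\<lambda>x. gibbs_weight r s x * f x)"
proof -
  have "integrable D f \<longleftrightarrow> integrable lborel (\<lambda>x. (gibbs_weight r s x / Zc) * f x)"
    unfolding D_density using Zc_pos by (subst integrable_density) (auto simp: gibbs_weight_nonneg)
  also have "\<dots> \<longleftrightarrow> integrable lborel (\<lambda>x. (1 / Zc) * (gibbs_weight r s x * f x))" by simp
  also have "\<dots> \<longleftrightarrow> integrable lborel (\<lambda>x. gibbs_weight r s x * f x)"
    using Zc_pos by (subst integrable_mult_left_iff) auto
  finally show ?thesis .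
qed

lemma integrable_moment: "integrable D (\<lambda>x. x ^ k)"
proof -
  from gibbs_weight_tail[OF int_weight] obtain C \<alpha> where C: "C > 0" "\<alpha> > 0"
    "\<And>x. gibbs_weight r s x \<le> C * (indicator {0..} x * exp (- \<alpha> * x))" by auto
  have "integrable lborel (erlang_density k \<alpha>)"
    using nn_integral_erlang_ith_moment[OF C(2), where k=k and i=0] C(2) by (intro integrableI_nonneg) auto
  then have i: "integrable lborel (\<lambda>x. (C * fact k / \<alpha> ^ Suc k) * erlang_density k \<alpha> x)" by (rule integrable_mult_right)
  show ?thesis
  proof (subst integrable_D_iff)
    show "integrable lborel (\<lambda>x. gibbs_weight r s x * x ^ k)"
    proof (rule Bochner_Integration.integrable_bound[OF i], measurable, intro AE_I2)
      fix x :: real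
      show "norm (gibbs_weight r s x * x ^ k) \<le> norm ((C * fact k / \<alpha> ^ Suc k) * erlang_density k \<alpha> x)"
      proof (cases "x \<ge> 0")
        case True
        have "(C * fact k / \<alpha> ^ Suc k) * erlang_density k \<alpha> x = C * exp (- \<alpha> * x) * x ^ k"
          using True C by (simp add: erlang_density_def)
        moreover have "gibbs_weight r s x * x ^ k \<le> C * exp (- \<alpha> * x) * x ^ k"
          using C(3)[of x] True by (intro mult_right_mono) auto
        ultimately show ?thesis using True C gibbs_weight_nonneg[of r s x] by simp
      qed (simp add: gibbs_weight_def)
    qed
  qed simp
qed

lemma weight_bounded: "\<exists>L>0. \<forall>x. gibbs_weight r s x / Zc \<le> L"
proof -
  from gibbs_weight_tail[OF int_weight] obtain C \<alpha> where C: "C > 0" "\<alpha> > 0"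
    "\<And>x. gibbs_weight r s x \<le> C * (indicator {0..} x * exp (- \<alpha> * x))" by auto
  have "gibbs_weight r s x \<le> C" for x
  proof -
    have "indicator {0..} x * exp (- \<alpha> * x) \<le> (1::real)" using C by (auto split: split_indicator)
    then show ?thesis using C(3)[of x] C(1) mult_left_mono[of "indicator {0..} x * exp (- \<alpha> * x)" 1 C] by linarith
  qed
  then show ?thesis using C Zc_pos by (intro exI[of _ "C / Zc"]) (auto simp: divide_simps)
qed

lemma prob_interval_le: 
  assumes "\<And>x. gibbs_weight r s x / Zc \<le> L" "a \<le> b"
  shows "D.prob {a..b} \<le> L * (b - a)"
proof -
  have "emeasure D {a..b} = (\<integral>\<^sup>+x. ennreal (gibbs_weight r s x / Zc) * indicator {a..b} x \<partial>lborel)"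
    unfolding D_density by (simp add: emeasure_density)
  also have "\<dots> \<le> (\<integral>\<^sup>+x. ennreal L * indicator {a..b} x \<partial>lborel)"
    by (intro nn_integral_mono mult_right_mono ennreal_leI assms) auto
  also have "\<dots> = ennreal (L * (b - a))"
    using assms order_trans[OF _ assms(1)[of 0]] gibbs_weight_nonneg Zc_pos
    by (simp add: nn_integral_cmult_indicator ennreal_mult)
  finally show ?thesis using assms order_trans[OF _ assms(1)[of 0]] gibbs_weight_nonneg Zc_pos
    by (simp add: D.emeasure_eq_measure ennreal_le_iff)
qed

end

context gibbs begin

lemma prob_finite_0: "finite S \<Longrightarrow> D.prob S = 0"
proof (induction S rule: finite_induct)
  case (insert x S)
  obtain L where "\<And>x. gibbs_weight r s x / Zc \<le> L" using weight_bounded by auto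
  from prob_interval_le[OF this, of x x] have "D.prob {x} = 0" by (simp add: measure_le_0_iff)
  have "D.prob (insert x S) = D.prob ({x} \<union> S)" by simp
  also have "\<dots> \<le> D.prob {x} + D.prob S" 
    using insert.hyps by (intro measure_Un_le) (auto intro: finite_imp_closed borel_closed)
  finally show ?case using insert \<open>D.prob {x} = 0\<close> by (simp add: measure_le_0_iff)
qed simp

text \<open>
  A nonzero polynomial has finitely many roots, and the Gibbs measure has no atoms. For quadratic
  polynomials this says that \<open>z\<close> and \<open>z\<^sup>2\<close> are affinely independent, that is, that their covariance
  matrix is nondegenerate.
\<close>
lemma poly_nondegenerate:
  assumes "p \<noteq> 0"
  shows "(\<integral>z. (poly p z)\<^sup>2 \<partial>D) > 0"
proof -
  have int: "integrable D (\<lambda>z. (poly p z)\<^sup>2)"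
  proof -
    have "(\<lambda>z. (poly p z)\<^sup>2) = (\<lambda>z. \<Sum>i\<le>degree (p * p). coeff (p * p) i * z ^ i)"
      by (auto simp: poly_altdef[symmetric] power2_eq_square)
    then show ?thesis by (auto intro!: integrable_moment Bochner_Integration.integrable_sum integrable_mult_right)
  qed
  have "(\<integral>z. (poly p z)\<^sup>2 \<partial>D) \<noteq> 0"
  proof
    assume "(\<integral>z. (poly p z)\<^sup>2 \<partial>D) = 0"
    then have "AE z in D. (poly p z)\<^sup>2 = 0" by (subst (asm) integral_nonneg_eq_0_iff_AE[OF int]) auto
    then have "AE z in D. z \<in> {z. poly p z = 0}" by eventually_elim simp
    moreover have f: "finite {z. poly p z = 0}" using assms by (rule poly_roots_finite)
    ultimately have "D.prob {z. poly p z = 0} = 1"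
      by (subst D.prob_eq_1) (auto intro: finite_imp_closed borel_closed)
    then show False using prob_finite_0[OF f] by simp
  qed
  moreover have "(\<integral>z. (poly p z)\<^sup>2 \<partial>D) \<ge> 0" by (intro integral_nonneg_AE) auto
  ultimately show ?thesis by (metis less_le)
qed

abbreviation P :: "nat \<Rightarrow> (nat \<Rightarrow> real) measure" where "P n \<equiv> PiM {..<n} (\<lambda>_. D)"

definition moment_window :: "nat \<Rightarrow> real \<Rightarrow> real \<Rightarrow> real \<Rightarrow> real \<Rightarrow> (nat \<Rightarrow> real) set" where
  "moment_window N b o1 o2 R = {y \<in> space (P N). \<bar>(\<Sum>i<N. y i) - real N - o1\<bar> \<le> R \<and> \<bar>(\<Sum>i<N. (y i)\<^sup>2) - real N * b - o2\<bar> \<le> R}"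

text \<open>
  The general bound is applied to small multiples of \<open>z - 1\<close> and \<open>z\<^sup>2 - b\<close>. Shrinking both variables
  by the same factor makes the cubic Taylor error small compared with the covariance form on the whole
  support \<open>[-4, 4]\<^sup>2\<close> of the smoothing kernels.
\<close>
lemma gibbs_local_lower_bound:
  assumes m1: "(\<integral>z. z \<partial>D) = 1" and m2: "(\<integral>z. z\<^sup>2 \<partial>D) = b"
  shows "\<exists>R>0. \<exists>c>0. \<forall>O1. \<exists>N0. \<forall>N\<ge>N0. \<forall>o1 o2. \<bar>o1\<bar> \<le> O1 \<longrightarrow> \<bar>o2\<bar> \<le> O1 \<longrightarrow>
    measure (P N) (moment_window N b o1 o2 R) \<ge> c / real N"
proof -
  have i1 [simp]: "integrable D (\<lambda>z. z)" using integrable_moment[of 1] by simp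
  have ik [simp]: "integrable D (\<lambda>z. z ^ k)" for k by (rule integrable_moment)
  let ?q = "\<lambda>u v. \<integral>z. (u * (z - 1) + v * (z\<^sup>2 - b))\<^sup>2 \<partial>D"
  define a11 where "a11 = ?q 1 0"
  define a22 where "a22 = ?q 0 1"
  define a12 where "a12 = (\<integral>z. (z - 1) * (z\<^sup>2 - b) \<partial>D)"
  have iA: "integrable D (\<lambda>z. (z - 1)\<^sup>2)" "integrable D (\<lambda>z. (z - 1) * (z\<^sup>2 - b))" "integrable D (\<lambda>z. (z\<^sup>2 - b)\<^sup>2)"
  proof -
    have "(\<lambda>z::real. (z - 1)\<^sup>2) = (\<lambda>z. z^2 - 2 * z + 1)" "(\<lambda>z. (z - 1) * (z\<^sup>2 - b)) = (\<lambda>z. z^3 - z^2 - b * z + b)"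
      "(\<lambda>z. (z\<^sup>2 - b)\<^sup>2) = (\<lambda>z. z^4 - 2 * b * z^2 + b^2)"
      by (auto simp: power2_eq_square power3_eq_cube power4_eq_xxxx algebra_simps)
    then show "integrable D (\<lambda>z. (z - 1)\<^sup>2)" "integrable D (\<lambda>z. (z - 1) * (z\<^sup>2 - b))" "integrable D (\<lambda>z. (z\<^sup>2 - b)\<^sup>2)"
      by simp_all
  qed
  have q: "?q u v = u\<^sup>2 * a11 + 2 * u * v * a12 + v\<^sup>2 * a22" for u v
  proof -
    have "(\<lambda>z. (u * (z - 1) + v * (z\<^sup>2 - b))\<^sup>2) = (\<lambda>z. u\<^sup>2 * (z - 1)\<^sup>2 + 2 * u * v * ((z - 1) * (z\<^sup>2 - b)) + v\<^sup>2 * (z\<^sup>2 - b)\<^sup>2)"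
      by (auto simp: power2_eq_square algebra_simps)
    then show ?thesis using iA by (simp add: a11_def a12_def a22_def)
  qed
  have qpos: "?q u v > 0" if "u \<noteq> 0 \<or> v \<noteq> 0" for u v
    using poly_nondegenerate[of "[:- u - v * b, u, v:]"] that by (simp add: algebra_simps power2_eq_square)
  have a11: "a11 > 0" "a22 > 0" using qpos[of 1 0] qpos[of 0 1] by (auto simp: a11_def a22_def)
  define tr where "tr = a11 + a22"
  define dt where "dt = a11 * a22 - a12\<^sup>2"
  have "dt > 0"
  proof -
    have "0 < ?q (- a12) a11" using a11 by (intro qpos) auto
    also have "\<dots> = a11 * dt" unfolding q dt_def by (simp add: power2_eq_square algebra_simps)
    finally show ?thesis using a11 by (simp add: zero_less_mult_iff)
  qed
  have tr: "tr > 0" using a11 by (simp add: tr_def)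
  \<comment> \<open>The smaller eigenvalue of a positive definite 2 by 2 matrix is at least determinant by trace.\<close>
  define c2 where "c2 = dt / tr"
  have c2: "c2 > 0" using tr \<open>dt > 0\<close> by (simp add: c2_def)
  have qlow: "c2 * (u\<^sup>2 + v\<^sup>2) \<le> ?q u v" for u v
  proof -
    \<comment> \<open>The square of the matrix is \<open>tr\<close> times the matrix minus \<open>dt\<close> times the identity.\<close>
    have "tr * ?q u v - dt * (u\<^sup>2 + v\<^sup>2) = (a11 * u + a12 * v)\<^sup>2 + (a12 * u + a22 * v)\<^sup>2"
      unfolding q tr_def dt_def by (simp add: power2_eq_square algebra_simps)
    also have "\<dots> \<ge> 0" by simp
    finally have "dt * (u\<^sup>2 + v\<^sup>2) \<le> tr * ?q u v" by simp
    then show ?thesis using tr by (simp add: c2_def field_simps)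
  qed
  have qup: "?q u v \<le> tr * (u\<^sup>2 + v\<^sup>2)" for u v
  proof -
    \<comment> \<open>The forms at \<open>(u, v)\<close> and \<open>(v, - u)\<close> add up to the trace times \<open>u\<^sup>2 + v\<^sup>2\<close>.\<close>
    have "0 \<le> ?q v (- u)" by (intro integral_nonneg_AE) auto
    then show ?thesis unfolding q tr_def by (simp add: power2_eq_square algebra_simps)
  qed
  define W where "W z = 2 * z\<^sup>2 + (3 + \<bar>b\<bar>)" for z :: real
  define M3 where "M3 = (\<integral>z. W z ^ 3 \<partial>D)"
  have W: "\<bar>u * (z - 1) + v * (z\<^sup>2 - b)\<bar> \<le> (\<bar>u\<bar> + \<bar>v\<bar>) * W z" for u v z
  proof -
    have "\<bar>z\<bar> \<le> 1 + z\<^sup>2" using zero_le_power2[of "\<bar>z\<bar> - 1"] by (simp add: power2_eq_square algebra_simps)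
    then have "\<bar>z - 1\<bar> \<le> W z" by (simp add: W_def)
    moreover have "\<bar>z\<^sup>2 - b\<bar> \<le> W z" using zero_le_power2[of z] unfolding W_def by linarith
    ultimately have "\<bar>u\<bar> * \<bar>z - 1\<bar> + \<bar>v\<bar> * \<bar>z\<^sup>2 - b\<bar> \<le> \<bar>u\<bar> * W z + \<bar>v\<bar> * W z"
      by (intro add_mono mult_left_mono) auto
    moreover have "\<bar>u * (z - 1) + v * (z\<^sup>2 - b)\<bar> \<le> \<bar>u\<bar> * \<bar>z - 1\<bar> + \<bar>v\<bar> * \<bar>z\<^sup>2 - b\<bar>"
      by (metis abs_mult abs_triangle_ineq)
    ultimately show ?thesis by (simp add: distrib_right)
  qed
  have W1: "W z \<ge> 1" for z by (simp add: W_def)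
  have iW: "integrable D (\<lambda>z. W z ^ 3)"
  proof -
    have "(\<lambda>z. W z ^ 3) = (\<lambda>z. 8 * z^6 + 12 * (3 + \<bar>b\<bar>) * z^4 + 6 * (3 + \<bar>b\<bar>)^2 * z^2 + (3 + \<bar>b\<bar>)^3)"
      unfolding W_def by (rule ext) algebra
    then show ?thesis by simp
  qed
  have i3: "integrable D (\<lambda>z. \<bar>u * (z - 1) + v * (z\<^sup>2 - b)\<bar> ^ 3)" "(\<integral>z. \<bar>u * (z - 1) + v * (z\<^sup>2 - b)\<bar> ^ 3 \<partial>D) \<le> (\<bar>u\<bar> + \<bar>v\<bar>) ^ 3 * M3" for u v
  proof -
    have le: "\<bar>u * (z - 1) + v * (z\<^sup>2 - b)\<bar> ^ 3 \<le> (\<bar>u\<bar> + \<bar>v\<bar>) ^ 3 * W z ^ 3" for z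
      using power_mono[OF W[of u z v], of 3] by (simp add: power_mult_distrib)
    have iW': "integrable D (\<lambda>z. (\<bar>u\<bar> + \<bar>v\<bar>) ^ 3 * W z ^ 3)" using iW by simp
    show i: "integrable D (\<lambda>z. \<bar>u * (z - 1) + v * (z\<^sup>2 - b)\<bar> ^ 3)"
      by (rule Bochner_Integration.integrable_bound[OF iW'])
         (use le W1 in \<open>auto intro!: AE_I2 simp: order_trans[OF zero_le_one W1]\<close>)
    have "(\<integral>z. \<bar>u * (z - 1) + v * (z\<^sup>2 - b)\<bar> ^ 3 \<partial>D) \<le> (\<integral>z. (\<bar>u\<bar> + \<bar>v\<bar>) ^ 3 * W z ^ 3 \<partial>D)"
      by (intro integral_mono i iW' le)
    then show "(\<integral>z. \<bar>u * (z - 1) + v * (z\<^sup>2 - b)\<bar> ^ 3 \<partial>D) \<le> (\<bar>u\<bar> + \<bar>v\<bar>) ^ 3 * M3" by (simp add: M3_def)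
  qed
  have M3: "M3 > 0"
  proof -
    have "1 = (\<integral>z. (1::real) \<partial>D)" using D.prob_space by simp
    also have "\<dots> \<le> M3" unfolding M3_def using W1 by (intro integral_mono iW) auto
    finally show ?thesis by simp
  qed
  \<comment> \<open>Small enough for the cubic error to be at most half the quadratic term on \<open>[-4, 4]\<^sup>2\<close>.\<close>
  define k where "k = Min {1, c2 / (64 * M3), 1 / (32 * tr)}"
  have k: "k > 0" "k \<le> 1" "k * M3 \<le> c2 / 64" "k * tr \<le> 1 / 32"
  proof -
    show "k > 0" using c2 M3 tr by (simp add: k_def)
    show "k \<le> 1" by (simp add: k_def)
    have "k \<le> c2 / (64 * M3)" "k \<le> 1 / (32 * tr)" by (simp_all add: k_def)
    then show "k * M3 \<le> c2 / 64" "k * tr \<le> 1 / 32" using M3 tr by (simp_all add: field_simps)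
  qed
  have ktr: "k\<^sup>2 * tr \<le> 1/32"
    using mult_mono[OF k(2) k(4)] k tr by (simp add: power2_eq_square mult.assoc)
  define f where "f z = k * (z - 1)" for z :: real
  define g where "g z = k * (z\<^sup>2 - b)" for z :: real
  define a where "a u v = 1 - k\<^sup>2 * ?q u v / 2" for u v
  have taylor: "cmod (joint_char D f g u v - of_real (a u v)) \<le> k ^ 3 * M3 * (\<bar>u\<bar> + \<bar>v\<bar>) ^ 3" for u v
  proof -
    have e: "u * f z + v * g z = (u * k) * (z - 1) + (v * k) * (z\<^sup>2 - b)" for z by (simp add: f_def g_def algebra_simps)
    have "cmod ((\<integral>z. iexp (u * f z + v * g z) \<partial>D) - of_real (1 - (\<integral>z. (u * f z + v * g z)\<^sup>2 \<partial>D) / 2)) \<le> (\<integral>z. \<bar>u * f z + v * g z\<bar> ^ 3 \<partial>D)"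
    proof (rule char_quadratic[OF prob_space_D])
      show "(\<lambda>z. u * f z + v * g z) \<in> borel_measurable D" unfolding f_def g_def by measurable
      show "integrable D (\<lambda>z. \<bar>u * f z + v * g z\<bar> ^ 3)" unfolding e by (rule i3)
      have "(\<lambda>z. (u * f z + v * g z)\<^sup>2) = (\<lambda>z. (u * k)\<^sup>2 * (z - 1)\<^sup>2 + 2 * (u * k) * (v * k) * ((z - 1) * (z\<^sup>2 - b)) + (v * k)\<^sup>2 * (z\<^sup>2 - b)\<^sup>2)"
        unfolding e by (auto simp: power2_eq_square algebra_simps)
      then show "integrable D (\<lambda>z. (u * f z + v * g z)\<^sup>2)" using iA by simp
      show "integrable D (\<lambda>z. u * f z + v * g z)" unfolding e by simp
      show "(\<integral>z. u * f z + v * g z \<partial>D) = 0" unfolding e using m1 m2 by (simp add: D.prob_space[simplified])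
    qed
    moreover have "(\<integral>z. (u * f z + v * g z)\<^sup>2 \<partial>D) = k\<^sup>2 * ?q u v"
      unfolding e q by (simp add: power2_eq_square algebra_simps)
    moreover have "(\<integral>z. \<bar>u * f z + v * g z\<bar> ^ 3 \<partial>D) \<le> k ^ 3 * M3 * (\<bar>u\<bar> + \<bar>v\<bar>) ^ 3"
      unfolding e using i3(2)[of "u * k" "v * k"] k(1) by (simp add: abs_mult power_mult_distrib flip: distrib_right) (simp add: mult_ac)
    ultimately show ?thesis unfolding joint_char_def a_def by simp
  qed
  have ahalf: "1/2 \<le> a u v" if "\<bar>u\<bar> \<le> 4" "\<bar>v\<bar> \<le> 4" for u v
  proof -
    have "u\<^sup>2 \<le> 4\<^sup>2" "v\<^sup>2 \<le> 4\<^sup>2" using that power_mono[of "\<bar>u\<bar>" 4 2] power_mono[of "\<bar>v\<bar>" 4 2] by simp_all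
    then have "u\<^sup>2 + v\<^sup>2 \<le> 32" by simp
    have "k\<^sup>2 * ?q u v \<le> k\<^sup>2 * (tr * (u\<^sup>2 + v\<^sup>2))" by (intro mult_left_mono qup) auto
    also have "\<dots> \<le> 1/32 * 32" unfolding mult.assoc[symmetric] using ktr \<open>u\<^sup>2 + v\<^sup>2 \<le> 32\<close> by (intro mult_mono) auto
    finally show ?thesis by (simp add: a_def)
  qed
  have bound: "cmod (joint_char D f g u v) \<le> exp (- (k\<^sup>2 * c2 / 4) * (u\<^sup>2 + v\<^sup>2))" if uv: "\<bar>u\<bar> \<le> 4" "\<bar>v\<bar> \<le> 4" for u v
  proof -
    have "joint_char D f g u v = (joint_char D f g u v - of_real (a u v)) + of_real (a u v)" by simp
    then have "cmod (joint_char D f g u v) \<le> cmod (joint_char D f g u v - of_real (a u v)) + cmod (of_real (a u v))"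
      by (metis norm_triangle_ineq)
    also have "\<dots> \<le> k ^ 3 * M3 * (\<bar>u\<bar> + \<bar>v\<bar>) ^ 3 + a u v"
      using taylor[of u v] ahalf[OF uv] by simp
    also have "k ^ 3 * M3 * (\<bar>u\<bar> + \<bar>v\<bar>) ^ 3 = k\<^sup>2 * ((k * M3) * ((\<bar>u\<bar> + \<bar>v\<bar>) * (\<bar>u\<bar> + \<bar>v\<bar>)\<^sup>2))"
      by (simp add: power2_eq_square power3_eq_cube)
    also have "\<dots> \<le> k\<^sup>2 * ((c2 / 64) * (8 * (2 * (u\<^sup>2 + v\<^sup>2))))"
    proof -
      have "(\<bar>u\<bar> + \<bar>v\<bar>)\<^sup>2 \<le> 2 * (u\<^sup>2 + v\<^sup>2)"
        using zero_le_power2[of "\<bar>u\<bar> - \<bar>v\<bar>"] by (simp add: power2_eq_square algebra_simps)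
      then show ?thesis using uv k M3 c2 by (intro mult_left_mono mult_mono) auto
    qed
    also have "a u v \<le> 1 - k\<^sup>2 * (c2 * (u\<^sup>2 + v\<^sup>2)) / 2"
      unfolding a_def using mult_left_mono[OF qlow[of u v], of "k\<^sup>2"] by simp
    finally have "cmod (joint_char D f g u v) \<le> k\<^sup>2 * ((c2 / 64) * (8 * (2 * (u\<^sup>2 + v\<^sup>2)))) + (1 - k\<^sup>2 * (c2 * (u\<^sup>2 + v\<^sup>2)) / 2)" by simp
    also have "\<dots> = 1 + (- (k\<^sup>2 * c2 / 4) * (u\<^sup>2 + v\<^sup>2))" by (simp add: field_simps)
    also have "\<dots> \<le> exp (- (k\<^sup>2 * c2 / 4) * (u\<^sup>2 + v\<^sup>2))" by (rule exp_ge_add_one_self)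
    finally show ?thesis .
  qed
  have "\<exists>R>0. \<exists>c'>0. \<forall>O1. \<exists>N0. \<forall>N\<ge>N0. \<forall>o1 o2. \<bar>o1\<bar> \<le> O1 \<longrightarrow> \<bar>o2\<bar> \<le> O1 \<longrightarrow>
    window_prob D f g N o1 o2 R
    \<ge> c' / real N"
  proof (rule local_lower_bound[OF prob_space_D _ _ _ bound _ _ taylor ahalf])
    show "f \<in> borel_measurable D" "g \<in> borel_measurable D" unfolding f_def g_def by measurable
    show "k\<^sup>2 * c2 / 4 > 0" "k ^ 3 * M3 > 0" "k\<^sup>2 * tr > 0" using k c2 M3 tr by auto
    fix u v
    show "1 - k\<^sup>2 * tr * (u\<^sup>2 + v\<^sup>2) \<le> a u v"
      using mult_left_mono[OF qup[of u v] zero_le_power2[of k]]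
        mult_nonneg_nonneg[OF zero_le_power2[of k] order_trans[OF mult_nonneg_nonneg[OF less_imp_le[OF c2] sum_power2_ge_zero] qlow[of u v]]]
      unfolding a_def mult.assoc by linarith
  qed auto
  then obtain R c' where R: "R > 0" "c' > 0" and llt: "\<And>O1. \<exists>N0. \<forall>N\<ge>N0. \<forall>o1 o2. \<bar>o1\<bar> \<le> O1 \<longrightarrow> \<bar>o2\<bar> \<le> O1 \<longrightarrow>
    window_prob D f g N o1 o2 R
    \<ge> c' / real N" by blast
  have eq: "\<bar>(\<Sum>i<N. f (y i)) - k * o1\<bar> \<le> R \<longleftrightarrow> \<bar>(\<Sum>i<N. y i) - real N - o1\<bar> \<le> R / k"
    "\<bar>(\<Sum>i<N. g (y i)) - k * o2\<bar> \<le> R \<longleftrightarrow> \<bar>(\<Sum>i<N. (y i)\<^sup>2) - real N * b - o2\<bar> \<le> R / k" for N :: nat and y o1 o2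
  proof -
    have "(\<Sum>i<N. f (y i)) - k * o1 = k * ((\<Sum>i<N. y i) - real N - o1)" 
      "(\<Sum>i<N. g (y i)) - k * o2 = k * ((\<Sum>i<N. (y i)\<^sup>2) - real N * b - o2)"
      by (simp_all add: f_def g_def sum_distrib_left[symmetric] sum_subtractf algebra_simps)
    then show "\<bar>(\<Sum>i<N. f (y i)) - k * o1\<bar> \<le> R \<longleftrightarrow> \<bar>(\<Sum>i<N. y i) - real N - o1\<bar> \<le> R / k"
      "\<bar>(\<Sum>i<N. g (y i)) - k * o2\<bar> \<le> R \<longleftrightarrow> \<bar>(\<Sum>i<N. (y i)\<^sup>2) - real N * b - o2\<bar> \<le> R / k"
      using k(1) by (simp_all add: abs_mult pos_le_divide_eq mult.commute)
  qed
  show ?thesis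
  proof (rule exI[of _ "R / k"], intro conjI, use R k in simp, rule exI[of _ c'], intro conjI allI, use R in simp)
    fix O1
    obtain N0 where N0: "\<And>N o1 o2. N \<ge> N0 \<Longrightarrow> \<bar>o1\<bar> \<le> k * O1 \<Longrightarrow> \<bar>o2\<bar> \<le> k * O1 \<Longrightarrow>
      window_prob D f g N o1 o2 R
    \<ge> c' / real N" using llt[of "k * O1"] by blast
    show "\<exists>N0. \<forall>N\<ge>N0. \<forall>o1 o2. \<bar>o1\<bar> \<le> O1 \<longrightarrow> \<bar>o2\<bar> \<le> O1 \<longrightarrow>
       measure (P N) (moment_window N b o1 o2 (R / k)) \<ge> c' / real N"
    proof (intro exI[of _ N0] allI impI)
      fix N o1 o2 assume "N0 \<le> N" "\<bar>o1\<bar> \<le> O1" "\<bar>o2\<bar> \<le> O1"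
      then show "measure (P N) (moment_window N b o1 o2 (R / k)) \<ge> c' / real N"
        using N0[of N "k * o1" "k * o2"] k(1) unfolding window_prob_def moment_window_def eq by (simp add: abs_mult)
    qed
  qed
qed

end

lemma gibbs_params_gibbs: "gibbs_params b r s \<Longrightarrow> gibbs r s"
  by (simp add: gibbs_params_def gibbs_def)

lemma (in gibbs) gibbs_params_moments:
  assumes "gibbs_params b r s"
  shows "(\<integral>z. z \<partial>D) = 1" "(\<integral>z. z\<^sup>2 \<partial>D) = b"
  using assms by (auto simp: gibbs_params_def dest: has_bochner_integral_integral_eq)

text \<open>
  For two such densities \<open>p\<close> and \<open>p'\<close>, the function \<open>ln p - ln p'\<close> is a quadratic polynomial on the
  half-line. As the moments of order 0, 1 and 2 agree, the integral of
  \<open>(p - p') * (ln p - ln p')\<close> is zero. The integrand is nonnegative, so the polynomial vanishes almost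
  everywhere.
\<close>
lemma gibbs_params_unique:
  assumes "gibbs_params b r s" "gibbs_params b r' s'"
  shows "r = r' \<and> s = s'"
proof -
  interpret g: gibbs r s using assms(1) by (rule gibbs_params_gibbs)
  interpret g': gibbs r' s' using assms(2) by (rule gibbs_params_gibbs)
  define c where "c = ln g.Zc - ln g'.Zc"
  define q where "q = [:- c, - (s - s'), - (r - r'):]"
  have h: "poly q x = - c - (s - s') * x - (r - r') * x\<^sup>2" for x by (simp add: q_def power2_eq_square algebra_simps)
  define p where "p x = gibbs_weight r s x / g.Zc" for x
  define p' where "p' x = gibbs_weight r' s' x / g'.Zc" for x
  have [measurable]: "p \<in> borel_measurable borel" "p' \<in> borel_measurable borel" unfolding p_def p'_def by measurable
  have p0: "0 \<le> p x" "0 \<le> p' x" for x using g.Zc_pos g'.Zc_pos by (auto simp: p_def p'_def gibbs_weight_nonneg)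
  have i: "integrable g.D (poly q)" "integrable g'.D (poly q)"
    using g.integrable_moment[of 1] g.integrable_moment[of 2] g'.integrable_moment[of 1] g'.integrable_moment[of 2]
    unfolding h by simp_all
  have Dh: "(\<integral>x. poly q x \<partial>g.D) = - c - (s - s') - (r - r') * b"
    using g.gibbs_params_moments[OF assms(1)] g.integrable_moment[of 1] g.integrable_moment[of 2] 
    unfolding h by (simp add: g.D.prob_space[simplified])
  have Dh': "(\<integral>x. poly q x \<partial>g'.D) = - c - (s - s') - (r - r') * b"
    using g'.gibbs_params_moments[OF assms(2)] g'.integrable_moment[of 1] g'.integrable_moment[of 2] 
    unfolding h by (simp add: g'.D.prob_space[simplified])
  have qm: "poly q \<in> borel_measurable lborel" unfolding h by measurable
  have il: "integrable lborel (\<lambda>x. p x * poly q x)" "(\<integral>x. poly q x \<partial>g.D) = (\<integral>x. p x * poly q x \<partial>lborel)"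
    using i(1) unfolding g.D_density p_def[symmetric] using p0 qm
    by (auto simp: integrable_density integral_density)
  have il': "integrable lborel (\<lambda>x. p' x * poly q x)" "(\<integral>x. poly q x \<partial>g'.D) = (\<integral>x. p' x * poly q x \<partial>lborel)"
    using i(2) unfolding g'.D_density p'_def[symmetric] using p0 qm
    by (auto simp: integrable_density integral_density)
  have lnp: "poly q x = ln (p x) - ln (p' x)" "p x > 0" "p' x > 0" if "x \<ge> 0" for x
  proof -
    show "p x > 0" "p' x > 0" using that g.Zc_pos g'.Zc_pos by (auto simp: p_def p'_def gibbs_weight_def)
    show "poly q x = ln (p x) - ln (p' x)"
      using that g.Zc_pos g'.Zc_pos by (simp add: p_def p'_def gibbs_weight_def ln_div h c_def algebra_simps)
  qed
  have nonneg: "(p x - p' x) * poly q x \<ge> 0" for x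
  proof (cases "x \<ge> 0")
    case True
    have "(p x - p' x) * (ln (p x) - ln (p' x)) \<ge> 0"
      using lnp(2,3)[OF True] by (cases "p x \<ge> p' x") (auto intro!: mult_nonneg_nonneg mult_nonpos_nonpos)
    then show ?thesis using lnp(1)[OF True] by simp
  qed (simp add: p_def p'_def gibbs_weight_def)
  have int: "integrable lborel (\<lambda>x. (p x - p' x) * poly q x)"
    using Bochner_Integration.integrable_diff[OF il(1) il'(1)] by (simp add: left_diff_distrib)
  have "(\<integral>x. (p x - p' x) * poly q x \<partial>lborel) = (\<integral>x. p x * poly q x - p' x * poly q x \<partial>lborel)"
    by (simp only: left_diff_distrib)
  also have "\<dots> = (\<integral>x. poly q x \<partial>g.D) - (\<integral>x. poly q x \<partial>g'.D)"
    unfolding il(2) il'(2) by (rule Bochner_Integration.integral_diff[OF il(1) il'(1)])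
  also have "\<dots> = 0" by (simp only: Dh Dh' diff_self)
  finally have "AE x in lborel. (p x - p' x) * poly q x = 0"
    using integral_nonneg_eq_0_iff_AE[OF int] nonneg by auto
  then have AE0: "AE x in lborel. 0 \<le> x \<longrightarrow> poly q x = 0"
  proof eventually_elim
    case (elim x)
    show ?case
    proof
      assume x: "0 \<le> x"
      then show "poly q x = 0" using elim lnp(1)[OF x] by auto
    qed
  qed
  have "AE x in g.D. poly q x = 0"
    unfolding g.D_density by (subst AE_density) (use AE0 in \<open>auto elim!: eventually_mono simp: gibbs_weight_def indicator_def split: if_splits\<close>)
  then have "(\<integral>x. (poly q x)\<^sup>2 \<partial>g.D) = (\<integral>x. 0 \<partial>g.D)"
    by (intro integral_cong_AE) (auto simp: h)
  then have "q = 0" using g.poly_nondegenerate[of q] by fastforce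
  then show ?thesis by (simp add: q_def)
qed

section \<open>Rotation invariance of Lebesgue measure\<close>

text \<open>
  Lebesgue measure on the same space of extensional functions on which the measures of the theorem
  live, so that both can be integrated against each other without changing spaces.
\<close>
abbreviation lam :: "nat \<Rightarrow> (nat \<Rightarrow> real) measure" where
  "lam n \<equiv> PiM {..<n} (\<lambda>_. lborel)"

interpretation lborel_prod: product_sigma_finite "\<lambda>_::nat. lborel :: real measure" ..

lemma sigma_finite_lam: "sigma_finite_measure (lam n)"
  by (rule lborel_prod.sigma_finite) simp

lemma sets_lam: "sets (lam n) = sets (PiM {..<n} (\<lambda>_. borel))"
  by (rule sets_PiM_cong) auto

lemma space_lam: "space (lam n) = {..<n} \<rightarrow>\<^sub>E UNIV" by (simp add: space_PiM)

lemma lam_coordinate: "i < n \<Longrightarrow> (\<lambda>y. y i) \<in> borel_measurable (lam n)"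
  using measurable_component_singleton[of i "{..<n}" "\<lambda>_. lborel"] by simp

lemma lam_all_coordinates:
  assumes "Measurable.pred borel Q"
  shows "Measurable.pred (lam n) (\<lambda>y. \<forall>i\<in>{..<n}. Q (y i))"
  by (intro pred_intros_finite) (auto intro: measurable_compose[OF lam_coordinate assms])

lemma distr_lborel_reflect: "distr lborel borel (\<lambda>t. a - t) = (lborel :: real measure)"
  using lborel_affine[of "-1" a] by (simp add: fun_eq_iff density_1 sgn_if)

lemma lam_reflect:
  "distr (lam n) (lam n) (\<lambda>y. \<lambda>i\<in>{..<n}. a i - y i) = lam n"
proof (rule lborel_prod.PiM_eqI)
  fix A :: "nat \<Rightarrow> real set" assume A: "\<And>i. i \<in> {..<n} \<Longrightarrow> A i \<in> sets lborel"
  have "emeasure (distr (lam n) (lam n) (\<lambda>y. \<lambda>i\<in>{..<n}. a i - y i)) (Pi\<^sub>E {..<n} A)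
      = emeasure (lam n) ((\<lambda>y. \<lambda>i\<in>{..<n}. a i - y i) -` (Pi\<^sub>E {..<n} A) \<inter> space (lam n))"
    using A by (subst emeasure_distr) (auto intro!: sets_PiM_I_finite)
  also have "(\<lambda>y. \<lambda>i\<in>{..<n}. a i - y i) -` (Pi\<^sub>E {..<n} A) \<inter> space (lam n) = Pi\<^sub>E {..<n} (\<lambda>i. (\<lambda>t. a i - t) -` A i)"
    by (auto simp: space_PiM PiE_def Pi_def)
  also have "emeasure (lam n) \<dots> = (\<Prod>i<n. emeasure lborel ((\<lambda>t. a i - t) -` A i))"
    using A by (intro lborel_prod.emeasure_PiM) (auto intro!: measurable_sets_borel[of _ borel])
  also have "\<dots> = (\<Prod>i<n. emeasure lborel (A i))"
  proof (rule prod.cong[OF refl])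
    fix i assume "i \<in> {..<n}"
    have "emeasure lborel (A i) = emeasure (distr lborel borel (\<lambda>t. a i - t)) (A i)" by (simp add: distr_lborel_reflect)
    also have "\<dots> = emeasure lborel ((\<lambda>t. a i - t) -` A i)"
      using A[OF \<open>i \<in> {..<n}\<close>] by (subst emeasure_distr) auto
    finally show "emeasure lborel ((\<lambda>t. a i - t) -` A i) = emeasure lborel (A i)" ..
  qed
  finally show "emeasure (distr (lam n) (lam n) (\<lambda>y. \<lambda>i\<in>{..<n}. a i - y i)) (Pi\<^sub>E {..<n} A) = (\<Prod>i\<in>{..<n}. emeasure lborel (A i))" .
qed auto

text \<open>
  In the double integral of \<open>indicator A x * indicator B y\<close> the substitutions of \<open>x - y\<close> for \<open>y\<close>, of
  \<open>x + y\<close> for \<open>x\<close>, and again a reflection of \<open>y\<close> preserve the integral and exchange the roles of \<open>x\<close>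
  and \<open>y\<close>.
\<close>
lemma translation_invariant_proportional:
  assumes "sigma_finite_measure M" and sets: "sets M = sets (lam n)"
    and inv: "\<And>a. a \<in> space (lam n) \<Longrightarrow> distr M M (\<lambda>x. \<lambda>i\<in>{..<n}. x i + a i) = M"
    and A: "A \<in> sets (lam n)" and B: "B \<in> sets (lam n)"
  shows "emeasure M A * emeasure (lam n) B = emeasure M B * emeasure (lam n) A"
proof -
  interpret M: sigma_finite_measure M by fact
  interpret L: sigma_finite_measure "lam n" by (rule sigma_finite_lam)
  interpret P: pair_sigma_finite M "lam n" ..
  note [measurable] = A B
  note [measurable_cong] = sets
  let ?plus = "\<lambda>x y. \<lambda>i\<in>{..<n}. x i + y i :: real"
  let ?minus = "\<lambda>x y. \<lambda>i\<in>{..<n}. x i - y i :: real"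
  have spM: "space M = space (lam n)" using sets by (rule sets_eq_imp_space_eq)
  have mp: "(\<lambda>(x, y). ?plus x y) \<in> M \<Otimes>\<^sub>M lam n \<rightarrow>\<^sub>M lam n" 
   and mm: "(\<lambda>(x, y). ?minus x y) \<in> M \<Otimes>\<^sub>M lam n \<rightarrow>\<^sub>M lam n"
    by (auto simp: split_def intro!: measurable_restrict)
  note [measurable] = mp[unfolded split_def] mm[unfolded split_def]
  have "emeasure M A * emeasure (lam n) B = (\<integral>\<^sup>+y. indicator B y * emeasure M A \<partial>lam n)"
    by (simp add: nn_integral_multc mult.commute)
  also have "\<dots> = (\<integral>\<^sup>+x. \<integral>\<^sup>+y. indicator A x * indicator B y \<partial>lam n \<partial>M)"
    by (subst P.Fubini'[symmetric]) (auto simp: nn_integral_multc mult.commute)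
  also have "\<dots> = (\<integral>\<^sup>+x. \<integral>\<^sup>+y. indicator A x * indicator B (?minus x y) \<partial>lam n \<partial>M)"
  proof (rule nn_integral_cong)
    fix x
    have "(\<integral>\<^sup>+y. indicator A x * indicator B y \<partial>lam n) = (\<integral>\<^sup>+y. indicator A x * indicator B y \<partial>distr (lam n) (lam n) (?minus x))"
      by (simp only: lam_reflect)
    also have "\<dots> = (\<integral>\<^sup>+y. indicator A x * indicator B (?minus x y) \<partial>lam n)"
      by (subst nn_integral_distr) auto
    finally show "(\<integral>\<^sup>+y. indicator A x * indicator B y \<partial>lam n) = (\<integral>\<^sup>+y. indicator A x * indicator B (?minus x y) \<partial>lam n)" .
  qed
  also have "\<dots> = (\<integral>\<^sup>+y. \<integral>\<^sup>+x. indicator A x * indicator B (?minus x y) \<partial>M \<partial>lam n)"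
    by (subst P.Fubini') (auto simp: split_def)
  also have "\<dots> = (\<integral>\<^sup>+y. \<integral>\<^sup>+x. indicator A (?plus x y) * indicator B x \<partial>M \<partial>lam n)"
  proof (rule nn_integral_cong)
    fix y assume y: "y \<in> space (lam n)"
    have my: "(\<lambda>x. ?plus x y) \<in> M \<rightarrow>\<^sub>M M" "(\<lambda>x. ?minus x y) \<in> M \<rightarrow>\<^sub>M lam n"
      by (auto simp: measurable_cong_sets[OF refl sets] intro!: measurable_restrict) 
    note [measurable] = my
    have "(\<integral>\<^sup>+x. indicator A x * indicator B (?minus x y) \<partial>M) = (\<integral>\<^sup>+x. indicator A x * indicator B (?minus x y) \<partial>distr M M (\<lambda>x. ?plus x y))"
      by (simp only: inv[OF y])
    also have "\<dots> = (\<integral>\<^sup>+x. indicator A (?plus x y) * indicator B (?minus (?plus x y) y) \<partial>M)"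
      by (subst nn_integral_distr) auto
    also have "\<dots> = (\<integral>\<^sup>+x. indicator A (?plus x y) * indicator B x \<partial>M)"
    proof (rule nn_integral_cong)
      fix x assume "x \<in> space M"
      then have "?minus (?plus x y) y = x" unfolding spM space_lam by (auto simp: PiE_def extensional_def fun_eq_iff)
      then show "indicator A (?plus x y) * indicator B (?minus (?plus x y) y) = (indicator A (?plus x y) * indicator B x :: ennreal)" by simp
    qed
    finally show "(\<integral>\<^sup>+x. indicator A x * indicator B (?minus x y) \<partial>M) = (\<integral>\<^sup>+x. indicator A (?plus x y) * indicator B x \<partial>M)" .
  qed
  also have "\<dots> = (\<integral>\<^sup>+x. \<integral>\<^sup>+y. indicator A (?plus x y) * indicator B x \<partial>lam n \<partial>M)"
    by (subst P.Fubini') (auto simp: split_def)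
  also have "\<dots> = (\<integral>\<^sup>+x. \<integral>\<^sup>+y. indicator A y * indicator B x \<partial>lam n \<partial>M)"
  proof (rule nn_integral_cong)
    fix x assume x: "x \<in> space M"
    have [measurable]: "?minus (\<lambda>_. 0) \<in> lam n \<rightarrow>\<^sub>M lam n" "?minus x \<in> lam n \<rightarrow>\<^sub>M lam n" "?plus x \<in> lam n \<rightarrow>\<^sub>M lam n"
      by (auto intro!: measurable_restrict)
    have "(\<integral>\<^sup>+y. indicator A (?plus x y) * indicator B x \<partial>lam n) = (\<integral>\<^sup>+y. indicator A (?plus x y) * indicator B x \<partial>distr (lam n) (lam n) (?minus (\<lambda>_. 0)))"
      by (simp only: lam_reflect)
    also have "\<dots> = (\<integral>\<^sup>+y. indicator A (?plus x (?minus (\<lambda>_. 0) y)) * indicator B x \<partial>lam n)"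
      by (subst nn_integral_distr) auto
    also have "\<dots> = (\<integral>\<^sup>+y. indicator A (?minus x y) * indicator B x \<partial>lam n)"
      by (intro nn_integral_cong arg_cong2[where f="(*)"] arg_cong[where f="indicator A"] refl) (auto simp: restrict_def)
    also have "\<dots> = (\<integral>\<^sup>+y. indicator A y * indicator B x \<partial>distr (lam n) (lam n) (?minus x))"
      by (subst nn_integral_distr) auto
    finally show "(\<integral>\<^sup>+y. indicator A (?plus x y) * indicator B x \<partial>lam n) = (\<integral>\<^sup>+y. indicator A y * indicator B x \<partial>lam n)" 
      by (simp only: lam_reflect)
  qed
  also have "\<dots> = emeasure M B * emeasure (lam n) A"
    by (simp add: nn_integral_cmult nn_integral_multc mult.commute)
  finally show ?thesis .
qed

lemma lam_translate:
  "distr (lam n) (lam n) (\<lambda>y. \<lambda>i\<in>{..<n}. y i + a i) = lam n"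
proof -
  have m: "(\<lambda>y. \<lambda>i\<in>{..<n}. c i - y i) \<in> lam n \<rightarrow>\<^sub>M lam n" for c :: "nat \<Rightarrow> real"
    by (auto intro!: measurable_restrict)
  have "lam n = distr (distr (lam n) (lam n) (\<lambda>y. \<lambda>i\<in>{..<n}. 0 - y i)) (lam n) (\<lambda>y. \<lambda>i\<in>{..<n}. a i - y i)"
    by (simp only: lam_reflect)
  also have "\<dots> = distr (lam n) (lam n) ((\<lambda>y. \<lambda>i\<in>{..<n}. a i - y i) \<circ> (\<lambda>y. \<lambda>i\<in>{..<n}. 0 - y i))"
    by (rule distr_distr[OF m m])
  also have "(\<lambda>y. \<lambda>i\<in>{..<n}. a i - y i) \<circ> (\<lambda>y. \<lambda>i\<in>{..<n}. 0 - y i) = (\<lambda>y. \<lambda>i\<in>{..<n}. y i + a i)"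
    by (auto simp: fun_eq_iff restrict_def)
  finally show ?thesis ..
qed

lemma lam_ball_finite: "emeasure (lam n) {x \<in> space (lam n). (\<Sum>i<n. (x i)\<^sup>2) \<le> c\<^sup>2} < \<infinity>"
proof -
  have "{x \<in> space (lam n). (\<Sum>i<n. (x i)\<^sup>2) \<le> c\<^sup>2} \<subseteq> Pi\<^sub>E {..<n} (\<lambda>_. {-\<bar>c\<bar>..\<bar>c\<bar>})"
  proof
    fix x assume "x \<in> {x \<in> space (lam n). (\<Sum>i<n. (x i)\<^sup>2) \<le> c\<^sup>2}"
    then have x: "x \<in> {..<n} \<rightarrow>\<^sub>E UNIV" "(\<Sum>i<n. (x i)\<^sup>2) \<le> c\<^sup>2" by (auto simp: space_lam)
    have "x i \<in> {-\<bar>c\<bar>..\<bar>c\<bar>}" if "i < n" for i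
    proof -
      have "(x i)\<^sup>2 \<le> (\<Sum>i<n. (x i)\<^sup>2)" using that by (intro member_le_sum) auto
      then have "(x i)\<^sup>2 \<le> c\<^sup>2" using x by linarith
      then have "\<bar>x i\<bar> \<le> \<bar>c\<bar>" by (simp add: abs_le_square_iff)
      then show ?thesis by auto
    qed
    then show "x \<in> Pi\<^sub>E {..<n} (\<lambda>_. {-\<bar>c\<bar>..\<bar>c\<bar>})" using x by (auto simp: PiE_def)
  qed
  then have "emeasure (lam n) {x \<in> space (lam n). (\<Sum>i<n. (x i)\<^sup>2) \<le> c\<^sup>2} \<le> emeasure (lam n) (Pi\<^sub>E {..<n} (\<lambda>_. {-\<bar>c\<bar>..\<bar>c\<bar>}))"
    by (intro emeasure_mono sets_PiM_I_finite) auto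
  also have "\<dots> = (\<Prod>i<n. ennreal (2 * \<bar>c\<bar>))"
    by (subst lborel_prod.emeasure_PiM) auto
  also have "\<dots> = ennreal (\<Prod>i<n. 2 * \<bar>c\<bar>)" by (subst prod_ennreal) auto
  also have "\<dots> < \<infinity>" by simp
  finally show ?thesis .
qed

lemma lam_box_pos:
  assumes "d > 0"
  shows "emeasure (lam n) (Pi\<^sub>E {..<n} (\<lambda>i. {a i - d..a i + d})) > 0"
proof -
  have "emeasure (lam n) (Pi\<^sub>E {..<n} (\<lambda>i. {a i - d..a i + d})) = (\<Prod>i<n. ennreal (2 * d))"
    using assms by (subst lborel_prod.emeasure_PiM) auto
  also have "\<dots> = ennreal (\<Prod>i<n. 2 * d)" using assms by (subst prod_ennreal) auto
  also have "\<dots> > 0" using assms by (simp add: prod_pos)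
  finally show ?thesis .
qed

lemma lam_ball_pos: 
  assumes "c > 0" shows "emeasure (lam n) {x \<in> space (lam n). (\<Sum>i<n. (x i)\<^sup>2) \<le> c\<^sup>2} > 0"
proof -
  define d where "d = c / (real n + 1)"
  have d: "d > 0" using assms by (simp add: d_def)
  have sub: "Pi\<^sub>E {..<n} (\<lambda>_. {0 - d..0 + d}) \<subseteq> {x \<in> space (lam n). (\<Sum>i<n. (x i)\<^sup>2) \<le> c\<^sup>2}"
  proof
    fix x assume x: "x \<in> Pi\<^sub>E {..<n} (\<lambda>_. {0 - d..0 + d})"
    have "(\<Sum>i<n. (x i)\<^sup>2) \<le> (\<Sum>i<n. d\<^sup>2)"
    proof (rule sum_mono)
      fix i assume "i \<in> {..<n}"
      then have "x i \<in> {0 - d..0 + d}" using x by (auto simp: PiE_def Pi_def)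
      then have "\<bar>x i\<bar> \<le> \<bar>d\<bar>" by auto
      then show "(x i)\<^sup>2 \<le> d\<^sup>2" by (simp only: abs_le_square_iff)
    qed
    also have "\<dots> = real n * d\<^sup>2" by simp
    also have "\<dots> \<le> (real n + 1)\<^sup>2 * d\<^sup>2" by (intro mult_right_mono) (auto simp: power2_eq_square algebra_simps)
    also have "\<dots> = c\<^sup>2" unfolding d_def by (simp add: power_divide)
    finally show "x \<in> {x \<in> space (lam n). (\<Sum>i<n. (x i)\<^sup>2) \<le> c\<^sup>2}" using x by (auto simp: space_lam PiE_def)
  qed
  have "0 < emeasure (lam n) (Pi\<^sub>E {..<n} (\<lambda>_. {0 - d..0 + d}))" using lam_box_pos[OF d, of n "\<lambda>_. 0"] .
  also have "\<dots> \<le> emeasure (lam n) {x \<in> space (lam n). (\<Sum>i<n. (x i)\<^sup>2) \<le> c\<^sup>2}"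
    by (rule emeasure_mono[OF sub]) measurable
  finally show ?thesis .
qed

text \<open>
  The image of Lebesgue measure is translation invariant, hence proportional to Lebesgue measure, and
  the factor is 1 because the unit ball is mapped to itself.
\<close>
lemma lam_involutive_isometry:
  assumes H [measurable]: "H \<in> lam n \<rightarrow>\<^sub>M lam n"
    and inv: "\<And>x. x \<in> space (lam n) \<Longrightarrow> H (H x) = x"
    and add: "\<And>x a. x \<in> space (lam n) \<Longrightarrow> a \<in> space (lam n) \<Longrightarrow> H (\<lambda>i\<in>{..<n}. x i + a i) = (\<lambda>i\<in>{..<n}. H x i + H a i)"
    and norm: "\<And>x. x \<in> space (lam n) \<Longrightarrow> (\<Sum>i<n. (H x i)\<^sup>2) = (\<Sum>i<n. (x i)\<^sup>2)"
  shows "distr (lam n) (lam n) H = lam n"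
proof -
  let ?M = "distr (lam n) (lam n) H"
  let ?B = "\<lambda>c. {x \<in> space (lam n). (\<Sum>i<n. (x i)\<^sup>2) \<le> c\<^sup>2}"
  have Hsp: "x \<in> space (lam n) \<Longrightarrow> H x \<in> space (lam n)" for x using measurable_space[OF H] .
  have ball: "emeasure ?M (?B c) = emeasure (lam n) (?B c)" for c
  proof -
    have "H -` ?B c \<inter> space (lam n) = ?B c" using Hsp norm by auto
    then show ?thesis by (subst emeasure_distr) auto
  qed
  have sf: "sigma_finite_measure ?M"
  proof
    show "\<exists>A. countable A \<and> A \<subseteq> sets ?M \<and> \<Union> A = space ?M \<and> (\<forall>a\<in>A. emeasure ?M a \<noteq> \<infinity>)"
    proof (intro exI[of _ "range (\<lambda>k::nat. ?B (real k))"] conjI)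
      show "\<Union> (range (\<lambda>k::nat. ?B (real k))) = space ?M"
      proof safe
        fix x assume x: "x \<in> space ?M"
        obtain k :: nat where k: "(\<Sum>i<n. (x i)\<^sup>2) \<le> real k" using real_arch_simple by blast
        have "real k \<le> (real k)\<^sup>2" by (cases k) (auto simp: power2_eq_square)
        then have "(\<Sum>i<n. (x i)\<^sup>2) \<le> (real k)\<^sup>2" using k by linarith
        then show "x \<in> \<Union> (range (\<lambda>k::nat. ?B (real k)))" using x by (intro UN_I[of k]) auto
      qed auto
      show "\<forall>a\<in>range (\<lambda>k::nat. ?B (real k)). emeasure ?M a \<noteq> \<infinity>" 
        using lam_ball_finite[of n] unfolding ball[symmetric] by (auto simp: less_top)
    qed auto
  qed
  have tr: "distr ?M ?M (\<lambda>x. \<lambda>i\<in>{..<n}. x i + a i) = ?M" if a: "a \<in> space (lam n)" for a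
  proof -
    have m: "(\<lambda>x. \<lambda>i\<in>{..<n}. x i + b i) \<in> lam n \<rightarrow>\<^sub>M lam n" for b :: "nat \<Rightarrow> real" by (auto intro!: measurable_restrict)
    have "distr ?M ?M (\<lambda>x. \<lambda>i\<in>{..<n}. x i + a i) = distr ?M (lam n) (\<lambda>x. \<lambda>i\<in>{..<n}. x i + a i)"
      by (intro distr_cong) auto
    also have "\<dots> = distr (lam n) (lam n) ((\<lambda>x. \<lambda>i\<in>{..<n}. x i + a i) \<circ> H)"
      by (rule distr_distr[OF m H])
    also have "\<dots> = distr (lam n) (lam n) (H \<circ> (\<lambda>x. \<lambda>i\<in>{..<n}. x i + H a i))"
    proof (rule distr_cong[OF refl refl])
      fix x assume x: "x \<in> space (lam n)"
      show "((\<lambda>x. \<lambda>i\<in>{..<n}. x i + a i) \<circ> H) x = (H \<circ> (\<lambda>x. \<lambda>i\<in>{..<n}. x i + H a i)) x"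
        using add[OF x Hsp[OF a]] inv[OF a] by simp
    qed
    also have "\<dots> = distr (distr (lam n) (lam n) (\<lambda>x. \<lambda>i\<in>{..<n}. x i + H a i)) (lam n) H"
      by (rule distr_distr[symmetric, OF H m])
    also have "\<dots> = ?M" by (simp only: lam_translate)
    finally show ?thesis .
  qed
  show ?thesis
  proof (rule measure_eqI)
    fix A assume A: "A \<in> sets ?M"
    have "emeasure ?M A * emeasure (lam n) (?B 1) = emeasure ?M (?B 1) * emeasure (lam n) A"
      by (rule translation_invariant_proportional[OF sf _ tr]) (use A in auto)
    then have "emeasure (lam n) (?B 1) * emeasure ?M A = emeasure (lam n) (?B 1) * emeasure (lam n) A"
      unfolding ball by (simp only: mult.commute)
    then show "emeasure ?M A = emeasure (lam n) A"
      using lam_ball_pos[of 1 n] lam_ball_finite[of n 1] by (subst (asm) ennreal_mult_cancel_left) auto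
  qed auto
qed

definition householder :: "nat \<Rightarrow> (nat \<Rightarrow> real) \<Rightarrow> nat \<Rightarrow> nat \<Rightarrow> real" where
  "householder n v i j = (if i = j then 1 else 0) - 2 * v i * v j / (\<Sum>l<n. (v l)\<^sup>2)"

lemma mat_app_householder:
  "mat_app n (householder n v) x = (\<lambda>i\<in>{..<n}. x i - (2 * (\<Sum>j<n. v j * x j) / (\<Sum>l<n. (v l)\<^sup>2)) * v i)"
proof -
  have "(\<Sum>j<n. householder n v i j * x j) = x i - (2 * (\<Sum>j<n. v j * x j) / (\<Sum>l<n. (v l)\<^sup>2)) * v i" if "i < n" for i
  proof -
    have "(\<Sum>j<n. householder n v i j * x j) = (\<Sum>j<n. (if i = j then x j else 0) - (2 * v i / (\<Sum>l<n. (v l)\<^sup>2)) * (v j * x j))"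
      by (intro sum.cong) (auto simp: householder_def algebra_simps)
    also have "\<dots> = x i - (2 * v i / (\<Sum>l<n. (v l)\<^sup>2)) * (\<Sum>j<n. v j * x j)"
      using that by (simp add: sum_subtractf sum_distrib_left)
    finally show ?thesis by (simp add: mult_ac)
  qed
  then show ?thesis unfolding mat_app_def by (auto simp: fun_eq_iff restrict_def)
qed

lemma householder_props:
  assumes S: "(\<Sum>l<n. (v l)\<^sup>2) \<noteq> 0"
  shows householder_inner: "(\<Sum>j<n. v j * mat_app n (householder n v) x j) = - (\<Sum>j<n. v j * x j)"
    and householder_norm: "(\<Sum>j<n. (mat_app n (householder n v) x j)\<^sup>2) = (\<Sum>j<n. (x j)\<^sup>2)"
    and householder_involutive: "x \<in> {..<n} \<rightarrow>\<^sub>E UNIV \<Longrightarrow> mat_app n (householder n v) (mat_app n (householder n v) x) = x"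
proof -
  let ?S = "\<Sum>l<n. (v l)\<^sup>2" and ?c = "\<lambda>x. 2 * (\<Sum>j<n. v j * x j) / (\<Sum>l<n. (v l)\<^sup>2)"
  have in1: "(\<Sum>j<n. v j * mat_app n (householder n v) x j) = - (\<Sum>j<n. v j * x j)" for x
  proof -
    have "(\<Sum>j<n. v j * mat_app n (householder n v) x j) = (\<Sum>j<n. v j * x j - ?c x * (v j)\<^sup>2)"
      unfolding mat_app_householder by (intro sum.cong) (auto simp: power2_eq_square algebra_simps)
    also have "\<dots> = (\<Sum>j<n. v j * x j) - ?c x * ?S" by (simp add: sum_subtractf sum_distrib_left)
    finally show ?thesis using S by (simp add: field_simps)
  qed
  then show "(\<Sum>j<n. v j * mat_app n (householder n v) x j) = - (\<Sum>j<n. v j * x j)" .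
  have "(\<Sum>j<n. (mat_app n (householder n v) x j)\<^sup>2) = (\<Sum>j<n. (x j)\<^sup>2 - 2 * ?c x * (v j * x j) + (?c x)\<^sup>2 * (v j)\<^sup>2)"
    unfolding mat_app_householder by (intro sum.cong) (auto simp: power2_eq_square algebra_simps)
  also have "\<dots> = (\<Sum>j<n. (x j)\<^sup>2) - 2 * ?c x * (\<Sum>j<n. v j * x j) + (?c x)\<^sup>2 * ?S"
    by (simp add: sum_subtractf sum.distrib sum_distrib_left)
  also have "(?c x)\<^sup>2 * ?S = 2 * ?c x * (\<Sum>j<n. v j * x j)" using S by (simp add: power2_eq_square)
  finally show "(\<Sum>j<n. (mat_app n (householder n v) x j)\<^sup>2) = (\<Sum>j<n. (x j)\<^sup>2)" by simp
  assume x: "x \<in> {..<n} \<rightarrow>\<^sub>E UNIV"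
  let ?y = "mat_app n (householder n v) x"
  have "?c ?y = - ?c x" unfolding in1 by simp
  then have "mat_app n (householder n v) ?y = (\<lambda>i\<in>{..<n}. ?y i + ?c x * v i)"
    by (subst mat_app_householder) (simp add: in1)
  also have "\<dots> = x" using x unfolding mat_app_householder by (auto simp: fun_eq_iff PiE_def extensional_def restrict_def)
  finally show "mat_app n (householder n v) ?y = x" .
qed

lemma mat_app_measurable [measurable]: "mat_app n Q \<in> lam n \<rightarrow>\<^sub>M lam n"
  unfolding mat_app_def by (auto intro!: measurable_restrict)

lemma lam_householder:
  assumes S: "(\<Sum>l<n. (v l)\<^sup>2) \<noteq> 0"
  shows "distr (lam n) (lam n) (mat_app n (householder n v)) = lam n"
proof (rule lam_involutive_isometry)
  fix x assume "x \<in> space (lam n)"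
  then show "mat_app n (householder n v) (mat_app n (householder n v) x) = x"
    by (intro householder_involutive S) (simp add: space_lam)
next
  fix x a
  show "mat_app n (householder n v) (\<lambda>i\<in>{..<n}. x i + a i) = (\<lambda>i\<in>{..<n}. mat_app n (householder n v) x i + mat_app n (householder n v) a i)"
    by (auto simp: mat_app_def fun_eq_iff restrict_def distrib_left sum.distrib)
qed (use householder_norm[OF S] in auto)

lemma sphere_rotation_householder:
  assumes S: "(\<Sum>l<n. (v l)\<^sup>2) \<noteq> 0" and v0: "(\<Sum>l<n. v l) = 0"
  shows "sphere_rotation n (householder n v)"
  unfolding sphere_rotation_def
proof (intro conjI allI impI)
  let ?S = "\<Sum>l<n. (v l)\<^sup>2"
  fix i j assume ij: "i < n" "j < n"
  have "(\<Sum>l<n. householder n v l i * householder n v l j) =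
    (\<Sum>l<n. (if l = i then (if i = j then 1 else 0) else 0) - (if l = j then 2 * v l * v i / ?S else 0) - (if l = i then 2 * v l * v j / ?S else 0) + (4 * v i * v j / ?S / ?S) * (v l)\<^sup>2)"
    by (intro sum.cong) (auto simp: householder_def power2_eq_square algebra_simps)
  also have "\<dots> = (if i = j then 1 else 0) - 2 * v j * v i / ?S - 2 * v i * v j / ?S + (4 * v i * v j / ?S / ?S) * ?S"
    using ij by (simp add: sum.distrib sum_subtractf sum_distrib_left)
  also have "\<dots> = (if i = j then 1 else 0)" using S by simp
  finally show "(\<Sum>l<n. householder n v l i * householder n v l j) = (if i = j then 1 else 0)" .
next
  fix i assume "i < n"
  then have "(\<Sum>j<n. householder n v i j) = 1 - (2 * v i / (\<Sum>l<n. (v l)\<^sup>2)) * (\<Sum>l<n. v l)"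
    by (simp add: householder_def sum_subtractf sum_distrib_left)
  then show "(\<Sum>j<n. householder n v i j) = 1" using v0 by simp
qed

text \<open>
  The reflection along \<open>x - y\<close> exchanges \<open>x\<close> and \<open>y\<close> since they have the same norm, and it fixes the
  constant vectors since \<open>x\<close> and \<open>y\<close> have the same sum.
\<close>
lemma sphere_transitive:
  assumes x: "x \<in> K_sphere n b" and y: "y \<in> K_sphere n b" and "x \<noteq> y"
  shows "\<exists>v. (\<Sum>l<n. (v l)\<^sup>2) \<noteq> 0 \<and> (\<Sum>l<n. v l) = 0 \<and> mat_app n (householder n v) x = y"
proof (intro exI[of _ "\<lambda>i. x i - y i"] conjI)
  let ?v = "\<lambda>i. x i - y i"
  show S: "(\<Sum>l<n. (?v l)\<^sup>2) \<noteq> 0"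
  proof
    assume "(\<Sum>l<n. (?v l)\<^sup>2) = 0"
    then have "\<forall>l\<in>{..<n}. (?v l)\<^sup>2 = 0" by (subst (asm) sum_nonneg_eq_0_iff) auto
    then have "x = y" using x y by (auto simp: K_sphere_def intro: PiE_ext)
    with \<open>x \<noteq> y\<close> show False by simp
  qed
  show "(\<Sum>l<n. ?v l) = 0" using x y by (simp add: K_sphere_def sum_subtractf)
  have eq: "(\<Sum>l<n. (x l)\<^sup>2) = (\<Sum>l<n. (y l)\<^sup>2)" using x y by (simp add: K_sphere_def)
  have "(\<Sum>l<n. (?v l)\<^sup>2) = (\<Sum>l<n. 2 * (?v l * x l) + (y l)\<^sup>2 - (x l)\<^sup>2)"
    by (intro sum.cong) (auto simp: power2_eq_square algebra_simps)
  also have "\<dots> = 2 * (\<Sum>l<n. ?v l * x l)"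
    using eq by (simp add: sum.distrib sum_subtractf sum_distrib_left)
  finally have "2 * (\<Sum>l<n. ?v l * x l) / (\<Sum>l<n. (?v l)\<^sup>2) = 1" using S by simp
  then have "mat_app n (householder n ?v) x = (\<lambda>i\<in>{..<n}. x i - ?v i)"
    unfolding mat_app_householder by simp
  also have "\<dots> = y" using y by (auto simp: K_sphere_def fun_eq_iff PiE_def extensional_def restrict_def)
  finally show "mat_app n (householder n ?v) x = y" .
qed

section \<open>Comparing the sphere with a Lebesgue shell\<close>

text \<open>
  The affine normalisation of the coordinates to mean 1 and second moment \<open>b\<close>. It commutes with the
  reflections that fix the constant vectors.
\<close>
definition proj :: "nat \<Rightarrow> real \<Rightarrow> (nat \<Rightarrow> real) \<Rightarrow> nat \<Rightarrow> real" where
  "proj n b y = (\<lambda>i\<in>{..<n}. 1 + sqrt ((b - 1) / ((\<Sum>i<n. (y i)\<^sup>2) / n - ((\<Sum>i<n. y i) / n)\<^sup>2)) * (y i - (\<Sum>i<n. y i) / n))"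

definition sqdist :: "nat \<Rightarrow> (nat \<Rightarrow> real) \<Rightarrow> (nat \<Rightarrow> real) \<Rightarrow> real" where
  "sqdist n x y = (\<Sum>i<n. (x i - y i)\<^sup>2)"

lemma proj_in_sphere:
  assumes "n > 0" "b > 1" and V: "(\<Sum>i<n. (y i)\<^sup>2) / n - ((\<Sum>i<n. y i) / n)\<^sup>2 > 0"
  shows "proj n b y \<in> K_sphere n b"
proof -
  define m where "m = (\<Sum>i<n. y i) / n"
  define V where "V = (\<Sum>i<n. (y i)\<^sup>2) / n - m\<^sup>2"
  define k where "k = sqrt ((b - 1) / V)"
  have s1: "(\<Sum>i<n. y i) = n * m" and s2: "(\<Sum>i<n. (y i)\<^sup>2) = n * (V + m\<^sup>2)"
    using assms(1) by (simp_all add: m_def V_def)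
  have V0: "V > 0" using V by (simp add: V_def m_def)
  have k2: "k\<^sup>2 * V = b - 1" using V0 assms(2) by (simp add: k_def)
  have p: "proj n b y = (\<lambda>i\<in>{..<n}. 1 + k * (y i - m))"
    unfolding proj_def k_def V_def m_def ..
  have "(\<Sum>i<n. proj n b y i) = (\<Sum>i<n. (1 - k * m) + k * y i)"
    unfolding p by (intro sum.cong) (auto simp: algebra_simps)
  also have "\<dots> = n * (1 - k * m) + k * (n * m)" by (simp only: sum.distrib sum_distrib_left[symmetric] s1) simp
  also have "\<dots> = n" by (simp add: algebra_simps)
  finally have 1: "(\<Sum>i<n. proj n b y i) = n" .
  have "(\<Sum>i<n. (proj n b y i)\<^sup>2) = (\<Sum>i<n. (1 - k * m)\<^sup>2 + 2 * (1 - k * m) * k * y i + k\<^sup>2 * (y i)\<^sup>2)"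
    unfolding p by (intro sum.cong) (auto simp: algebra_simps power2_eq_square)
  also have "\<dots> = n * (1 - k * m)\<^sup>2 + 2 * (1 - k * m) * k * (n * m) + k\<^sup>2 * (n * (V + m\<^sup>2))"
    by (simp add: sum.distrib sum_distrib_left[symmetric] s1 s2)
  also have "\<dots> = n * (1 + k\<^sup>2 * V)" by (simp add: algebra_simps power2_eq_square)
  also have "\<dots> = n * b" by (simp add: k2)
  finally have "(\<Sum>i<n. (proj n b y i)\<^sup>2) = n * b" .
  with 1 show ?thesis by (simp add: K_sphere_def p)
qed

lemma householder_sum:
  assumes "(\<Sum>l<n. v l) = 0"
  shows "(\<Sum>i<n. mat_app n (householder n v) y i) = (\<Sum>i<n. y i)"
proof -
  have "(\<Sum>i<n. c * v i) = 0" for c using assms by (simp add: sum_distrib_left[symmetric])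
  then show ?thesis unfolding mat_app_householder by (simp add: sum_subtractf del: times_divide_eq_left)
qed

lemma proj_householder:
  assumes S: "(\<Sum>l<n. (v l)\<^sup>2) \<noteq> 0" and v0: "(\<Sum>l<n. v l) = 0"
  shows "proj n b (mat_app n (householder n v) y) = mat_app n (householder n v) (proj n b y)"
proof -
  define m where "m = (\<Sum>i<n. y i) / n"
  define k where "k = sqrt ((b - 1) / ((\<Sum>i<n. (y i)\<^sup>2) / n - m\<^sup>2))"
  have p: "proj n b y = (\<lambda>i\<in>{..<n}. 1 + k * (y i - m))"
    unfolding proj_def k_def m_def ..
  have p': "proj n b (mat_app n (householder n v) y) = (\<lambda>i\<in>{..<n}. 1 + k * (mat_app n (householder n v) y i - m))"
    unfolding proj_def householder_norm[OF S] householder_sum[OF v0] k_def m_def ..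
  have "(\<Sum>j<n. v j * proj n b y j) = (\<Sum>j<n. (1 - k * m) * v j + k * (v j * y j))"
    unfolding p by (intro sum.cong) (auto simp: algebra_simps)
  also have "\<dots> = k * (\<Sum>j<n. v j * y j)"
    by (simp add: sum.distrib sum_distrib_left[symmetric] v0)
  finally have in': "(\<Sum>j<n. v j * proj n b y j) = k * (\<Sum>j<n. v j * y j)" .
  have "mat_app n (householder n v) (proj n b y) = (\<lambda>i\<in>{..<n}. proj n b y i - 2 * (k * (\<Sum>j<n. v j * y j)) / (\<Sum>l<n. (v l)\<^sup>2) * v i)"
    unfolding mat_app_householder in' ..
  also have "\<dots> = (\<lambda>i\<in>{..<n}. 1 + k * (mat_app n (householder n v) y i - m))"
    unfolding p mat_app_householder by (auto simp: fun_eq_iff restrict_def algebra_simps)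
  finally show ?thesis using p' by simp
qed

lemma sqdist_householder:
  assumes S: "(\<Sum>l<n. (v l)\<^sup>2) \<noteq> 0"
  shows "sqdist n (mat_app n (householder n v) x) (mat_app n (householder n v) y) = sqdist n x y"
proof -
  have "mat_app n (householder n v) x i - mat_app n (householder n v) y i = mat_app n (householder n v) (\<lambda>i. x i - y i) i" if "i < n" for i
    using that by (simp add: mat_app_def sum_subtractf right_diff_distrib)
  then have "sqdist n (mat_app n (householder n v) x) (mat_app n (householder n v) y) = (\<Sum>i<n. (mat_app n (householder n v) (\<lambda>i. x i - y i) i)\<^sup>2)"
    unfolding sqdist_def by (intro sum.cong) auto
  then show ?thesis unfolding householder_norm[OF S] sqdist_def .
qed

lemma uniform_on_sphere_ball:
  assumes u: "uniform_on_sphere n b \<sigma>" and z: "z \<in> K_sphere n b" "z' \<in> K_sphere n b"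
  shows "emeasure \<sigma> {x \<in> space \<sigma>. sqdist n x z < \<rho>} = emeasure \<sigma> {x \<in> space \<sigma>. sqdist n x z' < \<rho>}"
proof (cases "z = z'")
  case False
  have sets [measurable_cong]: "sets \<sigma> = sets (lam n)" using u by (simp add: uniform_on_sphere_def sets_lam)
  obtain v where v: "(\<Sum>l<n. (v l)\<^sup>2) \<noteq> 0" "(\<Sum>l<n. v l) = 0" "mat_app n (householder n v) z' = z"
    using sphere_transitive[OF z(2,1)] False by auto
  have inv: "distr \<sigma> \<sigma> (mat_app n (householder n v)) = \<sigma>"
    using u sphere_rotation_householder[OF v(1,2)] by (simp add: uniform_on_sphere_def)
  have [measurable]: "{x \<in> space \<sigma>. sqdist n x z < \<rho>} \<in> sets \<sigma>" unfolding sqdist_def by measurable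
  have m: "mat_app n (householder n v) \<in> \<sigma> \<rightarrow>\<^sub>M \<sigma>"
    by (simp add: measurable_cong_sets[OF sets sets])
  have "emeasure \<sigma> {x \<in> space \<sigma>. sqdist n x z < \<rho>} = emeasure (distr \<sigma> \<sigma> (mat_app n (householder n v))) {x \<in> space \<sigma>. sqdist n x z < \<rho>}"
    by (simp only: inv)
  also have "\<dots> = emeasure \<sigma> (mat_app n (householder n v) -` {x \<in> space \<sigma>. sqdist n x z < \<rho>} \<inter> space \<sigma>)"
    by (rule emeasure_distr[OF m]) measurable
  also have "mat_app n (householder n v) -` {x \<in> space \<sigma>. sqdist n x z < \<rho>} \<inter> space \<sigma> = {x \<in> space \<sigma>. sqdist n x z' < \<rho>}"
    using measurable_space[OF m] sqdist_householder[OF v(1), of _ z'] by (auto simp: v(3))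
  finally show ?thesis .
qed simp

text \<open>
  If one ball is a null set, then all balls of the same radius are. But countably many small cubes
  cover the space, and each of them that meets the sphere is contained in such a ball.
\<close>
lemma uniform_on_sphere_ball_pos:
  assumes u: "uniform_on_sphere n b \<sigma>" and z: "z \<in> K_sphere n b" and "\<rho> > 0"
  shows "emeasure \<sigma> {x \<in> space \<sigma>. sqdist n x z < \<rho>} > 0"
proof (rule ccontr)
  assume "\<not> emeasure \<sigma> {x \<in> space \<sigma>. sqdist n x z < \<rho>} > 0"
  then have null: "emeasure \<sigma> {x \<in> space \<sigma>. sqdist n x z' < \<rho>} = 0" if "z' \<in> K_sphere n b" for z'
    using uniform_on_sphere_ball[OF u that z] by simp
  have sets [measurable_cong]: "sets \<sigma> = sets (lam n)" and "prob_space \<sigma>" and AE: "AE x in \<sigma>. x \<in> K_sphere n b"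
    using u by (auto simp: uniform_on_sphere_def sets_lam)
  interpret prob_space \<sigma> by fact
  have sp: "space \<sigma> = {..<n} \<rightarrow>\<^sub>E UNIV" using sets_eq_imp_space_eq[OF sets] by (simp add: space_lam)
  \<comment> \<open>The side is such that a cube of \<open>n\<close> dimensions has diameter less than the radius of the ball.\<close>
  define d where "d = sqrt (\<rho> / (n + 1))"
  have d: "d > 0" "(real n + 1) * d\<^sup>2 = \<rho>" using \<open>\<rho> > 0\<close> by (auto simp: d_def add.commute)
  define cell where "cell g = {x \<in> space \<sigma>. \<forall>i<n. \<lfloor>x i / d\<rfloor> = g i}" for g :: "nat \<Rightarrow> int"
  have cm [measurable]: "cell g \<in> sets \<sigma>" for g
  proof -
    have "Measurable.pred \<sigma> (\<lambda>x. \<lfloor>x i / d\<rfloor> = g i)" if "i < n" for i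
    proof -
      have [measurable]: "(\<lambda>x. x i) \<in> borel_measurable \<sigma>"
        unfolding measurable_cong_sets[OF sets refl] using that by (auto intro!: measurable_component_singleton)
      show ?thesis by measurable
    qed
    then have "Measurable.pred \<sigma> (\<lambda>x. \<forall>i\<in>{..<n}. \<lfloor>x i / d\<rfloor> = g i)" by (intro pred_intros_finite) auto
    from predE[OF this] show ?thesis unfolding cell_def by (simp add: Ball_def)
  qed
  have cell0: "emeasure \<sigma> (cell g) = 0" for g
  proof (cases "\<exists>z'\<in>cell g. z' \<in> K_sphere n b")
    case True
    then obtain z' where z': "z' \<in> cell g" "z' \<in> K_sphere n b" by auto
    have "cell g \<subseteq> {x \<in> space \<sigma>. sqdist n x z' < \<rho>}"
    proof
      fix x assume x: "x \<in> cell g"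
      have "(x i - z' i)\<^sup>2 \<le> d\<^sup>2" if "i < n" for i
      proof -
        have "\<lfloor>x i / d\<rfloor> = \<lfloor>z' i / d\<rfloor>" using x z' that by (simp add: cell_def)
        then have "\<bar>x i / d - z' i / d\<bar> \<le> 1" by linarith
        then have "\<bar>x i - z' i\<bar> \<le> \<bar>d\<bar>" using d(1) by (simp add: diff_divide_distrib[symmetric] abs_divide)
        then show ?thesis by (simp only: abs_le_square_iff)
      qed
      then have "sqdist n x z' \<le> (\<Sum>i<n. d\<^sup>2)" unfolding sqdist_def by (intro sum_mono) auto
      also have "\<dots> < \<rho>" using d by (simp add: algebra_simps) (metis add.commute less_add_same_cancel1 zero_less_power)
      finally show "x \<in> {x \<in> space \<sigma>. sqdist n x z' < \<rho>}" using x by (simp add: cell_def)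
    qed
    then have "emeasure \<sigma> (cell g) \<le> emeasure \<sigma> {x \<in> space \<sigma>. sqdist n x z' < \<rho>}"
      by (rule emeasure_mono) (unfold sqdist_def, measurable)
    then show ?thesis using null[OF z'(2)] by simp
  next
    case False
    have "AE x in \<sigma>. x \<notin> cell g" using AE by eventually_elim (use False in auto)
    then show ?thesis by (subst (asm) AE_iff_measurable[of "cell g"]) (auto simp: cell_def)
  qed
  let ?G = "{..<n} \<rightarrow>\<^sub>E (UNIV :: int set)"
  have "countable ?G" by (intro countable_PiE) auto
  then have "emeasure \<sigma> (\<Union>g\<in>?G. cell g) = 0"
    using cell0 cm null_sets_UN'[of ?G cell \<sigma>] by (auto simp: null_sets_def)
  moreover have "(\<Union>g\<in>?G. cell g) = space \<sigma>"
  proof safe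
    fix x assume "x \<in> space \<sigma>"
    then show "x \<in> (\<Union>g\<in>?G. cell g)" by (intro UN_I[of "\<lambda>i\<in>{..<n}. \<lfloor>x i / d\<rfloor>"]) (auto simp: cell_def)
  qed (auto simp: cell_def)
  ultimately show False using emeasure_space_1 by simp
qed

text \<open>
  The relation \<open>y \<in> W \<and> sqdist n x (proj n b y) < \<rho>\<close> is invariant under the simultaneous action of the
  reflections on \<open>x\<close> and \<open>y\<close>. Therefore its section over a point \<open>x\<close> of the sphere has a Lebesgue measure
  \<open>v\<close> that does not depend on \<open>x\<close>, and its section over a point \<open>y\<close> of the shell has a measure \<open>h\<close> under
  \<open>\<sigma>\<close> that does not depend on \<open>y\<close>. Integrating over pairs in both orders gives
  \<open>\<sigma> B * v \<le> h * lam B'\<close> and \<open>h * lam A' \<le> \<sigma> A * v\<close>, and \<open>v\<close> and \<open>h\<close> cancel.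
\<close>
lemma sphere_shell_comparison:
  assumes u: "uniform_on_sphere n b \<sigma>" and n: "n > 0" and b: "b > 1" and \<rho>: "\<rho> > 0"
    and E [measurable]: "E \<in> sets (borel \<Otimes>\<^sub>M borel)"
    and Epos: "\<And>s q. (s, q) \<in> E \<Longrightarrow> q / n - (s / n)\<^sup>2 > 0 \<and> q \<le> M\<^sup>2"
    and W: "W = {y \<in> space (lam n). ((\<Sum>i<n. y i), (\<Sum>i<n. (y i)\<^sup>2)) \<in> E}"
    and A: "A \<in> sets (lam n)" and B: "B \<in> sets (lam n)" and A': "A' \<in> sets (lam n)" and B': "B' \<in> sets (lam n)"
    and hB: "\<And>x y. x \<in> B \<Longrightarrow> x \<in> K_sphere n b \<Longrightarrow> y \<in> W \<Longrightarrow> sqdist n x (proj n b y) < \<rho> \<Longrightarrow> y \<in> B'"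
    and hA: "\<And>x y. y \<in> A' \<Longrightarrow> x \<in> K_sphere n b \<Longrightarrow> sqdist n x (proj n b y) < \<rho> \<Longrightarrow> x \<in> A"
    and A'W: "A' \<subseteq> W" and A'pos: "emeasure (lam n) A' > 0"
  shows "emeasure \<sigma> B * emeasure (lam n) A' \<le> emeasure \<sigma> A * emeasure (lam n) B'"
proof -
  have sets [measurable_cong]: "sets \<sigma> = sets (lam n)" and "prob_space \<sigma>" and AE: "AE x in \<sigma>. x \<in> K_sphere n b"
    using u by (auto simp: uniform_on_sphere_def sets_lam)
  interpret prob_space \<sigma> by fact
  interpret L: sigma_finite_measure "lam n" by (rule sigma_finite_lam)
  interpret P: pair_sigma_finite \<sigma> "lam n" ..
  have sp: "space \<sigma> = space (lam n)" using sets_eq_imp_space_eq[OF sets] .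
  note [measurable] = A B A' B'
  have Wm [measurable]: "W \<in> sets (lam n)"
  proof -
    have "(\<lambda>y. ((\<Sum>i<n. y i), (\<Sum>i<n. (y i)\<^sup>2))) \<in> lam n \<rightarrow>\<^sub>M borel \<Otimes>\<^sub>M borel" by measurable
    from measurable_sets[OF this E] show ?thesis unfolding W by (simp add: vimage_def Int_def conj_commute)
  qed
  have Wproj: "proj n b y \<in> K_sphere n b" if "y \<in> W" for y
    using that Epos by (intro proj_in_sphere n b) (auto simp: W)
  define \<Gamma> where "\<Gamma> x y \<longleftrightarrow> y \<in> W \<and> sqdist n x (proj n b y) < \<rho>" for x y
  have \<Gamma>m [measurable]: "Measurable.pred (\<sigma> \<Otimes>\<^sub>M lam n) (\<lambda>p. \<Gamma> (fst p) (snd p))"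
    unfolding \<Gamma>_def sqdist_def proj_def by (simp cong: sum.cong) measurable
  let ?G = "\<lambda>x y. indicator {p. \<Gamma> (fst p) (snd p)} (x, y) :: ennreal"
  have Gm [measurable]: "(\<lambda>p. ?G (fst p) (snd p)) \<in> borel_measurable (\<sigma> \<Otimes>\<^sub>M lam n)"
    by simp
  obtain z where z: "z \<in> K_sphere n b"
  proof -
    have "A' \<noteq> {}" using A'pos by auto
    then show ?thesis using Wproj A'W that by blast
  qed
  define h where "h = emeasure \<sigma> {x \<in> space \<sigma>. sqdist n x z < \<rho>}"
  define v where "v = emeasure (lam n) {y \<in> space (lam n). \<Gamma> z y}"
  have hpos: "h > 0" unfolding h_def by (rule uniform_on_sphere_ball_pos[OF u z \<rho>])
  have h: "(\<integral>\<^sup>+x. ?G x y \<partial>\<sigma>) = h" if "y \<in> W" for y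
  proof -
    have "(\<integral>\<^sup>+x. ?G x y \<partial>\<sigma>) = (\<integral>\<^sup>+x. indicator {x \<in> space \<sigma>. sqdist n x (proj n b y) < \<rho>} x \<partial>\<sigma>)"
      using that by (intro nn_integral_cong) (auto simp: \<Gamma>_def split: split_indicator)
    also have "\<dots> = emeasure \<sigma> {x \<in> space \<sigma>. sqdist n x (proj n b y) < \<rho>}"
      by (rule nn_integral_indicator) (unfold sqdist_def, measurable)
    also have "\<dots> = h" unfolding h_def by (rule uniform_on_sphere_ball[OF u Wproj[OF that] z])
    finally show ?thesis .
  qed
  have v: "(\<integral>\<^sup>+y. ?G x y \<partial>lam n) = v" if x: "x \<in> K_sphere n b" for x
  proof -
    have Gx: "{y \<in> space (lam n). \<Gamma> x y} \<in> sets (lam n)" if "x \<in> K_sphere n b" for x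
      unfolding \<Gamma>_def sqdist_def proj_def by (simp cong: sum.cong) measurable
    have "(\<integral>\<^sup>+y. ?G x y \<partial>lam n) = (\<integral>\<^sup>+y. indicator {y \<in> space (lam n). \<Gamma> x y} y \<partial>lam n)"
      by (intro nn_integral_cong) (auto split: split_indicator)
    also have "\<dots> = emeasure (lam n) {y \<in> space (lam n). \<Gamma> x y}"
      by (rule nn_integral_indicator[OF Gx[OF x]])
    also have "\<dots> = v"
    proof (cases "x = z")
      case False
      obtain w where w: "(\<Sum>l<n. (w l)\<^sup>2) \<noteq> 0" "(\<Sum>l<n. w l) = 0" "mat_app n (householder n w) x = z"
        using sphere_transitive[OF x z False] by auto
      have "v = emeasure (distr (lam n) (lam n) (mat_app n (householder n w))) {y \<in> space (lam n). \<Gamma> z y}"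
        by (simp only: lam_householder[OF w(1)] v_def)
      also have "\<dots> = emeasure (lam n) (mat_app n (householder n w) -` {y \<in> space (lam n). \<Gamma> z y} \<inter> space (lam n))"
        by (rule emeasure_distr[OF mat_app_measurable Gx[OF z]])
      also have "mat_app n (householder n w) -` {y \<in> space (lam n). \<Gamma> z y} \<inter> space (lam n) = {y \<in> space (lam n). \<Gamma> x y}"
      proof -
        have "mat_app n (householder n w) y \<in> space (lam n)" for y by (simp add: mat_app_def space_lam)
        moreover have "mat_app n (householder n w) y \<in> W \<longleftrightarrow> y \<in> W" if "y \<in> space (lam n)" for y
          using that calculation unfolding W by (simp add: householder_sum[OF w(2)] householder_norm[OF w(1)])
        moreover have "sqdist n z (proj n b (mat_app n (householder n w) y)) = sqdist n x (proj n b y)" for y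
          unfolding w(3)[symmetric] proj_householder[OF w(1,2)] by (rule sqdist_householder[OF w(1)])
        ultimately show ?thesis by (auto simp: \<Gamma>_def)
      qed
      finally show ?thesis ..
    qed (simp add: v_def)
    finally show ?thesis .
  qed
  have swap: "(\<integral>\<^sup>+x. indicator C x * v \<partial>\<sigma>) = (\<integral>\<^sup>+y. \<integral>\<^sup>+x. indicator C x * ?G x y \<partial>\<sigma> \<partial>lam n)" if [measurable]: "C \<in> sets (lam n)" for C
  proof -
    have "(\<integral>\<^sup>+x. indicator C x * v \<partial>\<sigma>) = (\<integral>\<^sup>+x. \<integral>\<^sup>+y. indicator C x * ?G x y \<partial>lam n \<partial>\<sigma>)"
    proof (rule nn_integral_cong_AE)
      show "AE x in \<sigma>. indicator C x * v = (\<integral>\<^sup>+y. indicator C x * ?G x y \<partial>lam n)"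
        using AE
      proof eventually_elim
        case (elim x)
        then have "x \<in> space \<sigma>" by (simp add: sp space_lam K_sphere_def)
        then have "(\<lambda>y. ?G x y) \<in> borel_measurable (lam n)"
          using measurable_compose[OF measurable_Pair1' Gm] by simp
        then show ?case using v[OF elim] by (simp add: nn_integral_cmult)
      qed
    qed
    also have "\<dots> = (\<integral>\<^sup>+y. \<integral>\<^sup>+x. indicator C x * ?G x y \<partial>\<sigma> \<partial>lam n)"
      by (rule P.Fubini'[symmetric]) (use Gm in \<open>simp add: split_def\<close>)
    finally show ?thesis .
  qed
  have up: "emeasure \<sigma> B * v \<le> h * emeasure (lam n) B'"
  proof -
    have "emeasure \<sigma> B * v = (\<integral>\<^sup>+x. indicator B x * v \<partial>\<sigma>)"
      by (simp add: nn_integral_multc)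
    also have "\<dots> = (\<integral>\<^sup>+y. \<integral>\<^sup>+x. indicator B x * ?G x y \<partial>\<sigma> \<partial>lam n)" by (rule swap) simp
    also have "\<dots> \<le> (\<integral>\<^sup>+y. h * indicator B' y \<partial>lam n)"
    proof (rule nn_integral_mono)
      fix y
      show "(\<integral>\<^sup>+x. indicator B x * ?G x y \<partial>\<sigma>) \<le> h * indicator B' y"
      proof (cases "y \<in> B' \<and> y \<in> W")
        case True
        have "(\<integral>\<^sup>+x. indicator B x * ?G x y \<partial>\<sigma>) \<le> (\<integral>\<^sup>+x. ?G x y \<partial>\<sigma>)"
          by (intro nn_integral_mono) (auto split: split_indicator)
        then show ?thesis using True h by simp
      next
        case False
        have "(\<integral>\<^sup>+x. indicator B x * ?G x y \<partial>\<sigma>) = (\<integral>\<^sup>+x. 0 \<partial>\<sigma>)"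
        proof (rule nn_integral_cong_AE)
          show "AE x in \<sigma>. indicator B x * ?G x y = 0"
            using AE by eventually_elim (use False hB in \<open>auto simp: \<Gamma>_def split: split_indicator\<close>)
        qed
        then show ?thesis by simp
      qed
    qed
    also have "\<dots> = h * emeasure (lam n) B'" by (simp add: nn_integral_cmult)
    finally show ?thesis .
  qed
  have low: "h * emeasure (lam n) A' \<le> emeasure \<sigma> A * v"
  proof -
    have "h * emeasure (lam n) A' = (\<integral>\<^sup>+y. h * indicator A' y \<partial>lam n)" by (simp add: nn_integral_cmult)
    also have "\<dots> \<le> (\<integral>\<^sup>+y. \<integral>\<^sup>+x. indicator A x * ?G x y \<partial>\<sigma> \<partial>lam n)"
    proof (rule nn_integral_mono)
      fix y
      show "h * indicator A' y \<le> (\<integral>\<^sup>+x. indicator A x * ?G x y \<partial>\<sigma>)"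
      proof (cases "y \<in> A'")
        case True
        then have "h = (\<integral>\<^sup>+x. ?G x y \<partial>\<sigma>)" using h A'W by auto
        also have "\<dots> = (\<integral>\<^sup>+x. indicator A x * ?G x y \<partial>\<sigma>)"
        proof (rule nn_integral_cong_AE)
          show "AE x in \<sigma>. ?G x y = indicator A x * ?G x y"
            using AE by eventually_elim (use True hA in \<open>auto simp: \<Gamma>_def split: split_indicator\<close>)
        qed
        finally show ?thesis using True by simp
      qed simp
    qed
    also have "\<dots> = (\<integral>\<^sup>+x. indicator A x * v \<partial>\<sigma>)" by (rule swap[symmetric]) simp
    also have "\<dots> = emeasure \<sigma> A * v" by (simp add: nn_integral_multc)
    finally show ?thesis .
  qed
  have vfin: "v < \<infinity>"
  proof -
    have "v \<le> emeasure (lam n) {x \<in> space (lam n). (\<Sum>i<n. (x i)\<^sup>2) \<le> M\<^sup>2}"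
      unfolding v_def by (intro emeasure_mono) (use Epos in \<open>auto simp: \<Gamma>_def W\<close>)
    also have "\<dots> < \<infinity>" by (rule lam_ball_finite)
    finally show ?thesis .
  qed
  have vpos: "v > 0"
  proof (rule ccontr)
    assume "\<not> v > 0"
    then have "h * emeasure (lam n) A' = 0" using low by simp
    then show False using hpos A'pos by (simp add: zero_less_iff_neq_zero)
  qed
  have "v * (emeasure \<sigma> B * emeasure (lam n) A') = (emeasure \<sigma> B * v) * emeasure (lam n) A'" by (simp only: mult_ac)
  also have "\<dots> \<le> (h * emeasure (lam n) B') * emeasure (lam n) A'" by (intro mult_right_mono up) simp
  also have "\<dots> = (h * emeasure (lam n) A') * emeasure (lam n) B'" by (simp only: mult_ac)
  also have "\<dots> \<le> (emeasure \<sigma> A * v) * emeasure (lam n) B'" by (intro mult_right_mono low) simp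
  also have "\<dots> = v * (emeasure \<sigma> A * emeasure (lam n) B')" by (simp only: mult_ac)
  finally show ?thesis using vfin vpos by (subst (asm) ennreal_mult_le_mult_iff) auto
qed

section \<open>Exchangeability and empirical distribution functions\<close>

definition swap_coords :: "nat \<Rightarrow> nat \<Rightarrow> nat \<Rightarrow> (nat \<Rightarrow> real) \<Rightarrow> nat \<Rightarrow> real" where
  "swap_coords n j l x = (\<lambda>i\<in>{..<n}. x (Transposition.transpose j l i))"

definition exchangeable :: "nat \<Rightarrow> (nat \<Rightarrow> real) measure \<Rightarrow> bool" where
  "exchangeable n M \<longleftrightarrow> prob_space M \<and> sets M = sets (lam n) \<and>
     (\<forall>j<n. \<forall>l<n. distr M M (swap_coords n j l) = M)"

lemma swap_coords_measurable: 
  assumes "j < n" "l < n" "sets M = sets (lam n)"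
  shows "swap_coords n j l \<in> M \<rightarrow>\<^sub>M M"
proof -
  have "Transposition.transpose j l i < n" if "i < n" for i using that assms by (auto simp: Transposition.transpose_def)
  then have "swap_coords n j l \<in> lam n \<rightarrow>\<^sub>M lam n"
    unfolding swap_coords_def by (intro measurable_restrict measurable_component_singleton) simp
  then show ?thesis by (simp add: measurable_cong_sets[OF assms(3) assms(3)])
qed

text \<open>
  By exchangeability \<open>f (x j)\<close> may be replaced by the average of \<open>f (x l)\<close> over the coordinates
  \<open>l \<ge> j\<close>, on which \<open>A\<close> does not depend. The sum over these coordinates differs from the sum over all
  coordinates by at most \<open>j\<close>.
\<close>
lemma exchangeable_remainder:
  assumes ex: "exchangeable n M" and j: "j < n"
    and [measurable]: "A \<in> borel_measurable M" and A1: "\<And>x. \<bar>A x\<bar> \<le> 1"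
    and Adep: "\<And>x y. (\<And>i. i < j \<Longrightarrow> x i = y i) \<Longrightarrow> A x = A y"
    and f [measurable]: "f \<in> borel_measurable borel" and f1: "\<And>x. \<bar>f x\<bar> \<le> 1"
  shows "\<bar>\<integral>x. A x * f (x j) \<partial>M\<bar> \<le> ((\<integral>x. \<bar>\<Sum>i<n. f (x i)\<bar> \<partial>M) + real j) / (real n - real j)"
proof -
  have sets: "sets M = sets (lam n)" and "prob_space M" using ex by (auto simp: exchangeable_def)
  interpret prob_space M by fact
  have comp [measurable]: "(\<lambda>x. x i) \<in> borel_measurable M" if "i < n" for i
    unfolding measurable_cong_sets[OF sets refl] using that measurable_component_singleton[of i "{..<n}" "\<lambda>_. lborel"] by simp
  have fm [measurable]: "(\<lambda>x. f (x i)) \<in> borel_measurable M" if "i < n" for i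
    using comp[OF that] by measurable
  have int: "integrable M (\<lambda>x. A x * f (x i))" if "i < n" for i
    by (rule integrable_const_bound[of _ 1]) (use that in \<open>auto simp: abs_mult intro!: mult_le_one A1 f1\<close>)
  have same: "(\<integral>x. A x * f (x l) \<partial>M) = (\<integral>x. A x * f (x j) \<partial>M)" if l: "l \<in> {j..<n}" for l
  proof -
    have "distr M M (swap_coords n j l) = M" using ex j l by (auto simp: exchangeable_def)
    then have "(\<integral>x. A x * f (x j) \<partial>M) = (\<integral>x. A x * f (x j) \<partial>distr M M (swap_coords n j l))" by simp
    also have "\<dots> = (\<integral>x. A (swap_coords n j l x) * f (swap_coords n j l x j) \<partial>M)"
      using j l by (intro integral_distr swap_coords_measurable sets) auto
    also have "\<dots> = (\<integral>x. A x * f (x l) \<partial>M)"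
    proof (rule Bochner_Integration.integral_cong[OF refl])
      fix x
      have "A (swap_coords n j l x) = A x" using j l by (intro Adep) (auto simp: swap_coords_def Transposition.transpose_def)
      then show "A (swap_coords n j l x) * f (swap_coords n j l x j) = A x * f (x l)" using j by (simp add: swap_coords_def)
    qed
    finally show ?thesis ..
  qed
  have absf: "\<bar>\<Sum>i\<in>S. f (x i)\<bar> \<le> card S" for S :: "nat set" and x :: "nat \<Rightarrow> real"
    using sum_norm_bound[of S "\<lambda>i. f (x i)" 1] f1 by simp
  have i1: "integrable M (\<lambda>x. \<bar>\<Sum>i<n. f (x i)\<bar>)"
    by (rule integrable_const_bound[of _ n]) (use absf[of _ "{..<n}"] in auto)
  have "(real n - real j) * (\<integral>x. A x * f (x j) \<partial>M) = (\<Sum>l\<in>{j..<n}. \<integral>x. A x * f (x l) \<partial>M)"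
  proof -
    have "(\<Sum>l\<in>{j..<n}. \<integral>x. A x * f (x l) \<partial>M) = (\<Sum>l\<in>{j..<n}. \<integral>x. A x * f (x j) \<partial>M)"
      by (rule sum.cong[OF refl same])
    then show ?thesis using j by (simp add: of_nat_diff)
  qed
  also have "\<dots> = (\<integral>x. (\<Sum>l\<in>{j..<n}. A x * f (x l)) \<partial>M)"
    by (rule Bochner_Integration.integral_sum[symmetric], rule int, simp)
  finally have eq: "(real n - real j) * (\<integral>x. A x * f (x j) \<partial>M) = (\<integral>x. (\<Sum>l\<in>{j..<n}. A x * f (x l)) \<partial>M)" .
  have "(real n - real j) * \<bar>\<integral>x. A x * f (x j) \<partial>M\<bar> = \<bar>\<integral>x. (\<Sum>l\<in>{j..<n}. A x * f (x l)) \<partial>M\<bar>"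
    unfolding eq[symmetric] abs_mult using j by simp
  also have "\<dots> \<le> (\<integral>x. \<bar>\<Sum>l\<in>{j..<n}. A x * f (x l)\<bar> \<partial>M)" by (rule integral_abs_bound)
  also have "\<dots> \<le> (\<integral>x. \<bar>\<Sum>i<n. f (x i)\<bar> + real j \<partial>M)"
  proof (rule integral_mono)
    show "integrable M (\<lambda>x. \<bar>\<Sum>l\<in>{j..<n}. A x * f (x l)\<bar>)"
      by (intro integrable_abs Bochner_Integration.integrable_sum, rule int, simp)
    show "integrable M (\<lambda>x. \<bar>\<Sum>i<n. f (x i)\<bar> + real j)" using i1 by simp
    fix x
    have "(\<Sum>i<n. f (x i)) = (\<Sum>i<j. f (x i)) + (\<Sum>l\<in>{j..<n}. f (x l))"
      using j by (subst sum.union_disjoint[symmetric]) (auto intro!: sum.cong)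
    moreover have "\<bar>\<Sum>i<j. f (x i)\<bar> \<le> j" using absf[of _ "{..<j}"] by simp
    ultimately have le: "\<bar>\<Sum>l\<in>{j..<n}. f (x l)\<bar> \<le> \<bar>\<Sum>i<n. f (x i)\<bar> + real j" by linarith
    have "\<bar>\<Sum>l\<in>{j..<n}. A x * f (x l)\<bar> = \<bar>A x\<bar> * \<bar>\<Sum>l\<in>{j..<n}. f (x l)\<bar>"
      by (simp add: sum_distrib_left[symmetric] abs_mult)
    also have "\<dots> \<le> 1 * \<bar>\<Sum>l\<in>{j..<n}. f (x l)\<bar>" using A1 by (intro mult_right_mono) auto
    finally show "\<bar>\<Sum>l\<in>{j..<n}. A x * f (x l)\<bar> \<le> \<bar>\<Sum>i<n. f (x i)\<bar> + real j" using le by simp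
  qed
  also have "\<dots> = (\<integral>x. \<bar>\<Sum>i<n. f (x i)\<bar> \<partial>M) + real j" using i1 by (simp add: prob_space)
  finally show ?thesis using j by (simp add: pos_le_divide_eq mult.commute)
qed

definition count_deviation :: "nat \<Rightarrow> real \<Rightarrow> real \<Rightarrow> (nat \<Rightarrow> real) \<Rightarrow> real" where
  "count_deviation n p t x = \<bar>\<Sum>i<n. (indicator {..t} (x i) - p)\<bar>"

text \<open>
  The indicators of \<open>x i \<le> t i\<close> are replaced by the numbers \<open>p i\<close> one at a time; the error of the \<open>j\<close>-th
  replacement is an average of the deviation of the number of coordinates below \<open>t j\<close>.
\<close>
lemma exchangeable_joint_cdf:
  assumes ex: "exchangeable n M" and k: "k \<le> n" and p: "\<And>i. 0 \<le> p i" "\<And>i. p i \<le> 1"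
  shows "\<bar>joint_cdf k M t - (\<Prod>i<k. p i)\<bar> \<le>
    (\<Sum>j<k. ((\<integral>x. count_deviation n (p j) (t j) x \<partial>M) + real j) / (real n - real j))"
proof -
  have sets: "sets M = sets (lam n)" and "prob_space M" using ex by (auto simp: exchangeable_def)
  interpret prob_space M by fact
  have comp [measurable]: "(\<lambda>x. x i) \<in> borel_measurable M" if "i < n" for i
    unfolding measurable_cong_sets[OF sets refl] using that measurable_component_singleton[of i "{..<n}" "\<lambda>_. lborel"] by simp
  define P where "P k x = (\<Prod>i<k. indicator {..t i} (x i) :: real)" for k and x :: "nat \<Rightarrow> real"
  have P01: "0 \<le> P k x" "P k x \<le> 1" for k x
    unfolding P_def by (auto intro!: prod_nonneg prod_le_1)
  have Pm [measurable]: "P k \<in> borel_measurable M" if "k \<le> n" for k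
    unfolding P_def
  proof (rule borel_measurable_prod)
    fix i assume "i \<in> {..<k}"
    then have [measurable]: "(\<lambda>x. x i) \<in> borel_measurable M" using that by (intro comp) auto
    show "(\<lambda>x. indicator {..t i} (x i) :: real) \<in> borel_measurable M" by measurable
  qed
  have joint: "joint_cdf k M t = (\<integral>x. P k x \<partial>M)" if "k \<le> n" for k
  proof -
    let ?S = "{x \<in> space M. \<forall>i<k. x i \<le> t i}"
    have eq: "P k x = indicator {x. \<forall>i<k. x i \<le> t i} x" for x
      unfolding P_def by (auto simp: indicator_def prod_zero_iff)
    have "(\<integral>x. P k x \<partial>M) = (\<integral>x. indicator ?S x \<partial>M)"
      unfolding eq by (intro Bochner_Integration.integral_cong) (auto simp: indicator_def)
    also have "\<dots> = measure M (?S \<inter> space M)" by (rule Bochner_Integration.integral_indicator)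
    also have "?S \<inter> space M = ?S" by blast
    finally show ?thesis by (simp add: joint_cdf_def)
  qed
  have "\<bar>(\<integral>x. P k x \<partial>M) - (\<Prod>i<k. p i)\<bar> \<le>
    (\<Sum>j<k. ((\<integral>x. count_deviation n (p j) (t j) x \<partial>M) + real j) / (real n - real j))"
    using k
  proof (induction k)
    case 0
    then show ?case by (simp add: P_def prob_space)
  next
    case (Suc k)
    have int: "integrable M (P k)" using Suc.prems P01 by (intro integrable_const_bound[of _ 1]) auto
    have [measurable]: "(\<lambda>x. x k) \<in> borel_measurable M" using Suc.prems by (intro comp) auto
    have [measurable]: "P k \<in> borel_measurable M" using Suc.prems by (intro Pm) auto
    have int2: "integrable M (\<lambda>x. P k x * (indicator {..t k} (x k) - p k))"
      using P01 p by (intro integrable_const_bound[of _ 1]) (auto simp: abs_mult indicator_def intro!: mult_le_one AE_I2)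
    have "(\<integral>x. P (Suc k) x \<partial>M) - (\<Prod>i<Suc k. p i) =
       (\<integral>x. P k x * (indicator {..t k} (x k) - p k) + p k * P k x \<partial>M) - p k * (\<Prod>i<k. p i)"
      by (simp only: P_def prod.lessThan_Suc) (simp add: algebra_simps)
    also have "\<dots> = (\<integral>x. P k x * (indicator {..t k} (x k) - p k) \<partial>M) + p k * ((\<integral>x. P k x \<partial>M) - (\<Prod>i<k. p i))"
      using int int2 by (subst Bochner_Integration.integral_add) (auto simp: algebra_simps)
    finally have "\<bar>(\<integral>x. P (Suc k) x \<partial>M) - (\<Prod>i<Suc k. p i)\<bar> \<le>
        \<bar>\<integral>x. P k x * (indicator {..t k} (x k) - p k) \<partial>M\<bar> + p k * \<bar>(\<integral>x. P k x \<partial>M) - (\<Prod>i<k. p i)\<bar>"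
      using abs_triangle_ineq[of "\<integral>x. P k x * (indicator {..t k} (x k) - p k) \<partial>M" "p k * ((\<integral>x. P k x \<partial>M) - (\<Prod>i<k. p i))"]
        p(1)[of k] unfolding abs_mult[of "p k"] by simp
    also have "p k * \<bar>(\<integral>x. P k x \<partial>M) - (\<Prod>i<k. p i)\<bar> \<le> 1 * \<bar>(\<integral>x. P k x \<partial>M) - (\<Prod>i<k. p i)\<bar>"
      using p by (intro mult_right_mono) auto
    also have "\<bar>\<integral>x. P k x * (indicator {..t k} (x k) - p k) \<partial>M\<bar> \<le>
       ((\<integral>x. count_deviation n (p k) (t k) x \<partial>M) + real k) / (real n - real k)"
      unfolding count_deviation_def
    proof (rule exchangeable_remainder[OF ex])
      show "k < n" using Suc.prems by simp
      show "\<bar>P k x\<bar> \<le> 1" for x using P01 by simp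
      show "P k x = P k y" if "\<And>i. i < k \<Longrightarrow> x i = y i" for x y unfolding P_def using that by simp
      show "\<bar>indicator {..t k} x - p k\<bar> \<le> 1" for x using p[of k] by (simp add: indicator_def)
    qed measurable
    finally show ?case using Suc by simp
  qed
  then show ?thesis using joint[OF k] by simp
qed

lemma perm_rotation:
  assumes "j < n" "l < n"
  shows "sphere_rotation n (\<lambda>i m. if m = Transposition.transpose j l i then 1 else 0)"
    and "mat_app n (\<lambda>i m. if m = Transposition.transpose j l i then 1 else 0) = swap_coords n j l"
proof -
  have lt: "Transposition.transpose j l i < n \<longleftrightarrow> i < n" for i using assms by (auto simp: Transposition.transpose_def)
  show "sphere_rotation n (\<lambda>i m. if m = Transposition.transpose j l i then 1 else 0)"
    unfolding sphere_rotation_def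
  proof (intro conjI allI impI)
    fix i m assume "i < n" "m < n"
    have "(\<Sum>q<n. (if i = Transposition.transpose j l q then 1 else 0) * (if m = Transposition.transpose j l q then 1 else 0) :: real)
       = (\<Sum>q<n. if q = Transposition.transpose j l i then (if i = m then 1 else 0) else 0)"
      by (intro sum.cong) (auto simp: Transposition.transpose_eq_iff)
    also have "\<dots> = (if i = m then 1 else 0)" using \<open>i < n\<close> lt by simp
    finally show "(\<Sum>q<n. (if i = Transposition.transpose j l q then 1 else 0) * (if m = Transposition.transpose j l q then 1 else 0) :: real) = (if i = m then 1 else 0)" .
  qed (use lt in simp)
  show "mat_app n (\<lambda>i m. if m = Transposition.transpose j l i then 1 else 0) = swap_coords n j l"
    using lt by (auto simp: mat_app_def swap_coords_def fun_eq_iff restrict_def if_distrib[of "\<lambda>a. a * _"] cong: if_cong)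
qed

text \<open>
  Permutation matrices are orthogonal and fix the constant vectors, and they preserve the positive
  orthant.
\<close>
lemma exchangeable_uniform_on_K:
  assumes u: "uniform_on_sphere n b \<sigma>" and pos: "emeasure \<sigma> (K n b) > 0" and Km: "K n b \<in> sets (lam n)"
  shows "exchangeable n (uniform_measure \<sigma> (K n b))"
proof -
  have sets: "sets \<sigma> = sets (lam n)" and "prob_space \<sigma>" 
    using u by (auto simp: uniform_on_sphere_def sets_lam)
  interpret prob_space \<sigma> by fact
  let ?U = "uniform_measure \<sigma> (K n b)"
  have K: "K n b \<in> sets \<sigma>" using Km sets by simp
  have setsU: "sets ?U = sets (lam n)" using sets by simp
  have "distr ?U ?U (swap_coords n j l) = ?U" if jl: "j < n" "l < n" for j l
  proof (rule measure_eqI)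
    fix A assume "A \<in> sets (distr ?U ?U (swap_coords n j l))"
    then have A: "A \<in> sets \<sigma>" by simp
    have m: "swap_coords n j l \<in> \<sigma> \<rightarrow>\<^sub>M \<sigma>" by (rule swap_coords_measurable[OF jl sets])
    have inv: "distr \<sigma> \<sigma> (swap_coords n j l) = \<sigma>"
      using u perm_rotation[OF jl] by (auto simp: uniform_on_sphere_def)
    have Kinv: "swap_coords n j l x \<in> K n b \<longleftrightarrow> x \<in> K n b" if "x \<in> space \<sigma>" for x
    proof -
      have ext: "x \<in> {..<n} \<rightarrow>\<^sub>E UNIV" using that sets_eq_imp_space_eq[OF sets] by (simp add: space_lam)
      have bij: "bij_betw (Transposition.transpose j l) {..<n} {..<n}"
        using jl by (intro bij_betw_byWitness[where f'="Transposition.transpose j l"]) (auto simp: Transposition.transpose_def)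
      have s: "(\<Sum>i<n. f (swap_coords n j l x i)) = (\<Sum>i<n. f (x i))" for f :: "real \<Rightarrow> real"
      proof -
        have "(\<Sum>i<n. f (swap_coords n j l x i)) = (\<Sum>i<n. f (x (Transposition.transpose j l i)))" by (simp add: swap_coords_def)
        also have "\<dots> = (\<Sum>i<n. f (x i))" by (rule sum.reindex_bij_betw[OF bij])
        finally show ?thesis .
      qed
      have "(\<forall>i<n. 0 < swap_coords n j l x i) \<longleftrightarrow> (\<forall>i<n. 0 < x i)"
      proof -
        have "(\<forall>i\<in>{..<n}. 0 < x i) \<longleftrightarrow> (\<forall>i\<in>Transposition.transpose j l ` {..<n}. 0 < x i)" using bij by (simp add: bij_betw_def)
        then show ?thesis by (auto simp: swap_coords_def)
      qed
      then show ?thesis using ext s[of "\<lambda>x. x"] s[of "\<lambda>x. x\<^sup>2"] by (auto simp: K_def PiE_iff swap_coords_def)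
    qed
    have "emeasure (distr ?U ?U (swap_coords n j l)) A = emeasure ?U (swap_coords n j l -` A \<inter> space \<sigma>)"
      using m A by (subst emeasure_distr) auto
    also have "\<dots> = emeasure \<sigma> (K n b \<inter> (swap_coords n j l -` A \<inter> space \<sigma>)) / emeasure \<sigma> (K n b)"
      using K measurable_sets[OF m A] by (rule emeasure_uniform_measure)
    also have "K n b \<inter> (swap_coords n j l -` A \<inter> space \<sigma>) = swap_coords n j l -` (K n b \<inter> A) \<inter> space \<sigma>"
      using Kinv by auto
    also have "emeasure \<sigma> \<dots> = emeasure (distr \<sigma> \<sigma> (swap_coords n j l)) (K n b \<inter> A)"
      using m A K by (subst emeasure_distr) auto
    also have "\<dots> / emeasure \<sigma> (K n b) = emeasure ?U A" using A K by (simp add: inv)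
    finally show "emeasure (distr ?U ?U (swap_coords n j l)) A = emeasure ?U A" .
  qed simp
  moreover have "prob_space ?U" using pos by (intro prob_space_uniform_measure) (auto simp: emeasure_eq_measure)
  ultimately show ?thesis unfolding exchangeable_def using setsU by simp
qed

section \<open>Products of Gibbs measures\<close>

lemma indep_vars_coordinates:
  assumes "prob_space D" "n > 0"
  shows "prob_space.indep_vars (PiM {..<n} (\<lambda>_. D)) (\<lambda>_. D) (\<lambda>i y. y i) {..<n}"
proof -
  let ?P = "PiM {..<n} (\<lambda>_. D)"
  interpret P: prob_space ?P by (intro prob_space_PiM assms)
  have "distr ?P ?P (\<lambda>x. \<lambda>i\<in>{..<n}. x i) = distr ?P ?P (\<lambda>x. x)"
    by (intro distr_cong) (auto simp: space_PiM PiE_def extensional_def restrict_def fun_eq_iff)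
  also have "\<dots> = ?P" by (rule distr_id2) simp
  also have "\<dots> = PiM {..<n} (\<lambda>i. distr ?P D (\<lambda>x. x i))"
    using assms by (intro PiM_cong refl) (auto intro!: distr_PiM_component[symmetric])
  finally show ?thesis using assms
    by (subst P.indep_vars_iff_distr_eq_PiM') (auto intro!: measurable_component_singleton)
qed

context gibbs begin

lemma prob_space_P: "prob_space (P n)" by (intro prob_space_PiM prob_space_D)

lemma sets_P: "sets (P n) = sets (lam n)" by (rule sets_PiM_cong) auto
lemma space_P: "space (P n) = space (lam n)" by (simp add: space_PiM)

lemma cdf_Lipschitz:
  assumes L: "\<And>x. gibbs_weight r s x / Zc \<le> L" and "a \<le> b"
  shows "D.prob {..b} \<le> D.prob {..a} + L * (b - a)"
proof -
  have "D.prob {..b} \<le> D.prob ({..a} \<union> {a..b})" using assms(2) by (intro D.finite_measure_mono) auto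
  also have "\<dots> \<le> D.prob {..a} + D.prob {a..b}" by (intro measure_Un_le) auto
  finally show ?thesis using prob_interval_le[OF L assms(2)] by simp
qed

lemma empirical_cdf_Hoeffding:
  assumes "\<delta> \<ge> 0" "n > 0"
  shows "measure (P n) {y \<in> space (P n). count_deviation n (D.prob {..t}) t y \<ge> real n * \<delta>} \<le> 2 * exp (- 2 * real n * \<delta>\<^sup>2)"
proof -
  interpret P: prob_space "P n" by (rule prob_space_P)
  define X where "X i y = (indicator {..t} (y i) :: real)" for i and y :: "nat \<Rightarrow> real"
  have indep: "P.indep_vars (\<lambda>_. borel) X {..<n}"
    unfolding X_def by (rule P.indep_vars_compose2[OF indep_vars_coordinates[OF prob_space_D \<open>n > 0\<close>]]) auto
  interpret H: Hoeffding_ineq "P n" "{..<n}" X "\<lambda>_. 0" "\<lambda>_. 1" "\<Sum>i<n. P.expectation (X i)"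
    by unfold_locales (auto simp: indep X_def indicator_def)
  have ex: "P.expectation (X i) = D.prob {..t}" if "i < n" for i
  proof -
    have "D.prob {..t} = (\<integral>z. indicator {..t} z \<partial>D)" by simp
    also have "\<dots> = (\<integral>z. indicator {..t} z \<partial>distr (P n) D (\<lambda>y. y i))"
      using that by (subst distr_PiM_component) (auto intro: prob_space_D)
    also have "\<dots> = P.expectation (X i)" unfolding X_def
      using that by (intro integral_distr measurable_component_singleton) auto
    finally show ?thesis ..
  qed
  have "P.prob {y \<in> space (P n). \<bar>(\<Sum>i<n. X i y) - (\<Sum>i<n. P.expectation (X i))\<bar> \<ge> real n * \<delta>}
     \<le> 2 * exp (-2 * (real n * \<delta>)\<^sup>2 / (\<Sum>i<n. (1 - 0)\<^sup>2))"
    using assms by (intro H.Hoeffding_ineq_abs_ge) auto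
  also have "-2 * (real n * \<delta>)\<^sup>2 / (\<Sum>i<n. (1 - 0)\<^sup>2) = - 2 * real n * \<delta>\<^sup>2"
    using assms by (simp add: power2_eq_square)
  also have "(\<Sum>i<n. P.expectation (X i)) = (\<Sum>i<n. D.prob {..t})" by (intro sum.cong refl ex) simp
  finally show ?thesis by (simp add: X_def count_deviation_def sum_subtractf)
qed

lemma P_density: "P n = density (lam n) (\<lambda>y. \<Prod>i<n. ennreal (gibbs_weight r s (y i) / Zc))"
proof -
  interpret PD: product_sigma_finite "\<lambda>_::nat. D" ..
  note [measurable] = lam_coordinate
  have m: "(\<lambda>y. \<Prod>i<n. ennreal (gibbs_weight r s (y i) / Zc)) \<in> borel_measurable (lam n)"
    by (intro borel_measurable_prod_ennreal) auto
  have "density (lam n) (\<lambda>y. \<Prod>i<n. ennreal (gibbs_weight r s (y i) / Zc)) = P n"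
  proof (rule PD.PiM_eqI)
    show "sets (density (lam n) (\<lambda>y. \<Prod>i<n. ennreal (gibbs_weight r s (y i) / Zc))) = sets (P n)"
      using sets_P by simp
    fix A :: "nat \<Rightarrow> real set" assume A: "\<And>i. i \<in> {..<n} \<Longrightarrow> A i \<in> sets D"
    have "emeasure (density (lam n) (\<lambda>y. \<Prod>i<n. ennreal (gibbs_weight r s (y i) / Zc))) (Pi\<^sub>E {..<n} A)
       = (\<integral>\<^sup>+y. (\<Prod>i<n. ennreal (gibbs_weight r s (y i) / Zc)) * indicator (Pi\<^sub>E {..<n} A) y \<partial>lam n)"
      using A m by (intro emeasure_density sets_PiM_I_finite) auto
    also have "\<dots> = (\<integral>\<^sup>+y. (\<Prod>i<n. ennreal (gibbs_weight r s (y i) / Zc) * indicator (A i) (y i)) \<partial>lam n)"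
    proof (rule nn_integral_cong)
      fix y assume y: "y \<in> space (lam n)"
      have "indicator (Pi\<^sub>E {..<n} A) y = (\<Prod>i<n. indicator (A i) (y i) :: ennreal)"
      proof (cases "y \<in> Pi\<^sub>E {..<n} A")
        case False
        then obtain i where "i < n" "y i \<notin> A i" using y by (auto simp: space_PiM PiE_def Pi_def)
        then have "(\<Prod>i<n. indicator (A i) (y i) :: ennreal) = 0" by (intro prod_zero bexI[of _ i]) auto
        then show ?thesis using False by simp
      qed (auto simp: PiE_def Pi_def)
      then show "(\<Prod>i<n. ennreal (gibbs_weight r s (y i) / Zc)) * indicator (Pi\<^sub>E {..<n} A) y =
        (\<Prod>i<n. ennreal (gibbs_weight r s (y i) / Zc) * indicator (A i) (y i))" by (simp add: prod.distrib)
    qed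
    also have "\<dots> = (\<Prod>i<n. \<integral>\<^sup>+x. ennreal (gibbs_weight r s x / Zc) * indicator (A i) x \<partial>lborel)"
      using A by (intro lborel_prod.product_nn_integral_prod) auto
    also have "\<dots> = (\<Prod>i<n. emeasure D (A i))"
      using A unfolding D_density by (intro prod.cong refl) (auto simp: emeasure_density)
    finally show "emeasure (density (lam n) (\<lambda>y. \<Prod>i<n. ennreal (gibbs_weight r s (y i) / Zc))) (Pi\<^sub>E {..<n} A) = (\<Prod>i\<in>{..<n}. emeasure D (A i))" .
  qed simp
  then show ?thesis ..
qed

text \<open>
  The product density is \<open>exp (- r * (\<Sum>i<n. (y i)\<^sup>2) - s * (\<Sum>i<n. y i)) / Zc ^ n\<close>. Where both sums vary
  by at most 1, the exponent varies by at most \<open>\<bar>r\<bar> + \<bar>s\<bar>\<close>.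
\<close>
lemma P_lam_comparison:
  assumes A: "A \<in> sets (lam n)"
    and sub: "\<And>y. y \<in> A \<Longrightarrow> (\<forall>i<n. 0 \<le> y i) \<and> \<bar>(\<Sum>i<n. y i) - m1\<bar> \<le> 1 \<and> \<bar>(\<Sum>i<n. (y i)\<^sup>2) - m2\<bar> \<le> 1"
  shows "emeasure (P n) A \<le> ennreal (exp (- r * m2 - s * m1 + (\<bar>r\<bar> + \<bar>s\<bar>)) / Zc ^ n) * emeasure (lam n) A"
    and "ennreal (exp (- r * m2 - s * m1 - (\<bar>r\<bar> + \<bar>s\<bar>)) / Zc ^ n) * emeasure (lam n) A \<le> emeasure (P n) A"
proof -
  define w where "w y = (\<Prod>i<n. ennreal (gibbs_weight r s (y i) / Zc))" for y :: "nat \<Rightarrow> real"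
  note [measurable] = lam_coordinate
  have [measurable]: "w \<in> borel_measurable (lam n)" unfolding w_def
    by (intro borel_measurable_prod_ennreal) auto
  have PA: "emeasure (P n) A = (\<integral>\<^sup>+y. w y * indicator A y \<partial>lam n)"
    unfolding P_density w_def[symmetric] using A by (simp add: emeasure_density)
  have w: "w y = ennreal (exp (- r * (\<Sum>i<n. (y i)\<^sup>2) - s * (\<Sum>i<n. y i)) / Zc ^ n)" if "y \<in> A" for y
  proof -
    have "w y = ennreal (\<Prod>i<n. gibbs_weight r s (y i) / Zc)"
      unfolding w_def using Zc_pos gibbs_weight_nonneg by (intro prod_ennreal) auto
    also have "(\<Prod>i<n. gibbs_weight r s (y i) / Zc) = (\<Prod>i<n. exp (- r * (y i)\<^sup>2 - s * y i)) / Zc ^ n"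
      using sub[OF that] by (simp add: gibbs_weight_def prod_dividef)
    also have "(\<Prod>i<n. exp (- r * (y i)\<^sup>2 - s * y i)) = exp (- r * (\<Sum>i<n. (y i)\<^sup>2) - s * (\<Sum>i<n. y i))"
      by (simp add: exp_sum[symmetric] sum_subtractf sum_distrib_left[symmetric] sum_negf)
    finally show ?thesis .
  qed
  have dev: "\<bar>(- r * (\<Sum>i<n. (y i)\<^sup>2) - s * (\<Sum>i<n. y i)) - (- r * m2 - s * m1)\<bar> \<le> \<bar>r\<bar> + \<bar>s\<bar>" if "y \<in> A" for y
  proof -
    have "(- r * (\<Sum>i<n. (y i)\<^sup>2) - s * (\<Sum>i<n. y i)) - (- r * m2 - s * m1) = - (r * ((\<Sum>i<n. (y i)\<^sup>2) - m2) + s * ((\<Sum>i<n. y i) - m1))"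
      by (simp add: algebra_simps)
    moreover have "\<bar>r * ((\<Sum>i<n. (y i)\<^sup>2) - m2)\<bar> \<le> \<bar>r\<bar>" "\<bar>s * ((\<Sum>i<n. y i) - m1)\<bar> \<le> \<bar>s\<bar>"
      using sub[OF that] by (auto simp: abs_mult intro!: mult_left_le)
    ultimately show ?thesis by linarith
  qed
  have "emeasure (P n) A \<le> (\<integral>\<^sup>+y. ennreal (exp (- r * m2 - s * m1 + (\<bar>r\<bar> + \<bar>s\<bar>)) / Zc ^ n) * indicator A y \<partial>lam n)"
    unfolding PA
  proof (intro nn_integral_mono)
    fix y
    show "w y * indicator A y \<le> ennreal (exp (- r * m2 - s * m1 + (\<bar>r\<bar> + \<bar>s\<bar>)) / Zc ^ n) * indicator A y"
    proof (cases "y \<in> A")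
      case True
      have "exp (- r * (\<Sum>i<n. (y i)\<^sup>2) - s * (\<Sum>i<n. y i)) \<le> exp (- r * m2 - s * m1 + (\<bar>r\<bar> + \<bar>s\<bar>))"
        unfolding exp_le_cancel_iff using dev[OF True] by linarith
      then show ?thesis using True w[OF True] Zc_pos by (auto intro!: ennreal_leI divide_right_mono)
    qed simp
  qed
  then show "emeasure (P n) A \<le> ennreal (exp (- r * m2 - s * m1 + (\<bar>r\<bar> + \<bar>s\<bar>)) / Zc ^ n) * emeasure (lam n) A"
    using A by (simp add: nn_integral_cmult_indicator)
  have "(\<integral>\<^sup>+y. ennreal (exp (- r * m2 - s * m1 - (\<bar>r\<bar> + \<bar>s\<bar>)) / Zc ^ n) * indicator A y \<partial>lam n) \<le> emeasure (P n) A"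
    unfolding PA
  proof (intro nn_integral_mono)
    fix y
    show "ennreal (exp (- r * m2 - s * m1 - (\<bar>r\<bar> + \<bar>s\<bar>)) / Zc ^ n) * indicator A y \<le> w y * indicator A y"
    proof (cases "y \<in> A")
      case True
      have "exp (- r * m2 - s * m1 - (\<bar>r\<bar> + \<bar>s\<bar>)) \<le> exp (- r * (\<Sum>i<n. (y i)\<^sup>2) - s * (\<Sum>i<n. y i))"
        unfolding exp_le_cancel_iff using dev[OF True] by linarith
      then show ?thesis using True w[OF True] Zc_pos by (auto intro!: ennreal_leI divide_right_mono)
    qed simp
  qed
  then show "ennreal (exp (- r * m2 - s * m1 - (\<bar>r\<bar> + \<bar>s\<bar>)) / Zc ^ n) * emeasure (lam n) A \<le> emeasure (P n) A"
    using A by (simp add: nn_integral_cmult_indicator)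
qed

end

section \<open>From the sphere to independent coordinates\<close>

lemma K_measurable [measurable]: "K n b \<in> sets (lam n)"
proof -
  have "Measurable.pred (lam n) (\<lambda>x. \<forall>i\<in>{..<n}. 0 < x i)" by (rule lam_all_coordinates) measurable
  then have "{x \<in> space (lam n). (\<forall>i\<in>{..<n}. 0 < x i) \<and> (\<Sum>i<n. x i) = real n \<and> (\<Sum>i<n. (x i)\<^sup>2) = real n * b} \<in> sets (lam n)"
    by measurable
  also have "{x \<in> space (lam n). (\<forall>i\<in>{..<n}. 0 < x i) \<and> (\<Sum>i<n. x i) = real n \<and> (\<Sum>i<n. (x i)\<^sup>2) = real n * b} = K n b"
    by (auto simp: K_def space_lam PiE_iff)
  finally show ?thesis .
qed

text \<open>
  The pairs of sum and sum of squares that describe the shell. The mean exceeds 1 by at least three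
  times the relative amount \<open>\<eta>\<close> by which the standard deviation is stretched. Because of this shift
  the points of the shell that project close to \<open>K n b\<close> have nonnegative coordinates, so the density
  of the Gibbs measure does not vanish there.
\<close>
definition shell_params :: "nat \<Rightarrow> real \<Rightarrow> real \<Rightarrow> (real \<times> real) set" where
  "shell_params n b \<eta> = {(s, q). real n * (1 + 3 * \<eta>) \<le> s \<and> s \<le> real n * (1 + 4 * \<eta>) \<and>
      b - 1 \<le> q / n - (s / n)\<^sup>2 \<and> q / n - (s / n)\<^sup>2 \<le> (b - 1) * (1 + \<eta>)\<^sup>2}"

definition shell :: "nat \<Rightarrow> real \<Rightarrow> real \<Rightarrow> (nat \<Rightarrow> real) set" where
  "shell n b \<eta> = {y \<in> space (lam n). ((\<Sum>i<n. y i), (\<Sum>i<n. (y i)\<^sup>2)) \<in> shell_params n b \<eta>}"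

text \<open>
  The core is a part of the shell with an explicit description by sum and sum of squares: both are
  close to the values at the middle of the shell. The coordinates of its points are so far from zero
  that everything on the sphere close to their projection lies in \<open>K n b\<close>.
\<close>
definition core_sum :: "nat \<Rightarrow> real \<Rightarrow> real" where
  "core_sum n \<eta> = real n * (1 + 7 / 2 * \<eta>)"

definition core_sumsq :: "nat \<Rightarrow> real \<Rightarrow> real \<Rightarrow> real" where
  "core_sumsq n b \<eta> = real n * ((b - 1) * (1 + \<eta>) + (1 + 7 / 2 * \<eta>)\<^sup>2)"

definition core_width :: "real \<Rightarrow> real \<Rightarrow> real" where
  "core_width b \<eta> = \<eta> * min (1/2) ((b - 1) / 4)"

definition core :: "nat \<Rightarrow> real \<Rightarrow> real \<Rightarrow> (nat \<Rightarrow> real) set" where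
  "core n b \<eta> = {y \<in> space (lam n). (\<forall>i\<in>{..<n}. 8 * \<eta> \<le> y i) \<and>
      \<bar>(\<Sum>i<n. y i) - core_sum n \<eta>\<bar> \<le> core_width b \<eta> \<and> \<bar>(\<Sum>i<n. (y i)\<^sup>2) - core_sumsq n b \<eta>\<bar> \<le> core_width b \<eta>}"

context
  fixes n :: nat and b \<eta> :: real
  assumes n: "n > 0" and b: "b > 1" and \<eta>: "0 < \<eta>" "\<eta> \<le> 1/8"
begin

lemma core_measurable [measurable]: "core n b \<eta> \<in> sets (lam n)"
proof -
  have [measurable]: "Measurable.pred (lam n) (\<lambda>x. \<forall>i\<in>{..<n}. 8 * \<eta> \<le> x i)" by (rule lam_all_coordinates) measurable
  show ?thesis unfolding core_def by measurable
qed

lemma core_subset_shell: "core n b \<eta> \<subseteq> shell n b \<eta>"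
proof
  fix y assume y: "y \<in> core n b \<eta>"
  define S where "S = (\<Sum>i<n. y i) / n"
  define Q where "Q = (\<Sum>i<n. (y i)\<^sup>2) / n"
  define k where "k = core_width b \<eta>"
  have k: "0 < k" "k \<le> \<eta> / 2" "4 * k \<le> (b - 1) * \<eta>" 
    using \<eta> b by (auto simp: k_def core_width_def min_def field_simps)
  have n1: "real n \<ge> 1" using n by simp
  have d1: "\<bar>S - (1 + 7 / 2 * \<eta>)\<bar> \<le> k"
  proof -
    have "\<bar>S - (1 + 7 / 2 * \<eta>)\<bar> = \<bar>(\<Sum>i<n. y i) - core_sum n \<eta>\<bar> / n"
    proof -
      have "S - (1 + 7 / 2 * \<eta>) = ((\<Sum>i<n. y i) - core_sum n \<eta>) / n"
        using n1 by (simp add: S_def core_sum_def field_simps)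
      then show ?thesis by (simp only: abs_divide abs_of_nat)
    qed
    also have "\<dots> \<le> k / n" using y by (intro divide_right_mono) (auto simp: core_def k_def)
    also have "\<dots> \<le> k" using n1 k(1) by (simp add: field_simps)
    finally show ?thesis .
  qed
  have d2: "\<bar>Q - ((b - 1) * (1 + \<eta>) + (1 + 7 / 2 * \<eta>)\<^sup>2)\<bar> \<le> k"
  proof -
    have "\<bar>Q - ((b - 1) * (1 + \<eta>) + (1 + 7 / 2 * \<eta>)\<^sup>2)\<bar> = \<bar>(\<Sum>i<n. (y i)\<^sup>2) - core_sumsq n b \<eta>\<bar> / n"
    proof -
      have "Q - ((b - 1) * (1 + \<eta>) + (1 + 7 / 2 * \<eta>)\<^sup>2) = ((\<Sum>i<n. (y i)\<^sup>2) - core_sumsq n b \<eta>) / n"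
        using n1 by (simp add: Q_def core_sumsq_def diff_divide_distrib)
      then show ?thesis by (simp only: abs_divide abs_of_nat)
    qed
    also have "\<dots> \<le> k / n" using y by (intro divide_right_mono) (auto simp: core_def k_def)
    also have "\<dots> \<le> k" using n1 k(1) by (simp add: field_simps)
    finally show ?thesis .
  qed
  have S: "1 + 3 * \<eta> \<le> S" "S \<le> 1 + 4 * \<eta>" using d1 k(2) by linarith+
  have dsq: "\<bar>S\<^sup>2 - (1 + 7 / 2 * \<eta>)\<^sup>2\<bar> \<le> k * 3"
  proof -
    have "\<bar>S\<^sup>2 - (1 + 7 / 2 * \<eta>)\<^sup>2\<bar> = \<bar>S - (1 + 7 / 2 * \<eta>)\<bar> * \<bar>S + (1 + 7 / 2 * \<eta>)\<bar>"
      by (simp add: power2_eq_square abs_mult[symmetric] algebra_simps)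
    also have "\<dots> \<le> k * 3" using d1 S \<eta> k by (intro mult_mono) auto
    finally show ?thesis .
  qed
  have V: "b - 1 \<le> Q - S\<^sup>2" "Q - S\<^sup>2 \<le> (b - 1) * (1 + \<eta>)\<^sup>2"
  proof -
    have "\<bar>(Q - S\<^sup>2) - (b - 1) * (1 + \<eta>)\<bar> \<le> (b - 1) * \<eta>" using d2 dsq k(3) by linarith
    moreover have "(b - 1) * (1 + \<eta>) = (b - 1) + (b - 1) * \<eta>" by (simp add: algebra_simps)
    moreover have "(b - 1) * (1 + \<eta>)\<^sup>2 = (b - 1) + 2 * ((b - 1) * \<eta>) + (b - 1) * \<eta>\<^sup>2" by (simp add: algebra_simps power2_eq_square)
    moreover have "(b - 1) * \<eta>\<^sup>2 \<ge> 0" using b by simp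
    ultimately show "b - 1 \<le> Q - S\<^sup>2" "Q - S\<^sup>2 \<le> (b - 1) * (1 + \<eta>)\<^sup>2" by linarith+
  qed
  have "real n * (1 + 3 * \<eta>) \<le> (\<Sum>i<n. y i)" "(\<Sum>i<n. y i) \<le> real n * (1 + 4 * \<eta>)"
    using S n1 by (simp_all add: S_def field_simps)
  then show "y \<in> shell n b \<eta>" using y V by (simp add: shell_def shell_params_def core_def S_def Q_def)
qed

lemma shell_facts:
  fixes y :: "nat \<Rightarrow> real"
  assumes y: "y \<in> shell n b \<eta>"
  obtains m e where "3 * \<eta> \<le> m" "m \<le> 4 * \<eta>" "0 \<le> e" "e \<le> \<eta>"
    "\<And>i. i < n \<Longrightarrow> y i = (1 + m) + (1 + e) * (proj n b y i - 1)"
    "proj n b y \<in> K_sphere n b" "(\<Sum>i<n. y i) = real n * (1 + m)" "(\<Sum>i<n. (y i)\<^sup>2) = real n * ((b - 1) * (1 + e)\<^sup>2 + (1 + m)\<^sup>2)"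
proof -
  define S where "S = (\<Sum>i<n. y i) / n"
  define V where "V = (\<Sum>i<n. (y i)\<^sup>2) / n - S\<^sup>2"
  have n1: "real n \<ge> 1" using n by simp
  have S: "1 + 3 * \<eta> \<le> S" "S \<le> 1 + 4 * \<eta>" and V: "b - 1 \<le> V" "V \<le> (b - 1) * (1 + \<eta>)\<^sup>2"
    using y n1 by (auto simp: shell_def shell_params_def S_def V_def field_simps)
  define e where "e = sqrt (V / (b - 1)) - 1"
  have q: "1 \<le> V / (b - 1)" "V / (b - 1) \<le> (1 + \<eta>)\<^sup>2" using V b by (auto simp: field_simps)
  have e: "0 \<le> e" "e \<le> \<eta>" using q \<eta> real_le_lsqrt[of "1 + \<eta>" "V / (b - 1)"] by (auto simp: e_def)
  have e2: "(1 + e)\<^sup>2 * (b - 1) = V" using q b by (simp add: e_def)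
  have k: "sqrt ((b - 1) / V) = 1 / (1 + e)"
    by (simp add: e_def real_sqrt_divide)
  have p: "proj n b y i = 1 + (y i - S) / (1 + e)" if "i < n" for i
    using that unfolding proj_def S_def[symmetric] V_def[symmetric] k by simp
  show ?thesis
  proof (rule that[of "S - 1" e])
    show "3 * \<eta> \<le> S - 1" "S - 1 \<le> 4 * \<eta>" using S by auto
    show "0 \<le> e" "e \<le> \<eta>" by fact+
    show "y i = (1 + (S - 1)) + (1 + e) * (proj n b y i - 1)" if "i < n" for i
      using p[OF that] e by (simp add: field_simps)
    show "proj n b y \<in> K_sphere n b"
      using V b by (intro proj_in_sphere n b) (simp add: V_def S_def)
    show "(\<Sum>i<n. y i) = real n * (1 + (S - 1))" using n by (simp add: S_def)
    show "(\<Sum>i<n. (y i)\<^sup>2) = real n * ((b - 1) * (1 + e)\<^sup>2 + (1 + (S - 1))\<^sup>2)"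
      using e2 n by (simp add: mult.commute V_def field_simps)
  qed
qed

lemma shell_sums:
  assumes y: "y \<in> shell n b \<eta>" and small: "real n * \<eta> * (3 * b + 7) \<le> 1"
  shows "\<bar>(\<Sum>i<n. y i) - real n\<bar> \<le> 1" "\<bar>(\<Sum>i<n. (y i)\<^sup>2) - real n * b\<bar> \<le> 1"
proof -
  from shell_facts[OF y] obtain m e where me: "3 * \<eta> \<le> m" "m \<le> 4 * \<eta>" "0 \<le> e" "e \<le> \<eta>"
    and s: "(\<Sum>i<n. y i) = real n * (1 + m)" "(\<Sum>i<n. (y i)\<^sup>2) = real n * ((b - 1) * (1 + e)\<^sup>2 + (1 + m)\<^sup>2)" by metis
  have "real n * m \<le> real n * (\<eta> * (3 * b + 7))"
  proof (rule mult_left_mono)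
    have "\<eta> * 4 \<le> \<eta> * (3 * b + 7)" using b \<eta> by (intro mult_left_mono) auto
    then show "m \<le> \<eta> * (3 * b + 7)" using me by linarith
  qed simp
  also have "\<dots> \<le> 1" using small by (simp add: mult.assoc)
  finally have nm: "real n * m \<le> 1" .
  have m0: "m \<ge> 0" using me \<eta> by linarith
  then show "\<bar>(\<Sum>i<n. y i) - real n\<bar> \<le> 1" using nm by (simp add: s algebra_simps)
  define d where "d = (b - 1) * (2 * e + e\<^sup>2) + (2 * m + m\<^sup>2)"
  have "e * e \<le> \<eta> * 1" by (rule mult_mono) (use me \<eta> in auto)
  moreover have "m * m \<le> (4 * \<eta>) * (1/2)" by (rule mult_mono) (use me m0 \<eta> in auto)
  ultimately have "e\<^sup>2 \<le> \<eta>" "m\<^sup>2 \<le> 2 * \<eta>" by (auto simp: power2_eq_square)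
  then have "2 * e + e\<^sup>2 \<le> 3 * \<eta>" "2 * m + m\<^sup>2 \<le> 10 * \<eta>" using me by linarith+
  then have "d \<le> (b - 1) * (3 * \<eta>) + 10 * \<eta>" unfolding d_def using b by (intro add_mono mult_left_mono) auto
  also have "\<dots> = \<eta> * (3 * b + 7)" by (simp add: algebra_simps)
  finally have "real n * d \<le> 1" using small mult_left_mono[of d "\<eta> * (3 * b + 7)" "real n"] by (simp add: mult.assoc)
  moreover have "d \<ge> 0" unfolding d_def using b me m0 by simp
  moreover have "(\<Sum>i<n. (y i)\<^sup>2) - real n * b = real n * d" unfolding s d_def by (simp add: algebra_simps power2_eq_square)
  ultimately show "\<bar>(\<Sum>i<n. (y i)\<^sup>2) - real n * b\<bar> \<le> 1" by simp
qed

lemma sqdist_coord: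
  assumes "sqdist n x z < \<eta>\<^sup>2" "i < n" shows "\<bar>x i - z i\<bar> \<le> \<eta>"
proof -
  have "(x i - z i)\<^sup>2 \<le> sqdist n x z" unfolding sqdist_def using assms(2) by (intro member_le_sum) auto
  then have "(x i - z i)\<^sup>2 \<le> \<eta>\<^sup>2" using assms(1) by linarith
  then have "\<bar>x i - z i\<bar> \<le> \<bar>\<eta>\<bar>" by (simp only: abs_le_square_iff)
  then show ?thesis using \<eta> by simp
qed

text \<open>
  Coordinates of size \<open>8 * \<eta>\<close> outweigh the shift of the mean by \<open>4 * \<eta>\<close> and the distance \<open>\<eta>\<close>.
\<close>
lemma core_projects_into_K:
  assumes y: "y \<in> core n b \<eta>" and x: "x \<in> K_sphere n b" and d: "sqdist n x (proj n b y) < \<eta>\<^sup>2"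
  shows "x \<in> K n b"
proof -
  have "y \<in> shell n b \<eta>" using y core_subset_shell by auto
  from shell_facts[OF this] obtain m e where me: "3 * \<eta> \<le> m" "m \<le> 4 * \<eta>" "0 \<le> e" "e \<le> \<eta>"
    and yi: "\<And>i. i < n \<Longrightarrow> y i = (1 + m) + (1 + e) * (proj n b y i - 1)" by metis
  have "0 < x i" if i: "i < n" for i
  proof -
    define p where "p = proj n b y i"
    have "8 * \<eta> \<le> y i" using y i by (auto simp: core_def)
    then have "(1 + e) * p \<ge> 8 * \<eta> - m + e" using yi[OF i] by (simp add: p_def algebra_simps)
    then have "(1 + e) * p \<ge> 4 * \<eta>" using me by linarith
    moreover have "(1 + e) * p \<le> (1 + e) * (2 * \<eta>)" if "p \<le> 2 * \<eta>" using that me by (intro mult_left_mono) auto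
    moreover have "(1 + e) * (2 * \<eta>) < 2 * (2 * \<eta>)" using me \<eta> by (intro mult_strict_right_mono) auto
    ultimately have "p > 2 * \<eta>" by linarith
    then show ?thesis using sqdist_coord[OF d i] \<eta> unfolding p_def by linarith
  qed
  then show ?thesis using x by (auto simp: K_def K_sphere_def PiE_iff)
qed

text \<open>
  The shift of the mean by \<open>3 * \<eta>\<close> outweighs the stretching and the distance \<open>\<eta>\<close> for a coordinate near
  zero. Large coordinates are at most of order \<open>n\<close>, so stretching moves them by a multiple of \<open>\<eta> * n\<close>.
\<close>
lemma K_lifts_to_shell:
  assumes y: "y \<in> shell n b \<eta>" and x: "x \<in> K n b" and d: "sqdist n x (proj n b y) < \<eta>\<^sup>2" and i: "i < n"
  shows "0 \<le> y i" "\<bar>y i - x i\<bar> \<le> \<eta> * n * (6 + b)"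
proof -
  from shell_facts[OF y] obtain m e where me: "3 * \<eta> \<le> m" "m \<le> 4 * \<eta>" "0 \<le> e" "e \<le> \<eta>"
    and yi: "\<And>i. i < n \<Longrightarrow> y i = (1 + m) + (1 + e) * (proj n b y i - 1)" and pS: "proj n b y \<in> K_sphere n b" by metis
  define p where "p = proj n b y i"
  have px: "\<bar>x i - p\<bar> \<le> \<eta>" unfolding p_def by (rule sqdist_coord[OF d i])
  have x0: "0 < x i" using x i by (auto simp: K_def PiE_iff)
  have n1: "real n \<ge> 1" using n by simp
  have yp: "y i = m - e + p + e * p" using yi[OF i] by (simp add: p_def algebra_simps)
  have "e * p \<ge> e * (- \<eta>)" using px x0 me by (intro mult_left_mono) auto
  moreover have "e * \<eta> \<le> \<eta> * 1" using me \<eta> by (intro mult_mono) auto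
  ultimately show "0 \<le> y i" unfolding yp using me px x0 by linarith
  have "p\<^sup>2 \<le> real n * b"
  proof -
    have "p\<^sup>2 \<le> (\<Sum>i<n. (proj n b y i)\<^sup>2)" unfolding p_def using i by (intro member_le_sum) auto
    then show ?thesis using pS by (simp add: K_sphere_def)
  qed
  also have "\<dots> \<le> (real n * b)\<^sup>2" using n1 b mult_mono[OF n1, of 1 b] by (intro self_le_power) auto
  finally have "\<bar>p\<bar> \<le> real n * b" using b by (simp add: abs_le_square_iff[symmetric])
  then have "\<bar>e * p\<bar> \<le> \<eta> * (real n * b)" unfolding abs_mult using me b by (intro mult_mono) auto
  then have "\<bar>y i - x i\<bar> \<le> 6 * \<eta> + \<eta> * (real n * b)" unfolding yp using me px by linarith
  also have "6 * \<eta> \<le> \<eta> * n * 6" using n1 \<eta> by simp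
  finally show "\<bar>y i - x i\<bar> \<le> \<eta> * n * (6 + b)" by (simp add: algebra_simps)
qed

end

lemma shell_params_measurable [measurable]: "shell_params n b \<eta> \<in> sets (borel \<Otimes>\<^sub>M borel)"
proof -
  have "{p \<in> space (borel \<Otimes>\<^sub>M borel). real n * (1 + 3 * \<eta>) \<le> fst p \<and> fst p \<le> real n * (1 + 4 * \<eta>) \<and>
      b - 1 \<le> snd p / n - (fst p / n)\<^sup>2 \<and> snd p / n - (fst p / n)\<^sup>2 \<le> (b - 1) * (1 + \<eta>)\<^sup>2} \<in> sets (borel \<Otimes>\<^sub>M borel)"
    by measurable
  also have "{p \<in> space (borel \<Otimes>\<^sub>M borel). real n * (1 + 3 * \<eta>) \<le> fst p \<and> fst p \<le> real n * (1 + 4 * \<eta>) \<and>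
      b - 1 \<le> snd p / n - (fst p / n)\<^sup>2 \<and> snd p / n - (fst p / n)\<^sup>2 \<le> (b - 1) * (1 + \<eta>)\<^sup>2} = shell_params n b \<eta>"
    by (auto simp: shell_params_def space_pair_measure)
  finally show ?thesis .
qed

lemma shell_measurable [measurable]: "shell n b \<eta> \<in> sets (lam n)"
proof -
  have "(\<lambda>y. ((\<Sum>i<n. y i), (\<Sum>i<n. (y i)\<^sup>2))) \<in> lam n \<rightarrow>\<^sub>M borel \<Otimes>\<^sub>M borel" by measurable
  from measurable_sets[OF this shell_params_measurable] show ?thesis unfolding shell_def by (simp add: vimage_def Int_def conj_commute)
qed

lemma shell_params_bounds:
  assumes n: "n > 0" and b: "b > 1" and \<eta>: "0 < \<eta>" "\<eta> \<le> 1/8" and sq: "(s, q) \<in> shell_params n b \<eta>"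
  shows "q / n - (s / n)\<^sup>2 > 0 \<and> q \<le> (4 * b * n)\<^sup>2"
proof
  have n1: "real n \<ge> 1" using n by simp
  show "q / n - (s / n)\<^sup>2 > 0" using sq b by (auto simp: shell_params_def)
  have "0 \<le> s / n" "s / n \<le> 2"
  proof -
    have "real n * (1 + 3 * \<eta>) \<le> s" "s \<le> real n * (1 + 4 * \<eta>)" using sq by (auto simp: shell_params_def)
    moreover have "real n * (1 + 4 * \<eta>) \<le> real n * 2" "0 \<le> real n * (1 + 3 * \<eta>)" using \<eta> n1 by (auto intro!: mult_left_mono)
    ultimately have "0 \<le> s" "s \<le> real n * 2" by linarith+
    then show "0 \<le> s / n" "s / n \<le> 2" using n1 by (simp_all add: divide_simps mult.commute)
  qed
  then have "(s / n)\<^sup>2 \<le> 2\<^sup>2" by (intro power_mono) auto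
  moreover have "(1 + \<eta>)\<^sup>2 \<le> 2\<^sup>2" using \<eta> by (intro power_mono) auto
  then have "(b - 1) * (1 + \<eta>)\<^sup>2 \<le> (b - 1) * 2\<^sup>2" using b by (intro mult_left_mono) auto
  ultimately have "q / n \<le> 4 * b" using sq by (auto simp: shell_params_def)
  then have "q \<le> 4 * b * n" using n1 by (simp add: divide_simps)
  also have "\<dots> \<le> (4 * b * n)\<^sup>2" using n1 b mult_mono[of 1 "4 * b" 1 "real n"] by (intro self_le_power) auto
  finally show "q \<le> (4 * b * n)\<^sup>2" .
qed

lemma integral_deviation_le:
  assumes "prob_space M" and [measurable]: "B \<in> sets M" "f \<in> borel_measurable M"
    and c: "c \<ge> 0" "d \<ge> 0" and f: "\<And>x. 0 \<le> f x" "\<And>x. f x \<le> c" and AE: "AE x in M. x \<notin> B \<longrightarrow> f x \<le> d"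
  shows "(\<integral>x. f x \<partial>M) \<le> d + c * measure M B"
proof -
  interpret prob_space M by fact
  have "(\<integral>x. f x \<partial>M) \<le> (\<integral>x. d + c * indicator B x \<partial>M)"
  proof (rule integral_mono_AE)
    show "integrable M f" using f by (intro integrable_const_bound[of _ c]) auto
    show "integrable M (\<lambda>x. d + c * indicator B x)"
      using c by (intro integrable_const_bound[of _ "d + c"]) (auto simp: indicator_def)
    show "AE x in M. f x \<le> d + c * indicator B x"
      using AE by eventually_elim (use f(2) c in \<open>auto simp: indicator_def intro: add_increasing\<close>)
  qed
  also have "\<dots> = d + c * measure M B"
  proof -
    have "integrable M (\<lambda>x. c * indicator B x)"
      using c by (intro integrable_const_bound[of _ c]) (auto simp: indicator_def)
    moreover have "(\<integral>x. indicator B x \<partial>M) = measure M B"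
      by (subst Bochner_Integration.integral_indicator) (simp add: Int_absorb2[OF sets.sets_into_space])
    ultimately show ?thesis by (simp add: prob_space)
  qed
  finally show ?thesis .
qed

context gibbs begin

text \<open>
  If a point of \<open>K n b\<close> has a bad empirical distribution function at \<open>t\<close>, then the points of the shell
  that project close to it have a bad one at \<open>t + \<rho>\<close> or at \<open>t - \<rho>\<close>, because their coordinates differ by
  at most \<open>\<rho>\<close>. Hoeffding's inequality bounds the Gibbs probability of the latter, and the comparison of
  the sphere with the shell divides it by the Gibbs probability of the core. The value of the Gibbs
  density on the shell cancels in this quotient.
\<close>
lemma empirical_cdf_deviation:
  assumes n: "n > 0" and b: "b > 1" and \<eta>: "0 < \<eta>" "\<eta> \<le> 1/8" and small: "real n * \<eta> * (3 * b + 7) \<le> 1"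
    and L: "\<And>x. gibbs_weight r s x / Zc \<le> L" and \<delta>: "0 \<le> \<delta>" "L * (\<eta> * n * (6 + b)) \<le> \<delta> / 2"
    and u: "uniform_on_sphere n b \<sigma>" and p: "0 < p" "p \<le> measure (P n) (core n b \<eta>)"
  shows "emeasure \<sigma> (K n b) > 0"
    and "(\<integral>x. count_deviation n (D.prob {..t}) t x \<partial>uniform_measure \<sigma> (K n b))
      \<le> real n * (\<delta> + 4 * exp (2 * (\<bar>r\<bar> + \<bar>s\<bar>)) * exp (- real n * \<delta>\<^sup>2 / 2) / p)"
proof -
  have sets [measurable_cong]: "sets \<sigma> = sets (lam n)" and "prob_space \<sigma>" and AE: "AE x in \<sigma>. x \<in> K_sphere n b"
    using u by (auto simp: uniform_on_sphere_def sets_lam)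
  interpret S: prob_space \<sigma> by fact
  interpret P: prob_space "P n" by (rule prob_space_P)
  note [measurable_cong] = sets_P
  have spS: "space \<sigma> = space (lam n)" using sets_eq_imp_space_eq[OF sets] .
  have cm [measurable]: "core n b \<eta> \<in> sets (lam n)" by (rule core_measurable[OF n b \<eta>])
  have csub: "core n b \<eta> \<subseteq> shell n b \<eta>" by (rule core_subset_shell[OF n b \<eta>])
  define E where "E = \<bar>r\<bar> + \<bar>s\<bar>"
  define c0 where "c0 = - r * (real n * b) - s * real n"
  have coreP: "emeasure (P n) (core n b \<eta>) \<le> ennreal (exp (c0 + E) / Zc ^ n) * emeasure (lam n) (core n b \<eta>)"
    unfolding c0_def E_def
  proof (rule P_lam_comparison(1)[OF cm])
    fix y assume y: "y \<in> core n b \<eta>"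
    have "0 \<le> y i" if "i < n" for i using y that \<eta> by (auto simp: core_def intro: order_trans[of 0 "8 * \<eta>"])
    then show "(\<forall>i<n. 0 \<le> y i) \<and> \<bar>(\<Sum>i<n. y i) - real n\<bar> \<le> 1 \<and> \<bar>(\<Sum>i<n. (y i)\<^sup>2) - real n * b\<bar> \<le> 1"
      using shell_sums[OF n b \<eta> subsetD[OF csub y] small] by auto
  qed
  have corePp: "ennreal p \<le> emeasure (P n) (core n b \<eta>)" using p by (simp add: P.emeasure_eq_measure)
  have corepos: "emeasure (lam n) (core n b \<eta>) > 0"
  proof (rule ccontr)
    assume "\<not> ?thesis"
    then have "emeasure (P n) (core n b \<eta>) = 0" using coreP by simp
    then show False using corePp p by simp
  qed
  have cmp: "emeasure \<sigma> B * emeasure (lam n) (core n b \<eta>) \<le> emeasure \<sigma> (K n b) * emeasure (lam n) B'"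
    if "B \<in> sets (lam n)" "B' \<in> sets (lam n)"
      "\<And>x y. x \<in> B \<Longrightarrow> x \<in> K_sphere n b \<Longrightarrow> y \<in> shell n b \<eta> \<Longrightarrow> sqdist n x (proj n b y) < \<eta>\<^sup>2 \<Longrightarrow> y \<in> B'" for B B'
    by (rule sphere_shell_comparison[where \<rho>="\<eta>\<^sup>2", OF u n b _ shell_params_measurable shell_params_bounds[OF n b \<eta>] shell_def])
       (use that \<eta> csub corepos core_projects_into_K[OF n b \<eta>] in auto)
  show pos: "emeasure \<sigma> (K n b) > 0"
  proof (rule ccontr)
    assume "\<not> ?thesis"
    then have "emeasure \<sigma> (space (lam n)) * emeasure (lam n) (core n b \<eta>) = 0"
      using cmp[of "space (lam n)" "shell n b \<eta>"] by simp
    then show False using corepos S.emeasure_space_1 by (simp add: spS)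
  qed
  let ?U = "uniform_measure \<sigma> (K n b)"
  have KS: "K n b \<in> sets \<sigma>" using K_measurable sets by simp
  interpret U: prob_space ?U using pos by (intro prob_space_uniform_measure) (auto simp: S.emeasure_eq_measure)
  define \<rho> where "\<rho> = \<eta> * n * (6 + b)"
  have \<rho>: "\<rho> \<ge> 0" using \<eta> b by (simp add: \<rho>_def)
  define F where "F t = D.prob {..t}" for t
  define dev where "dev t = count_deviation n (F t) t" for t
  have devm [measurable]: "dev t \<in> borel_measurable (lam n)" for t unfolding dev_def count_deviation_def by measurable
  define B where "B = {x \<in> space (lam n). x \<in> K n b \<and> dev t x > n * \<delta>}"
  define B1 where "B1 t = {y \<in> space (lam n). dev t y \<ge> n * (\<delta> / 2)}" for t
  have nn: "{y \<in> space (lam n). \<forall>i\<in>{..<n}. 0 \<le> y i} \<in> sets (lam n)"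
  proof -
    have "Measurable.pred (lam n) (\<lambda>x. \<forall>i\<in>{..<n}. 0 \<le> x i)" by (rule lam_all_coordinates) measurable
    then show ?thesis by (rule predE)
  qed
  define B' where "B' = shell n b \<eta> \<inter> {y \<in> space (lam n). \<forall>i\<in>{..<n}. 0 \<le> y i} \<inter> (B1 (t + \<rho>) \<union> B1 (t - \<rho>))"
  have Bm [measurable]: "B \<in> sets (lam n)" unfolding B_def by measurable
  have B1m [measurable]: "B1 t \<in> sets (lam n)" for t unfolding B1_def by measurable
  have B'm [measurable]: "B' \<in> sets (lam n)" unfolding B'_def using nn by measurable
  have step: "y \<in> B'" if x: "x \<in> B" and y: "y \<in> shell n b \<eta>" and d: "sqdist n x (proj n b y) < \<eta>\<^sup>2" for x y
  proof -
    have xK: "x \<in> K n b" and dx: "dev t x > n * \<delta>" using x by (auto simp: B_def)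
    have ysp: "y \<in> space (lam n)" using y by (simp add: shell_def)
    have y0: "0 \<le> y i" and yx: "\<bar>y i - x i\<bar> \<le> \<rho>" if "i < n" for i
      using K_lifts_to_shell[OF n b \<eta> y xK d that] by (auto simp: \<rho>_def)
    have dev': "dev t x = \<bar>(\<Sum>i<n. indicator {..t} (x i)) - n * F t\<bar>" for t x
      by (simp add: dev_def count_deviation_def sum_subtractf)
    have up: "(\<Sum>i<n. indicator {..t} (x i)) \<le> (\<Sum>i<n. indicator {..t + \<rho>} (y i) :: real)"
      by (intro sum_mono) (use yx in \<open>force simp: indicator_def abs_le_iff\<close>)
    have low: "(\<Sum>i<n. indicator {..t - \<rho>} (y i)) \<le> (\<Sum>i<n. indicator {..t} (x i) :: real)"
      by (intro sum_mono) (use yx in \<open>force simp: indicator_def abs_le_iff\<close>)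
    have F1: "F (t + \<rho>) \<le> F t + \<delta> / 2" "F t \<le> F (t - \<rho>) + \<delta> / 2"
      using cdf_Lipschitz[OF L, of t "t + \<rho>"] cdf_Lipschitz[OF L, of "t - \<rho>" t] \<rho> \<delta> by (auto simp: F_def \<rho>_def)
    have "n * F (t + \<rho>) \<le> n * F t + n * (\<delta> / 2)" "n * F t \<le> n * F (t - \<rho>) + n * (\<delta> / 2)"
      using F1[THEN mult_left_mono, of "real n"] by (auto simp: distrib_left)
    then have "n * (\<delta> / 2) \<le> dev (t + \<rho>) y \<or> n * (\<delta> / 2) \<le> dev (t - \<rho>) y"
      using dx up low unfolding dev' by (simp add: abs_if split: if_splits)
    then show ?thesis using y y0 ysp by (auto simp: B'_def B1_def)
  qed
  have B'P: "ennreal (exp (c0 - E) / Zc ^ n) * emeasure (lam n) B' \<le> emeasure (P n) B'"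
    unfolding c0_def E_def
  proof (rule P_lam_comparison(2)[OF B'm])
    fix y assume y: "y \<in> B'"
    then have "\<forall>i<n. 0 \<le> y i" "y \<in> shell n b \<eta>" by (auto simp: B'_def)
    then show "(\<forall>i<n. 0 \<le> y i) \<and> \<bar>(\<Sum>i<n. y i) - real n\<bar> \<le> 1 \<and> \<bar>(\<Sum>i<n. (y i)\<^sup>2) - real n * b\<bar> \<le> 1"
      using shell_sums[OF n b \<eta> _ small] by auto
  qed
  have B1P: "P.prob (B1 t) \<le> 2 * exp (- real n * \<delta>\<^sup>2 / 2)" for t
  proof -
    have "P.prob (B1 t) \<le> 2 * exp (- 2 * real n * (\<delta> / 2)\<^sup>2)"
      using empirical_cdf_Hoeffding[of "\<delta> / 2" n t] \<delta> n by (simp add: B1_def dev_def F_def space_P)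
    also have "- 2 * real n * (\<delta> / 2)\<^sup>2 = - real n * \<delta>\<^sup>2 / 2" by (simp add: power2_eq_square)
    finally show ?thesis .
  qed
  have B'le: "P.prob B' \<le> 4 * exp (- real n * \<delta>\<^sup>2 / 2)"
  proof -
    have "P.prob B' \<le> P.prob (B1 (t + \<rho>) \<union> B1 (t - \<rho>))"
      by (rule P.finite_measure_mono) (auto simp: B'_def)
    also have "\<dots> \<le> P.prob (B1 (t + \<rho>)) + P.prob (B1 (t - \<rho>))" by (rule measure_Un_le) auto
    finally show ?thesis using B1P[of "t + \<rho>"] B1P[of "t - \<rho>"] by linarith
  qed
  have "emeasure \<sigma> B * emeasure (P n) (core n b \<eta>) \<le> emeasure \<sigma> B * (ennreal (exp (c0 + E) / Zc ^ n) * emeasure (lam n) (core n b \<eta>))"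
    by (intro mult_left_mono coreP) simp
  also have "\<dots> = ennreal (exp (c0 + E) / Zc ^ n) * (emeasure \<sigma> B * emeasure (lam n) (core n b \<eta>))" by (simp only: mult_ac)
  also have "\<dots> \<le> ennreal (exp (c0 + E) / Zc ^ n) * (emeasure \<sigma> (K n b) * emeasure (lam n) B')"
    by (intro mult_left_mono cmp step) auto
  also have "exp (c0 + E) / Zc ^ n = exp (2 * E) * (exp (c0 - E) / Zc ^ n)" by (simp flip: exp_add)
  also have "ennreal (exp (2 * E) * (exp (c0 - E) / Zc ^ n)) = ennreal (exp (2 * E)) * ennreal (exp (c0 - E) / Zc ^ n)"
    using Zc_pos by (intro ennreal_mult) auto
  also have "\<dots> * (emeasure \<sigma> (K n b) * emeasure (lam n) B') = ennreal (exp (2 * E)) * (emeasure \<sigma> (K n b) * (ennreal (exp (c0 - E) / Zc ^ n) * emeasure (lam n) B'))"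
    by (simp only: mult_ac)
  also have "\<dots> \<le> ennreal (exp (2 * E)) * (emeasure \<sigma> (K n b) * emeasure (P n) B')"
    by (intro mult_left_mono B'P) auto
  finally have main: "S.prob B * P.prob (core n b \<eta>) \<le> exp (2 * E) * (S.prob (K n b) * P.prob B')"
    by (simp add: S.emeasure_eq_measure P.emeasure_eq_measure flip: ennreal_mult)
  have Kpos: "S.prob (K n b) > 0" using pos by (simp add: S.emeasure_eq_measure)
  have UB: "U.prob B \<le> 4 * exp (2 * E) * exp (- real n * \<delta>\<^sup>2 / 2) / p"
  proof -
    have "K n b \<inter> B = B" by (auto simp: B_def)
    then have "U.prob B = S.prob B / S.prob (K n b)"
      using KS Kpos sets Bm by (subst measure_uniform_measure) (auto simp: S.emeasure_eq_measure)
    moreover have "S.prob B * p \<le> exp (2 * E) * (S.prob (K n b) * (4 * exp (- real n * \<delta>\<^sup>2 / 2)))"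
    proof -
      have "S.prob B * p \<le> S.prob B * P.prob (core n b \<eta>)" using p by (intro mult_left_mono) auto
      also note main
      also have "exp (2 * E) * (S.prob (K n b) * P.prob B') \<le> exp (2 * E) * (S.prob (K n b) * (4 * exp (- real n * \<delta>\<^sup>2 / 2)))"
        by (intro mult_left_mono B'le) auto
      finally show ?thesis .
    qed
    ultimately have "S.prob (K n b) * (U.prob B * p) \<le> S.prob (K n b) * (4 * exp (2 * E) * exp (- real n * \<delta>\<^sup>2 / 2))"
      using Kpos by (simp add: mult_ac)
    then have "U.prob B * p \<le> 4 * exp (2 * E) * exp (- real n * \<delta>\<^sup>2 / 2)"
      using Kpos by (simp only: mult_le_cancel_left_pos)
    then show ?thesis using p by (simp add: pos_le_divide_eq)
  qed
  have "(\<integral>x. dev t x \<partial>?U) \<le> n * \<delta> + real n * U.prob B"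
  proof (rule integral_deviation_le[OF U.prob_space_axioms])
    show "B \<in> sets ?U" "dev t \<in> borel_measurable ?U" using Bm sets devm[of t] by (auto simp: measurable_cong_sets[OF sets refl])
    show "0 \<le> dev t x" for x by (simp add: dev_def count_deviation_def)
    show "dev t x \<le> real n" for x
    proof -
      have "\<bar>indicator {..t} a - F t\<bar> \<le> 1" for a using D.prob_le_1[of "{..t}"] measure_nonneg[of D "{..t}"]
        by (auto simp: indicator_def F_def)
      then show ?thesis using sum_norm_bound[of "{..<n}" "\<lambda>i. indicator {..t} (x i) - F t" 1] by (simp add: dev_def count_deviation_def)
    qed
    show "AE x in ?U. x \<notin> B \<longrightarrow> dev t x \<le> n * \<delta>"
      by (rule AE_uniform_measureI[OF KS]) (auto simp: B_def spS intro!: AE_I2)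
  qed (use \<delta> in auto)
  also have "\<dots> \<le> real n * \<delta> + real n * (4 * exp (2 * E) * exp (- real n * \<delta>\<^sup>2 / 2) / p)"
    by (intro add_left_mono mult_left_mono UB) auto
  finally show "(\<integral>x. count_deviation n (D.prob {..t}) t x \<partial>?U)
      \<le> real n * (\<delta> + 4 * exp (2 * (\<bar>r\<bar> + \<bar>s\<bar>)) * exp (- real n * \<delta>\<^sup>2 / 2) / p)"
    by (simp add: dev_def F_def E_def distrib_left)
qed

end

section \<open>Lower bounds for the probability of the core\<close>

definition block :: "nat \<Rightarrow> nat \<Rightarrow> (nat \<Rightarrow> real) set \<Rightarrow> real set \<Rightarrow> (nat \<Rightarrow> real) set" where
  "block N M A J = {y \<in> space (lam (N + M)). restrict y {..<N} \<in> A \<and> (\<forall>i\<in>{N..<N + M}. y i \<in> J)}"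

context gibbs begin

lemma nn_integral_P_Suc:
  assumes "f \<in> borel_measurable (P (Suc N))"
  shows "(\<integral>\<^sup>+y. f y \<partial>P (Suc N)) = (\<integral>\<^sup>+y. \<integral>\<^sup>+u. f (y(N := u)) \<partial>D \<partial>P N)"
proof -
  interpret PD: product_sigma_finite "\<lambda>_::nat. D" ..
  show ?thesis using PD.product_nn_integral_insert[of "{..<N}" N f] assms by (simp add: lessThan_Suc)
qed

lemma prob_interval_ge:
  assumes "0 \<le> a" "a + w \<le> B" "0 \<le> w"
  shows "D.prob {a..a + w} \<ge> w * exp (- \<bar>r\<bar> * B\<^sup>2 - \<bar>s\<bar> * B) / Zc"
proof -
  let ?c = "exp (- \<bar>r\<bar> * B\<^sup>2 - \<bar>s\<bar> * B) / Zc"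
  have c0: "?c \<ge> 0" using Zc_pos by simp
  have "ennreal (w * ?c) = ennreal ?c * ennreal w"
    using assms c0 by (subst ennreal_mult[symmetric]) (simp_all add: mult.commute)
  also have "\<dots> = (\<integral>\<^sup>+x. ennreal ?c * indicator {a..a + w} x \<partial>lborel)"
    using assms by (subst nn_integral_cmult_indicator) auto
  also have "\<dots> \<le> (\<integral>\<^sup>+x. ennreal (gibbs_weight r s x / Zc) * indicator {a..a + w} x \<partial>lborel)"
  proof (intro nn_integral_mono)
    fix x
    show "ennreal ?c * indicator {a..a + w} x \<le> ennreal (gibbs_weight r s x / Zc) * indicator {a..a + w} x"
    proof (cases "x \<in> {a..a + w}")
      case True
      then have x: "0 \<le> x" "x \<le> B" using assms by auto
      then have "x\<^sup>2 \<le> B\<^sup>2" by (intro power_mono) auto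
      then have "r * x\<^sup>2 \<le> \<bar>r\<bar> * B\<^sup>2" using mult_mono[of r "\<bar>r\<bar>" "x\<^sup>2" "B\<^sup>2"] by auto
      moreover have "s * x \<le> \<bar>s\<bar> * B" using mult_mono[of s "\<bar>s\<bar>" x B] x by auto
      ultimately have "exp (- \<bar>r\<bar> * B\<^sup>2 - \<bar>s\<bar> * B) \<le> gibbs_weight r s x" using x by (simp add: gibbs_weight_def)
      then show ?thesis using True Zc_pos by (auto intro!: ennreal_leI divide_right_mono)
    qed simp
  qed
  also have "\<dots> = emeasure D {a..a + w}" unfolding D_density by (simp add: emeasure_density)
  finally have "ennreal (w * ?c) \<le> ennreal (D.prob {a..a + w})" by (simp add: D.emeasure_eq_measure)
  then show ?thesis by (simp add: ennreal_le_iff)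
qed

text \<open>
  Let \<open>d\<close> and \<open>F\<close> be what is missing from the sum and from the sum of squares. The system \<open>u + v = d\<close>,
  \<open>u\<^sup>2 + v\<^sup>2 = F\<close> has a positive real solution if \<open>F < d\<^sup>2 \<le> 2 * F\<close>. The bounds of \<open>d\<close> by \<open>11/10\<close> and
  \<open>13/10\<close> times \<open>sqrt F\<close> keep both solutions above \<open>sqrt F / 10\<close>. In a box of side \<open>k\<close> next to the
  solution both sums change by at most the width of the core.
\<close>
lemma core_completion:
  assumes N: "n = Suc (Suc N)" and b: "b > 1" and \<eta>: "0 < \<eta>" "\<eta> \<le> 1/8" and G [measurable]: "G \<in> sets (lam N)"
    and Dm: "Dm \<ge> 0" and k: "k = core_width b \<eta> / (2 * (Dm + 1))"
    and GI: "\<And>y. y \<in> G \<Longrightarrow> (\<forall>i<N. 8 * \<eta> \<le> y i) \<and> 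
       11/10 * sqrt (core_sumsq n b \<eta> - (\<Sum>i<N. (y i)\<^sup>2)) \<le> core_sum n \<eta> - (\<Sum>i<N. y i) \<and>
       core_sum n \<eta> - (\<Sum>i<N. y i) \<le> 13/10 * sqrt (core_sumsq n b \<eta> - (\<Sum>i<N. (y i)\<^sup>2)) \<and>
       core_sum n \<eta> - (\<Sum>i<N. y i) \<le> Dm \<and> 80 * \<eta> \<le> sqrt (core_sumsq n b \<eta> - (\<Sum>i<N. (y i)\<^sup>2))"
  shows "measure (P N) G * (k * exp (- \<bar>r\<bar> * (Dm + 1)\<^sup>2 - \<bar>s\<bar> * (Dm + 1)) / Zc)\<^sup>2 \<le> measure (P n) (core n b \<eta>)"
proof -
  interpret PN: prob_space "P N" by (rule prob_space_P)
  interpret Pn: prob_space "P n" by (rule prob_space_P)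
  interpret PD: product_sigma_finite "\<lambda>_::nat. D" ..
  have GP: "G \<in> sets (P N)" using G sets_P by simp
  define \<theta> where "\<theta> = k * exp (- \<bar>r\<bar> * (Dm + 1)\<^sup>2 - \<bar>s\<bar> * (Dm + 1)) / Zc"
  have w: "0 < core_width b \<eta>" "core_width b \<eta> \<le> 1" 
    using \<eta> b mult_mono[of \<eta> 1 "min (1/2) ((b - 1) / 4)" 1] by (auto simp: core_width_def)
  have k0: "0 < k" "k \<le> 1" using w Dm by (auto simp: k field_simps)
  have kw: "k * (2 * (Dm + 1)) = core_width b \<eta>" using Dm by (simp add: k)
  have \<theta>0: "\<theta> \<ge> 0" using k0 Zc_pos by (simp add: \<theta>_def)
  have n0: "n > 0" using N by simp
  let ?C = "core n b \<eta>"
  have Cm: "?C \<in> sets (P n)" using core_measurable[OF n0 b \<eta>] sets_P by simp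
  then have Cm2: "(indicator ?C :: _ \<Rightarrow> ennreal) \<in> borel_measurable (P (Suc (Suc N)))" using N by simp
  have "ennreal (measure (P N) G * \<theta>\<^sup>2) = ennreal (\<theta>\<^sup>2) * emeasure (P N) G"
    by (simp add: PN.emeasure_eq_measure ennreal_mult mult.commute)
  also have "\<dots> = (\<integral>\<^sup>+y. ennreal (\<theta>\<^sup>2) * indicator G y \<partial>P N)"
    using GP by (subst nn_integral_cmult_indicator) auto
  also have "\<dots> \<le> (\<integral>\<^sup>+y. \<integral>\<^sup>+u. \<integral>\<^sup>+v. indicator ?C ((y(N := u))(Suc N := v)) \<partial>D \<partial>D \<partial>P N)"
  proof (rule nn_integral_mono)
    fix y assume ysp: "y \<in> space (P N)"
    show "ennreal (\<theta>\<^sup>2) * indicator G y \<le> (\<integral>\<^sup>+u. \<integral>\<^sup>+v. indicator ?C ((y(N := u))(Suc N := v)) \<partial>D \<partial>D)"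
    proof (cases "y \<in> G")
      case True
      define d where "d = core_sum n \<eta> - (\<Sum>i<N. y i)"
      define F where "F = core_sumsq n b \<eta> - (\<Sum>i<N. (y i)\<^sup>2)"
      have g: "\<forall>i<N. 8 * \<eta> \<le> y i" "11/10 * sqrt F \<le> d" "d \<le> 13/10 * sqrt F" "d \<le> Dm" "80 * \<eta> \<le> sqrt F"
        using GI[OF True] by (auto simp: d_def F_def)
      have sF: "sqrt F > 0" using g(5) \<eta> by linarith
      then have F0: "F > 0" by simp
      have d0: "d \<ge> 0" using g(2) sF by linarith
      have "(11/10 * sqrt F)\<^sup>2 \<le> d\<^sup>2" "d\<^sup>2 \<le> (13/10 * sqrt F)\<^sup>2" using g d0 sF by (auto intro!: power_mono)
      then have d2: "121/100 * F \<le> d\<^sup>2" "d\<^sup>2 \<le> 169/100 * F" using F0 by (auto simp: power_mult_distrib power2_eq_square)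
      define e where "e = sqrt (2 * F - d\<^sup>2)"
      have e: "0 \<le> e" "e\<^sup>2 = 2 * F - d\<^sup>2" using d2 F0 by (auto simp: e_def)
      have "e \<le> sqrt ((9/10)\<^sup>2 * F)" unfolding e_def using d2 F0 by (intro real_sqrt_le_mono) (simp add: power2_eq_square)
      then have e9: "e \<le> 9/10 * sqrt F" by (simp add: real_sqrt_mult)
      define u0 where "u0 = (d + e) / 2"
      define v0 where "v0 = (d - e) / 2"
      have uv: "u0 + v0 = d" "u0\<^sup>2 + v0\<^sup>2 = F"
      proof -
        show "u0 + v0 = d" by (simp add: u0_def v0_def field_simps)
        have "u0\<^sup>2 + v0\<^sup>2 = (d\<^sup>2 + e\<^sup>2) / 2" by (simp add: u0_def v0_def power2_eq_square field_simps)
        then show "u0\<^sup>2 + v0\<^sup>2 = F" by (simp add: e(2))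
      qed
      have v08: "8 * \<eta> \<le> v0" unfolding v0_def using e9 g(2,5) by (simp add: field_simps)
      moreover have "v0 \<le> u0" using e(1) by (simp add: u0_def v0_def)
      ultimately have bnd: "8 * \<eta> \<le> v0" "8 * \<eta> \<le> u0" "0 \<le> v0" "0 \<le> u0" "v0 \<le> Dm" "u0 \<le> Dm"
        using \<eta> uv(1) g(4) by linarith+
      have inC: "(y(N := u))(Suc N := v) \<in> ?C" if u: "u \<in> {u0..u0 + k}" and v: "v \<in> {v0..v0 + k}" for u v
      proof -
        define a where "a = u - u0"
        define c where "c = v - v0"
        have a: "u = u0 + a" "0 \<le> a" "a \<le> k" and c: "v = v0 + c" "0 \<le> c" "c \<le> k" using u v by (auto simp: a_def c_def)
        let ?y = "(y(N := u))(Suc N := v)"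
        have s1: "(\<Sum>i<n. ?y i) = (\<Sum>i<N. y i) + u + v" unfolding N by simp
        have s2: "(\<Sum>i<n. (?y i)\<^sup>2) = (\<Sum>i<N. (y i)\<^sup>2) + u\<^sup>2 + v\<^sup>2" unfolding N by simp
        have d1: "(\<Sum>i<n. ?y i) - core_sum n \<eta> = a + c" unfolding s1 using uv(1) by (simp add: d_def a(1) c(1))
        have d2: "(\<Sum>i<n. (?y i)\<^sup>2) - core_sumsq n b \<eta> = a * (2 * u0 + a) + c * (2 * v0 + c)"
          unfolding s2 using uv(2) by (simp add: F_def a(1) c(1) power2_eq_square algebra_simps)
        have "a + c \<le> k * 2" using a c by simp
        also have "\<dots> \<le> k * (2 * (Dm + 1))" using k0 Dm by (intro mult_left_mono) auto
        finally have w1: "a + c \<le> core_width b \<eta>" by (simp only: kw)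
        have "a * (2 * u0 + a) + c * (2 * v0 + c) \<le> k * (2 * u0 + 1) + k * (2 * v0 + 1)"
          using a c k0 bnd by (intro add_mono mult_mono) auto
        also have "\<dots> = k * (2 * (d + 1))" using uv(1) by (simp add: algebra_simps flip: uv(1))
        also have "\<dots> \<le> k * (2 * (Dm + 1))" using k0 g(4) by (intro mult_left_mono) auto
        finally have w2: "a * (2 * u0 + a) + c * (2 * v0 + c) \<le> core_width b \<eta>" by (simp only: kw)
        have nn: "0 \<le> a * (2 * u0 + a) + c * (2 * v0 + c)" using a c bnd by auto
        have "?y \<in> space (lam n)" using ysp unfolding N by (auto simp: space_PiM PiE_def extensional_def)
        moreover have "8 * \<eta> \<le> ?y i" if "i < n" for i
          using that g(1) a c bnd unfolding N by (auto simp: less_Suc_eq)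
        moreover have "\<bar>(\<Sum>i<n. ?y i) - core_sum n \<eta>\<bar> \<le> core_width b \<eta>" unfolding d1 using w1 a c by simp
        moreover have "\<bar>(\<Sum>i<n. (?y i)\<^sup>2) - core_sumsq n b \<eta>\<bar> \<le> core_width b \<eta>" unfolding d2 using w2 nn by simp
        ultimately show ?thesis unfolding core_def mem_Collect_eq lessThan_iff Ball_def by blast
      qed
      have Du: "D.prob {u0..u0 + k} \<ge> \<theta>" "D.prob {v0..v0 + k} \<ge> \<theta>" unfolding \<theta>_def
        by (rule prob_interval_ge; use bnd k0 in linarith)+
      have "ennreal (\<theta>\<^sup>2) * indicator G y = ennreal \<theta> * ennreal \<theta>" using True \<theta>0 by (simp add: power2_eq_square ennreal_mult)
      also have "\<dots> \<le> emeasure D {u0..u0 + k} * emeasure D {v0..v0 + k}"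
        using Du by (intro mult_mono) (auto simp: D.emeasure_eq_measure)
      also have "\<dots> = (\<integral>\<^sup>+u. \<integral>\<^sup>+v. indicator {u0..u0 + k} u * indicator {v0..v0 + k} v \<partial>D \<partial>D)"
        by (simp add: nn_integral_cmult nn_integral_multc)
      also have "\<dots> \<le> (\<integral>\<^sup>+u. \<integral>\<^sup>+v. indicator ?C ((y(N := u))(Suc N := v)) \<partial>D \<partial>D)"
        by (intro nn_integral_mono) (use inC in \<open>auto split: split_indicator\<close>)
      finally show ?thesis .
    qed simp
  qed
  also have "\<dots> = (\<integral>\<^sup>+y. \<integral>\<^sup>+v. indicator ?C (y(Suc N := v)) \<partial>D \<partial>P (Suc N))"
  proof (rule nn_integral_P_Suc[symmetric])
    have "(\<lambda>(y, v). y(Suc N := v)) \<in> P (Suc N) \<Otimes>\<^sub>M D \<rightarrow>\<^sub>M P (Suc (Suc N))"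
      using measurable_add_dim[of "Suc N" "{..<Suc N}" "\<lambda>_. D"] by (simp only: lessThan_Suc[of "Suc N"])
    from measurable_compose[OF this Cm2]
    have m: "(\<lambda>p. indicator ?C ((fst p)(Suc N := snd p)) :: ennreal) \<in> borel_measurable (P (Suc N) \<Otimes>\<^sub>M D)" by (simp add: split_def)
    have sf: "sigma_finite_measure D" ..
    from sigma_finite_measure.borel_measurable_nn_integral_fst[OF sf m]
    show "(\<lambda>y. \<integral>\<^sup>+v. indicator ?C (y(Suc N := v)) \<partial>D) \<in> borel_measurable (P (Suc N))" by simp
  qed
  also have "\<dots> = (\<integral>\<^sup>+y. indicator ?C y \<partial>P (Suc (Suc N)))"
    by (rule nn_integral_P_Suc[symmetric, OF Cm2])
  also have "\<dots> = (\<integral>\<^sup>+y. indicator ?C y \<partial>P n)" by (simp only: N)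
  also have "\<dots> = emeasure (P n) ?C" using Cm by simp
  also have "\<dots> = ennreal (measure (P n) ?C)" by (rule Pn.emeasure_eq_measure)
  finally show ?thesis unfolding \<theta>_def[symmetric] by (simp add: ennreal_le_iff)
qed

lemma block_measure:
  assumes A: "A \<in> sets (lam N)" and J: "J \<in> sets borel"
  shows "block N M A J \<in> sets (lam (N + M)) \<and> emeasure (P (N + M)) (block N M A J) = emeasure (P N) A * emeasure D J ^ M"
proof (induction M)
  case 0
  have "block N 0 A J = A"
  proof -
    have "restrict y {..<N} = y" if "y \<in> space (lam N)" for y using that by (auto simp: space_PiM PiE_def extensional_def restrict_def fun_eq_iff)
    then show ?thesis using sets.sets_into_space[OF A] by (auto simp: block_def)
  qed
  then show ?case using A by simp
next
  case (Suc M)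
  let ?B = "block N M A J" and ?B' = "block N (Suc M) A J" and ?n = "N + M"
  have B: "?B \<in> sets (lam ?n)" using Suc by simp
  have eq: "?B' = {y \<in> space (lam (Suc ?n)). restrict y {..<?n} \<in> ?B \<and> y ?n \<in> J}"
    by (auto simp: block_def space_PiM PiE_iff extensional_def less_Suc_eq Int_absorb2 restrict_restrict Int_commute)
  have r: "(\<lambda>y. restrict y {..<?n}) \<in> lam (Suc ?n) \<rightarrow>\<^sub>M lam ?n" by (intro measurable_restrict_subset) auto
  have c: "(\<lambda>y. y ?n) \<in> lam (Suc ?n) \<rightarrow>\<^sub>M borel" using measurable_component_singleton[of ?n "{..<Suc ?n}" "\<lambda>_. lborel"] by simp
  have B'm: "?B' \<in> sets (lam (Suc ?n))"
  proof -
    have "?B' = ((\<lambda>y. restrict y {..<?n}) -` ?B \<inter> space (lam (Suc ?n))) \<inter> ((\<lambda>y. y ?n) -` J \<inter> space (lam (Suc ?n)))"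
      unfolding eq by auto
    then show ?thesis using measurable_sets[OF r B] measurable_sets[OF c J] by simp
  qed
  have "emeasure (P (Suc ?n)) ?B' = (\<integral>\<^sup>+y. indicator ?B' y \<partial>P (Suc ?n))" using B'm sets_P by simp
  also have "\<dots> = (\<integral>\<^sup>+y. \<integral>\<^sup>+u. indicator ?B' (y(?n := u)) \<partial>D \<partial>P ?n)"
    using B'm sets_P by (intro nn_integral_P_Suc) auto
  also have "\<dots> = (\<integral>\<^sup>+y. \<integral>\<^sup>+u. indicator ?B y * indicator J u \<partial>D \<partial>P ?n)"
  proof (intro nn_integral_cong)
    fix y u assume y: "y \<in> space (P ?n)"
    have "restrict (y(?n := u)) {..<?n} = y" using y by (auto simp: space_PiM PiE_def extensional_def restrict_def fun_eq_iff)
    moreover have "y(?n := u) \<in> space (lam (Suc ?n))" using y by (auto simp: space_PiM PiE_def extensional_def)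
    ultimately show "indicator ?B' (y(?n := u)) = (indicator ?B y * indicator J u :: ennreal)"
      unfolding eq by (auto simp: indicator_def)
  qed
  also have "\<dots> = emeasure (P ?n) ?B * emeasure D J"
    using B J sets_P by (simp add: nn_integral_cmult nn_integral_multc)
  finally show ?case using B'm Suc by (simp add: mult_ac)
qed

text \<open>
  A union bound over the coordinates, using that the density is bounded.
\<close>
lemma measure_bounded_below:
  assumes L: "\<And>x. gibbs_weight r s x / Zc \<le> L" and A: "A \<in> sets (lam N)" and \<zeta>: "\<zeta> \<ge> 0"
  shows "{y \<in> A. \<forall>i\<in>{..<N}. \<zeta> \<le> y i} \<in> sets (lam N)"
    "measure (P N) A - real N * (L * \<zeta>) \<le> measure (P N) {y \<in> A. \<forall>i\<in>{..<N}. \<zeta> \<le> y i}"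
proof -
  interpret PN: prob_space "P N" by (rule prob_space_P)
  have AP: "A \<in> sets (P N)" using A sets_P by simp
  have [measurable]: "(\<lambda>y. y i) \<in> P N \<rightarrow>\<^sub>M D" if "i < N" for i
    using that by (intro measurable_component_singleton) simp
  define E where "E i = {y \<in> space (P N). y i < \<zeta>}" for i
  have Em: "E i \<in> sets (P N)" if "i < N" for i
  proof -
    have [measurable]: "(\<lambda>y. y i) \<in> P N \<rightarrow>\<^sub>M D" using that by (intro measurable_component_singleton) simp
    show ?thesis unfolding E_def by measurable
  qed
  have EP: "PN.prob (E i) \<le> L * \<zeta>" if i: "i < N" for i
  proof -
    have "PN.prob (E i) = measure (distr (P N) D (\<lambda>y. y i)) {..<\<zeta>}"
      using i by (subst measure_distr) (auto simp: E_def vimage_def Int_def conj_commute)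
    also have "\<dots> = D.prob {..<\<zeta>}" using i by (subst distr_PiM_component) (auto intro: prob_space_D)
    also have "\<dots> \<le> D.prob {0..\<zeta>}"
      by (rule D.finite_measure_mono_AE) (use AE_D_nonneg in \<open>auto elim: eventually_mono\<close>)
    also have "\<dots> \<le> L * \<zeta>" using prob_interval_le[OF L \<zeta>] by simp
    finally show ?thesis .
  qed
  have eq: "{y \<in> A. \<forall>i\<in>{..<N}. \<zeta> \<le> y i} = A - (\<Union>i\<in>{..<N}. E i)"
    using sets.sets_into_space[OF AP] by (force simp: E_def)
  have U: "(\<Union>i\<in>{..<N}. E i) \<in> sets (P N)" using Em by auto
  show "{y \<in> A. \<forall>i\<in>{..<N}. \<zeta> \<le> y i} \<in> sets (lam N)" unfolding eq using AP U sets_P by auto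
  have "PN.prob A \<le> PN.prob ((A - (\<Union>i\<in>{..<N}. E i)) \<union> (\<Union>i\<in>{..<N}. E i))"
    by (rule PN.finite_measure_mono) (use AP U in auto)
  also have "\<dots> \<le> PN.prob (A - (\<Union>i\<in>{..<N}. E i)) + PN.prob (\<Union>i\<in>{..<N}. E i)"
    by (rule measure_Un_le) (use AP U in auto)
  also have "PN.prob (\<Union>i\<in>{..<N}. E i) \<le> (\<Sum>i<N. PN.prob (E i))"
    by (rule measure_UNION_le) (use Em in auto)
  also have "\<dots> \<le> (\<Sum>i<N. L * \<zeta>)" by (intro sum_mono EP) auto
  finally show "measure (P N) A - real N * (L * \<zeta>) \<le> measure (P N) {y \<in> A. \<forall>i\<in>{..<N}. \<zeta> \<le> y i}"
    unfolding eq by simp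
qed

end

lemma core_sumsq_bounds:
  assumes b: "b > 1" and n: "n \<ge> 1" and \<eta>: "0 \<le> \<eta>" "\<eta> \<le> 1" "real n * \<eta> \<le> 1"
  shows "real n * b \<le> core_sumsq n b \<eta>" "core_sumsq n b \<eta> \<le> real n * b + b + 20"
    "real n \<le> core_sum n \<eta>" "core_sum n \<eta> \<le> real n + 4"
proof -
  define X where "X = (real n * \<eta>) * (b + 6 + 49/4 * \<eta>)"
  have e: "core_sumsq n b \<eta> = real n * b + X"
    by (simp add: core_sumsq_def X_def power2_eq_square algebra_simps)
  have X1: "X \<le> 1 * (b + 20)" unfolding X_def using b \<eta> by (intro mult_mono) auto
  have X0: "0 \<le> X" unfolding X_def using b \<eta> by auto
  show "real n * b \<le> core_sumsq n b \<eta>" unfolding e using X0 by simp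
  show "core_sumsq n b \<eta> \<le> real n * b + b + 20" unfolding e using X1 by simp
  have "core_sum n \<eta> = real n + 7/2 * (real n * \<eta>)" by (simp add: core_sum_def algebra_simps)
  moreover have "0 \<le> real n * \<eta>" using \<eta> by simp
  ultimately show "real n \<le> core_sum n \<eta>" "core_sum n \<eta> \<le> real n + 4" using \<eta> by linarith+
qed

lemma eta_bounds:
  assumes "n \<ge> 6" shows "0 < 1 / real n ^ 3" "1 / real n ^ 3 \<le> 1/216" "real n * (1 / real n ^ 3) \<le> 1 / 36" "real n * (1 / real n ^ 3) = 1 / real n ^ 2"
proof -
  have n: "real n \<ge> 6" using assms by simp
  then show "0 < 1 / real n ^ 3" by simp
  have "(6::real) ^ 3 \<le> real n ^ 3" "(6::real) ^ 2 \<le> real n ^ 2" using n by (intro power_mono; simp)+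
  then show "1 / real n ^ 3 \<le> 1/216" using n by (simp add: divide_simps)
  show e: "real n * (1 / real n ^ 3) = 1 / real n ^ 2" using n by (simp add: power2_eq_square power3_eq_cube)
  show "real n * (1 / real n ^ 3) \<le> 1 / 36" unfolding e using n \<open>(6::real) ^ 2 \<le> real n ^ 2\<close> by (simp add: divide_simps)
qed

context gibbs begin

lemma moment_window_measurable: "moment_window N b o1 o2 R \<in> sets (lam N)"
proof -
  have "moment_window N b o1 o2 R = {y \<in> space (lam N). \<bar>(\<Sum>i<N. y i) - real N - o1\<bar> \<le> R \<and> \<bar>(\<Sum>i<N. (y i)\<^sup>2) - real N * b - o2\<bar> \<le> R}"
    by (simp add: moment_window_def space_P)
  also have "\<dots> \<in> sets (lam N)" by measurable
  finally show ?thesis .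
qed

text \<open>
  The union bound costs a term of order \<open>n * (1 / n ^ 3)\<close>, which is small compared with \<open>c / n\<close>.
\<close>
lemma moment_window_positive_part:
  assumes L: "\<And>x. gibbs_weight r s x / Zc \<le> L" and L0: "L > 0" and c: "c > 0" and nN: "N \<le> n" "N > 0" "n \<ge> 6" "16 * L / c \<le> real n"
    and llt: "c / real N \<le> measure (P N) (moment_window N b o1 o2 R)"
  shows "c / (2 * real n) \<le> measure (P N) {y \<in> moment_window N b o1 o2 R. \<forall>i\<in>{..<N}. 8 * (1 / real n ^ 3) \<le> y i}"
proof -
  have n: "real n > 0" "real N > 0" "real N \<le> real n" using nN by auto
  have "c / (2 * real n) = c / n - c / (2 * n)" by (simp add: field_simps)
  also have "\<dots> \<le> c / N - 8 * L / n^2"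
  proof (rule diff_mono)
    show "c / n \<le> c / N" using n c by (intro divide_left_mono) auto
    show "8 * L / n^2 \<le> c / (2 * n)" using nN(4) n c by (simp add: field_simps power2_eq_square)
  qed
  also have "8 * L / n^2 \<ge> real N * (L * (8 * (1 / real n ^ 3)))"
  proof -
    have "real N * (L * (8 * (1 / real n ^ 3))) \<le> real n * (L * (8 * (1 / real n ^ 3)))"
      using n L0 by (intro mult_right_mono) auto
    also have "\<dots> = 8 * L / n^2" using n by (simp add: field_simps power2_eq_square power3_eq_cube)
    finally show ?thesis .
  qed
  then have "c / N - 8 * L / n^2 \<le> measure (P N) (moment_window N b o1 o2 R) - real N * (L * (8 * (1 / real n ^ 3)))"
    using llt by linarith
  also have "\<dots> \<le> measure (P N) {y \<in> moment_window N b o1 o2 R. \<forall>i\<in>{..<N}. 8 * (1 / real n ^ 3) \<le> y i}"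
    by (rule measure_bounded_below(2)[OF L moment_window_measurable]) simp
  finally show ?thesis .
qed

text \<open>
  All but two coordinates are placed by the local bound into a window whose offset leaves the sum
  \<open>6/5 * k\<close> and the sum of squares \<open>k\<^sup>2\<close> to the last two coordinates. As \<open>k\<close> is a constant, these cost only
  the two factors of order \<open>1 / n ^ 3\<close> for the size of the box.
\<close>
lemma core_prob_polynomial:
  assumes m: "(\<integral>z. z \<partial>D) = 1" "(\<integral>z. z\<^sup>2 \<partial>D) = b" and b: "b > 1"
  shows "\<exists>c>0. \<exists>n0. \<forall>n\<ge>n0. c / real n ^ 7 \<le> measure (P n) (core n b (1 / real n ^ 3))"
proof -
  obtain L where L: "L > 0" "\<And>x. gibbs_weight r s x / Zc \<le> L" using weight_bounded by auto
  obtain R c where R: "R > 0" "c > 0" and llt: "\<And>O1. \<exists>N0. \<forall>N\<ge>N0. \<forall>o1 o2. \<bar>o1\<bar> \<le> O1 \<longrightarrow> \<bar>o2\<bar> \<le> O1 \<longrightarrow>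
     c / real N \<le> measure (P N) (moment_window N b o1 o2 R)"
    using gibbs_local_lower_bound[OF m] by blast
  \<comment> \<open>So large that the radius \<open>R\<close> is at most one per cent of \<open>k\<close> and of \<open>k\<^sup>2\<close>.\<close>
  define k where "k = 100 * (R + 1)"
  have k: "k \<ge> 100" "R \<le> k / 100" using R by (auto simp: k_def)
  have "k * 1 \<le> k * k" using k by (intro mult_left_mono) auto
  then have Rk2: "R \<le> k\<^sup>2 / 100" using k unfolding power2_eq_square by linarith
  define O1 where "O1 = 3 * b + 30 + 2 * k + k\<^sup>2"
  obtain N0 where N0: "\<And>N o1 o2. N0 \<le> N \<Longrightarrow> \<bar>o1\<bar> \<le> O1 \<Longrightarrow> \<bar>o2\<bar> \<le> O1 \<Longrightarrow> c / real N \<le> measure (P N) (moment_window N b o1 o2 R)"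
    using llt[of O1] by blast
  define C where "C = min (1/2) ((b - 1) / 4) / (2 * (2 * k + 1)) * (exp (- \<bar>r\<bar> * (2 * k + 1)\<^sup>2 - \<bar>s\<bar> * (2 * k + 1)) / Zc)"
  have C0: "C > 0" using b k Zc_pos by (auto simp: C_def intro!: mult_pos_pos divide_pos_pos)
  define n0 where "n0 = N0 + 6 + nat \<lceil>16 * L / c\<rceil>"
  have "c * C\<^sup>2 / 2 / real n ^ 7 \<le> measure (P n) (core n b (1 / real n ^ 3))" if n: "n \<ge> n0" for n
  proof -
    define \<eta> where "\<eta> = 1 / real n ^ 3"
    have n6: "n \<ge> 6" "N0 \<le> n - 2" "16 * L / c \<le> real n" using n unfolding n0_def by linarith+
    have \<eta>: "0 < \<eta>" "\<eta> \<le> 1/216" "real n * \<eta> \<le> 1/36" unfolding \<eta>_def by (rule eta_bounds[OF n6(1)])+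
    define N where "N = n - 2"
    have N: "n = Suc (Suc N)" "N > 0" "N0 \<le> N" "real N = real n - 2" "N \<le> n" using n6 by (auto simp: N_def)
    have cs: "real n * b \<le> core_sumsq n b \<eta>" "core_sumsq n b \<eta> \<le> real n * b + b + 20"
       "real n \<le> core_sum n \<eta>" "core_sum n \<eta> \<le> real n + 4"
      using core_sumsq_bounds[OF b, of n \<eta>] \<eta> n6 by auto
    \<comment> \<open>With these offsets the last two coordinates get \<open>6/5 * k\<close> and \<open>k\<^sup>2\<close>, up to \<open>R\<close>.\<close>
    define o1 where "o1 = core_sum n \<eta> - real N - 6/5 * k"
    define o2 where "o2 = core_sumsq n b \<eta> - real N * b - k\<^sup>2"
    have "\<bar>o1\<bar> \<le> O1" using cs k N(4) b zero_le_power2[of k] unfolding o1_def O1_def by linarith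
    moreover have "real N * b = real n * b - 2 * b" unfolding N(4) by (simp add: left_diff_distrib)
    then have "\<bar>o2\<bar> \<le> O1" using cs k b zero_le_power2[of k] unfolding o2_def O1_def by linarith
    ultimately have "c / real N \<le> measure (P N) (moment_window N b o1 o2 R)" using N0 N(3) by simp
    define G where "G = {y \<in> moment_window N b o1 o2 R. \<forall>i\<in>{..<N}. 8 * \<eta> \<le> y i}"
    have PG: "c / (2 * real n) \<le> measure (P N) G"
      unfolding G_def \<eta>_def by (rule moment_window_positive_part[OF L(2,1) R(2) N(5,2) n6(1,3)]) fact
    have Gm: "G \<in> sets (lam N)" unfolding G_def
      by (rule measure_bounded_below(1)[OF L(2) moment_window_measurable]) (use \<eta> in simp)
    define \<kappa> where "\<kappa> = core_width b \<eta> / (2 * (2 * k + 1))"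
    have comp: "measure (P N) G * (\<kappa> * exp (- \<bar>r\<bar> * (2 * k + 1)\<^sup>2 - \<bar>s\<bar> * (2 * k + 1)) / Zc)\<^sup>2 \<le> measure (P n) (core n b \<eta>)"
    proof (rule core_completion[OF N(1) b \<eta>(1) _ Gm _ \<kappa>_def])
      show "\<eta> \<le> 1/8" "0 \<le> 2 * k" using \<eta> k by auto
      fix y assume y: "y \<in> G"
      define F where "F = core_sumsq n b \<eta> - (\<Sum>i<N. (y i)\<^sup>2)"
      define d where "d = core_sum n \<eta> - (\<Sum>i<N. y i)"
      have "\<bar>d - 6/5 * k\<bar> \<le> R" "\<bar>F - k\<^sup>2\<bar> \<le> R"
        using y by (auto simp: G_def moment_window_def o1_def o2_def d_def F_def)
      then have d: "119/100 * k \<le> d" "d \<le> 121/100 * k" and F: "99/100 * k\<^sup>2 \<le> F" "F \<le> 101/100 * k\<^sup>2"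
        using k Rk2 by (auto simp: abs_le_iff)
      have "sqrt ((99/100 * k)\<^sup>2) \<le> sqrt F"
      proof (rule real_sqrt_le_mono)
        have "(99/100 * k)\<^sup>2 \<le> 99/100 * k\<^sup>2" using zero_le_power2[of k] by (simp add: power_mult_distrib power2_eq_square)
        then show "(99/100 * k)\<^sup>2 \<le> F" using F by linarith
      qed
      then have sF1: "99/100 * k \<le> sqrt F" using k by simp
      have "sqrt F \<le> sqrt ((101/100 * k)\<^sup>2)"
      proof (rule real_sqrt_le_mono)
        have "101/100 * k\<^sup>2 \<le> (101/100 * k)\<^sup>2" using zero_le_power2[of k] by (simp add: power_mult_distrib power2_eq_square)
        then show "F \<le> (101/100 * k)\<^sup>2" using F by linarith
      qed
      then have sF2: "sqrt F \<le> 101/100 * k" using k by simp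
      have "\<forall>i<N. 8 * \<eta> \<le> y i" using y by (auto simp: G_def)
      moreover have "11/10 * sqrt F \<le> d" "d \<le> 13/10 * sqrt F" "d \<le> 2 * k" "80 * \<eta> \<le> sqrt F"
        using d sF1 sF2 k \<eta> by linarith+
      ultimately show "(\<forall>i<N. 8 * \<eta> \<le> y i) \<and> 
       11/10 * sqrt (core_sumsq n b \<eta> - (\<Sum>i<N. (y i)\<^sup>2)) \<le> core_sum n \<eta> - (\<Sum>i<N. y i) \<and>
       core_sum n \<eta> - (\<Sum>i<N. y i) \<le> 13/10 * sqrt (core_sumsq n b \<eta> - (\<Sum>i<N. (y i)\<^sup>2)) \<and>
       core_sum n \<eta> - (\<Sum>i<N. y i) \<le> 2 * k \<and> 80 * \<eta> \<le> sqrt (core_sumsq n b \<eta> - (\<Sum>i<N. (y i)\<^sup>2))"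
        unfolding F_def d_def by blast
    qed
    have "\<kappa> * exp (- \<bar>r\<bar> * (2 * k + 1)\<^sup>2 - \<bar>s\<bar> * (2 * k + 1)) / Zc = C * \<eta>"
      by (simp add: \<kappa>_def C_def core_width_def)
    then have "c / (2 * real n) * (C * \<eta>)\<^sup>2 \<le> measure (P n) (core n b \<eta>)"
      using comp mult_right_mono[OF PG, of "(C * \<eta>)\<^sup>2"] by simp
    moreover have "c / (2 * real n) * (C * \<eta>)\<^sup>2 = c * C\<^sup>2 / 2 / real n ^ 7"
      by (simp add: \<eta>_def power_mult_distrib power_divide power_mult[symmetric] eval_nat_numeral)
    ultimately show ?thesis by (simp add: \<eta>_def)
  qed
  then show ?thesis using C0 R by (intro exI[of _ "c * C\<^sup>2 / 2"] conjI exI[of _ n0]) auto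
qed

end

section \<open>Exponential variables with an excessive sum of squares\<close>

lemma gibbs_weight_0_1: "gibbs_weight 0 1 = erlang_density 0 1"
  by (auto simp: gibbs_weight_def erlang_density_def fun_eq_iff)

lemma erlang_moment: "has_bochner_integral lborel (\<lambda>x. erlang_density 0 1 x * x ^ i) (fact i)"
proof (rule has_bochner_integral_nn_integral)
  show "(\<integral>\<^sup>+ x. ennreal (erlang_density 0 1 x * x ^ i) \<partial>lborel) = ennreal (fact i)"
    using nn_integral_erlang_ith_moment[of 1 0 i] by simp
qed (auto simp: erlang_density_def)

interpretation exp1: gibbs 0 1
proof
  show "integrable lborel (gibbs_weight 0 1)"
    using erlang_moment[of 0] by (simp add: gibbs_weight_0_1 has_bochner_integral_iff)
qed

lemma exp1_Zc: "exp1.Zc = 1"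
  using erlang_moment[of 0] by (simp add: exp1.Zc_def gibbs_weight_0_1 has_bochner_integral_iff)

lemma exp1_measure_gibbs: "exp1_measure = gibbs_measure 0 1"
  unfolding exp1.D_density exp1_Zc exp1_measure_def gibbs_weight_0_1 by simp

lemma exp1_moments: "(\<integral>z. z \<partial>gibbs_measure 0 1) = 1" "(\<integral>z. z\<^sup>2 \<partial>gibbs_measure 0 1) = 2"
proof -
  have "(\<integral>z. z ^ i \<partial>gibbs_measure 0 1) = fact i" for i
  proof -
    have "(\<integral>z. z ^ i \<partial>gibbs_measure 0 1) = (\<integral>x. erlang_density 0 1 x * x ^ i \<partial>lborel)"
      unfolding exp1.D_density exp1_Zc gibbs_weight_0_1 by (subst integral_density) auto
    then show ?thesis using erlang_moment[of i] by (simp add: has_bochner_integral_iff)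
  qed
  from this[of 1] this[of 2] show "(\<integral>z. z \<partial>gibbs_measure 0 1) = 1" "(\<integral>z. z\<^sup>2 \<partial>gibbs_measure 0 1) = 2"
    by (simp_all add: fact_numeral)
qed

lemma sqrt_between:
  assumes X: "X \<ge> 0" and F: "98/100 * X\<^sup>2 \<le> F" "F \<le> 102/100 * X\<^sup>2"
  shows "98/100 * X \<le> sqrt F" "sqrt F \<le> 101/100 * X"
proof -
  have "sqrt ((98/100 * X)\<^sup>2) \<le> sqrt F"
  proof (rule real_sqrt_le_mono)
    have "(98/100 * X)\<^sup>2 \<le> 98/100 * X\<^sup>2" using zero_le_power2[of X] by (simp add: power_mult_distrib power2_eq_square)
    then show "(98/100 * X)\<^sup>2 \<le> F" using F by linarith
  qed
  then show "98/100 * X \<le> sqrt F" using X by simp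
  have "sqrt F \<le> sqrt ((101/100 * X)\<^sup>2)"
  proof (rule real_sqrt_le_mono)
    have "102/100 * X\<^sup>2 \<le> (101/100 * X)\<^sup>2" using zero_le_power2[of X] by (simp add: power_mult_distrib power2_eq_square)
    then show "F \<le> (101/100 * X)\<^sup>2" using F by linarith
  qed
  then show "sqrt F \<le> 101/100 * X" using X by simp
qed

text \<open>
  Write \<open>X = sqrt ((b - 2) * n)\<close>. The last two coordinates have to supply an extra sum of squares of
  about \<open>X\<^sup>2\<close>, so their sum has to lie between \<open>11/10 * X\<close> and \<open>13/10 * X\<close>. To make room for it, about
  \<open>5/4 * X\<close> coordinates are confined to values below \<open>1/10\<close>, which lowers the total by an amount between
  \<open>9/8 * X\<close> and \<open>5/4 * X\<close>. The remaining coordinates are typical exponential variables, to which the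
  local bound applies with second moment 2. Confining the coordinates and enlarging two of them each
  have a probability of the form \<open>exp (- C * sqrt n)\<close>.
\<close>
lemma exp1_core_prob:
  assumes b: "b > 2"
  shows "\<exists>C>0. \<exists>n0. \<forall>n\<ge>n0. exp (- C * sqrt (real n)) \<le> measure (exp1.P n) (core n b (1 / real n ^ 3))"
proof -
  have b1: "b > 1" using b by simp
  obtain L where L: "L > 0" "\<And>x. gibbs_weight 0 1 x / exp1.Zc \<le> L" using exp1.weight_bounded by auto
  obtain R c where R: "R > 0" "c > 0" and llt: "\<And>O1. \<exists>N0. \<forall>N\<ge>N0. \<forall>o1 o2. \<bar>o1\<bar> \<le> O1 \<longrightarrow> \<bar>o2\<bar> \<le> O1 \<longrightarrow>
     c / real N \<le> measure (exp1.P N) (exp1.moment_window N 2 o1 o2 R)"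
    using exp1.gibbs_local_lower_bound[OF exp1_moments] by blast
  obtain N0 where N0: "\<And>N. N0 \<le> N \<Longrightarrow> c / real N \<le> measure (exp1.P N) (exp1.moment_window N 2 0 0 R)"
    using llt[of 0] by auto
  define q where "q = sqrt (b - 2)"
  have q: "q > 0" "q\<^sup>2 = b - 2" using b by (auto simp: q_def)
  define w where "w = min (1/2) ((b - 1) / 4)"
  have w: "w > 0" using b by (simp add: w_def)
  define p1 where "p1 = (1/20) * exp (-1 :: real)"
  have "exp (-1 :: real) \<le> 1" by simp
  then have p1: "0 < p1" "p1 \<le> 1" unfolding p1_def by (simp, linarith)
  define a where "a = - ln p1"
  have a: "a \<ge> 0" "exp (- a) = p1" using p1 by (auto simp: a_def)
  \<comment> \<open>The term with \<open>a\<close> pays for the confined coordinates, \<open>4 * q\<close> for the two large ones, and 1 for the powers of \<open>n\<close>.\<close>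
  define C where "C = 5/4 * q * a + 4 * q + 1"
  have C: "C > 0" using q a by (simp add: C_def add_nonneg_pos)
  let ?X = "\<lambda>n. q * sqrt (real n)"
  have e1: "eventually (\<lambda>n. real N0 + 10 \<le> real n - 5/4 * ?X n) at_top"
    using q(1) by real_asymp
  have e2: "eventually (\<lambda>n. 100 * (R + 7) \<le> ?X n) at_top" using q(1) by real_asymp
  have e3: "eventually (\<lambda>n. R + b + 300 \<le> ?X n) at_top" using q(1) by real_asymp
  have e4: "eventually (\<lambda>n. 16 * L / c \<le> real n) at_top" by real_asymp
  have e5: "eventually (\<lambda>n. 1 \<le> (c / 2 * exp (- a) * (w / 2 * exp (-1))\<^sup>2) * (exp (sqrt (real n)) / (real n ^ 7 * (2 * ?X n + 1)\<^sup>2))) at_top"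
  proof -
    have "c / 2 * exp (- a) * (w / 2 * exp (-1))\<^sup>2 > 0" using R w by simp
    moreover have "filterlim (\<lambda>n. exp (sqrt (real n)) / (real n ^ 7 * (2 * ?X n + 1)\<^sup>2)) at_top at_top" using q(1) by real_asymp
    ultimately have "filterlim (\<lambda>n. (c / 2 * exp (- a) * (w / 2 * exp (-1))\<^sup>2) * (exp (sqrt (real n)) / (real n ^ 7 * (2 * ?X n + 1)\<^sup>2))) at_top at_top"
      by (intro filterlim_tendsto_pos_mult_at_top[OF tendsto_const])
    then show ?thesis by (simp only: filterlim_at_top)
  qed
  have "eventually (\<lambda>n. exp (- C * sqrt (real n)) \<le> measure (exp1.P n) (core n b (1 / real n ^ 3))) at_top"
    using e1 e2 e3 e4 e5 eventually_ge_at_top[of 6]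
  proof eventually_elim
    case (elim n)
    define X where "X = ?X n"
    have X: "100 * (R + 7) \<le> X" "5/2 * X + R + b + 26 \<le> 2/100 * X\<^sup>2" "real N0 + 10 \<le> real n - 5/4 * X"
    proof -
      show "100 * (R + 7) \<le> X" "real N0 + 10 \<le> real n - 5/4 * X" using elim by (simp_all add: X_def)
      have x: "R + b + 300 \<le> X" using elim by (simp add: X_def)
      then have "300 * X \<le> X * X" using R b by (intro mult_right_mono) auto
      then show "5/2 * X + R + b + 26 \<le> 2/100 * X\<^sup>2" using x R b unfolding power2_eq_square by linarith
    qed
    have X0: "X \<ge> 700" using X R by simp
    have X2: "X\<^sup>2 = (b - 2) * n" by (simp add: X_def power_mult_distrib q)
    define \<eta> where "\<eta> = 1 / real n ^ 3"
    have \<eta>: "0 < \<eta>" "\<eta> \<le> 1/216" "real n * \<eta> \<le> 1/36" unfolding \<eta>_def by (rule eta_bounds[OF elim(6)])+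
    define M where "M = nat \<lceil>5/4 * X\<rceil>"
    have M: "5/4 * X \<le> real M" "real M \<le> 5/4 * X + 1" using X0 unfolding M_def by linarith+
    define N' where "N' = n - 2 - M"
    have N'r: "real N' = real n - 2 - real M" "N0 \<le> N'" "0 < N'" "N' \<le> n" "n = Suc (Suc (N' + M))"
    proof -
      have "real M + 2 + real N0 + 1 \<le> real n" using X M by linarith
      then have "M + 2 + N0 + 1 \<le> n" by linarith
      then show "real N' = real n - 2 - real M" "N0 \<le> N'" "0 < N'" "N' \<le> n" "n = Suc (Suc (N' + M))"
        unfolding N'_def by auto
    qed
    have cs: "real n * b \<le> core_sumsq n b \<eta>" "core_sumsq n b \<eta> \<le> real n * b + b + 20"
       "real n \<le> core_sum n \<eta>" "core_sum n \<eta> \<le> real n + 4"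
      using core_sumsq_bounds[OF b1, of n \<eta>] \<eta> elim(6) by auto
    define A where "A = {y \<in> exp1.moment_window N' 2 0 0 R. \<forall>i\<in>{..<N'}. 8 * \<eta> \<le> y i}"
    have PA: "c / (2 * real n) \<le> measure (exp1.P N') A"
      unfolding A_def \<eta>_def by (rule exp1.moment_window_positive_part[OF L(2,1) R(2) N'r(4,3) elim(6,4) N0[OF N'r(2)]])
    have Am: "A \<in> sets (lam N')" unfolding A_def
      by (rule exp1.measure_bounded_below(1)[OF L(2) exp1.moment_window_measurable]) (use \<eta> in simp)
    define J where "J = {8 * \<eta>..1/10}"
    have PJ: "p1 \<le> exp1.D.prob J"
    proof -
      have "p1 \<le> (1/10 - 8 * \<eta>) * exp (- \<bar>0\<bar> * 1\<^sup>2 - \<bar>1\<bar> * 1) / exp1.Zc"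
        unfolding p1_def exp1_Zc using \<eta> by (simp add: mult_right_mono)
      also have "\<dots> \<le> exp1.D.prob {8 * \<eta>..8 * \<eta> + (1/10 - 8 * \<eta>)}"
        using \<eta> by (intro exp1.prob_interval_ge) auto
      finally show ?thesis by (simp add: J_def)
    qed
    define G where "G = block N' M A J"
    have blk: "G \<in> sets (lam (N' + M))" "emeasure (exp1.P (N' + M)) G = emeasure (exp1.P N') A * emeasure (gibbs_measure 0 1) J ^ M"
      unfolding G_def using exp1.block_measure[OF Am, of J M] by (auto simp: J_def)
    have PG: "c / (2 * real n) * p1 ^ M \<le> measure (exp1.P (N' + M)) G"
    proof -
      interpret PN: prob_space "exp1.P N'" by (rule exp1.prob_space_P)
      interpret PNM: prob_space "exp1.P (N' + M)" by (rule exp1.prob_space_P)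
      have "measure (exp1.P (N' + M)) G = PN.prob A * exp1.D.prob J ^ M"
        using blk(2) by (simp add: PN.emeasure_eq_measure PNM.emeasure_eq_measure exp1.D.emeasure_eq_measure ennreal_power flip: ennreal_mult)
      moreover have "c / (2 * real n) * p1 ^ M \<le> PN.prob A * exp1.D.prob J ^ M"
        by (rule mult_mono) (use PA PJ p1 R in \<open>auto intro: power_mono\<close>)
      ultimately show ?thesis by simp
    qed
    define \<kappa> where "\<kappa> = core_width b \<eta> / (2 * (2 * X + 1))"
    have comp: "measure (exp1.P (N' + M)) G * (\<kappa> * exp (- \<bar>0\<bar> * (2 * X + 1)\<^sup>2 - \<bar>1\<bar> * (2 * X + 1)) / exp1.Zc)\<^sup>2 \<le> measure (exp1.P n) (core n b \<eta>)"
    proof (rule exp1.core_completion[OF N'r(5) b1 \<eta>(1) _ blk(1) _ \<kappa>_def])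
      show "\<eta> \<le> 1/8" "0 \<le> 2 * X" using \<eta> X0 by auto
      fix y assume y: "y \<in> G"
      have yA: "restrict y {..<N'} \<in> A" and yJ: "\<And>i. i \<in> {N'..<N' + M} \<Longrightarrow> 8 * \<eta> \<le> y i \<and> y i \<le> 1/10"
        using y by (auto simp: G_def block_def J_def)
      define S1 where "S1 = (\<Sum>i<N'. y i)"
      define S2 where "S2 = (\<Sum>i<N'. (y i)\<^sup>2)"
      define T1 where "T1 = (\<Sum>i\<in>{N'..<N' + M}. y i)"
      define T2 where "T2 = (\<Sum>i\<in>{N'..<N' + M}. (y i)\<^sup>2)"
      have split: "(\<Sum>i<N' + M. f i) = (\<Sum>i<N'. f i) + (\<Sum>i\<in>{N'..<N' + M}. f i)" for f :: "nat \<Rightarrow> real"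
        by (subst sum.union_disjoint[symmetric]) (auto intro!: sum.cong)
      have S: "\<bar>S1 - real N'\<bar> \<le> R" "\<bar>S2 - real N' * 2\<bar> \<le> R"
        using yA by (auto simp: A_def exp1.moment_window_def S1_def S2_def)
      have T1: "0 \<le> T1" "T1 \<le> real M * (1/10)"
      proof -
        show "0 \<le> T1" unfolding T1_def using yJ \<eta> by (intro sum_nonneg) (force intro: order_trans[of 0 "8 * \<eta>"])
        have "T1 \<le> (\<Sum>i\<in>{N'..<N' + M}. 1/10)" unfolding T1_def using yJ by (intro sum_mono) auto
        then show "T1 \<le> real M * (1/10)" by simp
      qed
      have T2: "0 \<le> T2" "T2 \<le> real M * (1/100)"
      proof -
        show "0 \<le> T2" unfolding T2_def by (intro sum_nonneg) auto
        have "T2 \<le> (\<Sum>i\<in>{N'..<N' + M}. (1/10)\<^sup>2)" unfolding T2_def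
        proof (rule sum_mono)
          fix i assume "i \<in> {N'..<N' + M}"
          from yJ[OF this] \<eta> show "(y i)\<^sup>2 \<le> (1/10)\<^sup>2" by (intro power_mono) auto
        qed
        then show "T2 \<le> real M * (1/100)" by (simp add: power2_eq_square)
      qed
      define F where "F = core_sumsq n b \<eta> - (\<Sum>i<N' + M. (y i)\<^sup>2)"
      define d where "d = core_sum n \<eta> - (\<Sum>i<N' + M. y i)"
      have dS: "d = core_sum n \<eta> - S1 - T1" and FS: "F = core_sumsq n b \<eta> - S2 - T2"
        unfolding d_def F_def split S1_def S2_def T1_def T2_def by simp_all
      have d: "9/10 * real M - R \<le> d" "d \<le> real M + 6 + R"
        unfolding dS using S T1 cs N'r(1) by linarith+
      have nb: "real n * b = X\<^sup>2 + 2 * real n" by (simp add: X2 algebra_simps)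
      have "F \<le> X\<^sup>2 + 2 * real M + R + b + 24" "X\<^sup>2 - R \<le> F"
        unfolding FS using S T2 cs nb N'r(1) by linarith+
      then have F: "98/100 * X\<^sup>2 \<le> F" "F \<le> 102/100 * X\<^sup>2" using X(2) M X0 R b by linarith+
      have sF: "98/100 * X \<le> sqrt F" "sqrt F \<le> 101/100 * X" using sqrt_between[OF _ F] X0 by simp_all
      have "8 * \<eta> \<le> y i" if "i < N' + M" for i
      proof (cases "i < N'")
        case True
        then show ?thesis using yA by (auto simp: A_def)
      next
        case False
        then show ?thesis using that yJ[of i] by auto
      qed
      moreover have "11/10 * sqrt F \<le> d" using d(1) sF(2) X(1) M(1) X0 by simp
      moreover have "d \<le> 13/10 * sqrt F" using d(2) sF(1) X(1) M(2) X0 by simp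
      moreover have "d \<le> 2 * X" using d(2) X(1) M(2) X0 by simp
      moreover have "80 * \<eta> \<le> sqrt F" using sF(1) X0 \<eta> by simp
      ultimately show "(\<forall>i<N' + M. 8 * \<eta> \<le> y i) \<and> 
       11/10 * sqrt (core_sumsq n b \<eta> - (\<Sum>i<N' + M. (y i)\<^sup>2)) \<le> core_sum n \<eta> - (\<Sum>i<N' + M. y i) \<and>
       core_sum n \<eta> - (\<Sum>i<N' + M. y i) \<le> 13/10 * sqrt (core_sumsq n b \<eta> - (\<Sum>i<N' + M. (y i)\<^sup>2)) \<and>
       core_sum n \<eta> - (\<Sum>i<N' + M. y i) \<le> 2 * X \<and> 80 * \<eta> \<le> sqrt (core_sumsq n b \<eta> - (\<Sum>i<N' + M. (y i)\<^sup>2))"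
        unfolding F_def d_def by blast
    qed
    have "exp (- C * sqrt (real n)) \<le> c / (2 * real n) * p1 ^ M * (\<kappa> * exp (- \<bar>0\<bar> * (2 * X + 1)\<^sup>2 - \<bar>1\<bar> * (2 * X + 1)) / exp1.Zc)\<^sup>2"
    proof -
      have "exp (- a * (5/4 * X + 1)) \<le> exp (- a * real M)" using a M by (simp add: mult_left_mono)
      also have "exp (- a * real M) = p1 ^ M" by (simp add: a(2)[symmetric] exp_of_nat_mult[symmetric] mult.commute)
      finally have pM: "exp (- a * (5/4 * X + 1)) \<le> p1 ^ M" .
      define Y where "Y = 2 * X + 1"
      have Y: "Y > 0" using X0 by (simp add: Y_def)
      have "exp (- C * sqrt (real n)) * 1 \<le> exp (- C * sqrt (real n)) * ((c / 2 * exp (- a) * (w / 2 * exp (-1))\<^sup>2) * (exp (sqrt (real n)) / (real n ^ 7 * Y\<^sup>2)))"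
        using elim(5) unfolding Y_def X_def by (intro mult_left_mono) auto
      also have "\<dots> = (exp (- C * sqrt (real n)) * exp (- a) * (exp (-1))\<^sup>2 * exp (sqrt (real n))) * (c / 2 * (w / 2)\<^sup>2 / (real n ^ 7 * Y\<^sup>2))"
        by (simp add: power_mult_distrib power_divide)
      also have "exp (- C * sqrt (real n)) * exp (- a) * (exp (-1))\<^sup>2 * exp (sqrt (real n)) = exp (- a * (5/4 * X + 1)) * (exp (- Y))\<^sup>2"
        by (simp add: power2_eq_square exp_add[symmetric] Y_def C_def X_def algebra_simps)
      also have "exp (- a * (5/4 * X + 1)) * (exp (- Y))\<^sup>2 * (c / 2 * (w / 2)\<^sup>2 / (real n ^ 7 * Y\<^sup>2)) \<le> p1 ^ M * (exp (- Y))\<^sup>2 * (c / 2 * (w / 2)\<^sup>2 / (real n ^ 7 * Y\<^sup>2))"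
        using R by (intro mult_right_mono pM) auto
      also have "\<dots> = c / (2 * real n) * p1 ^ M * (\<eta> * w / (2 * Y) * exp (- Y))\<^sup>2"
        using elim(6) Y by (simp add: \<eta>_def power_mult_distrib power_divide power_mult[symmetric] eval_nat_numeral mult_ac)
      also have "\<eta> * w / (2 * Y) * exp (- Y) = \<kappa> * exp (- \<bar>0\<bar> * (2 * X + 1)\<^sup>2 - \<bar>1\<bar> * (2 * X + 1)) / exp1.Zc"
        by (simp add: \<kappa>_def core_width_def w_def Y_def exp1_Zc)
      finally show ?thesis by simp
    qed
    also have "\<dots> \<le> measure (exp1.P (N' + M)) G * (\<kappa> * exp (- \<bar>0\<bar> * (2 * X + 1)\<^sup>2 - \<bar>1\<bar> * (2 * X + 1)) / exp1.Zc)\<^sup>2"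
      by (intro mult_right_mono PG) auto
    also note comp
    finally show ?case by (simp only: \<eta>_def)
  qed
  then show ?thesis using C by (auto simp: eventually_at_top_linorder)
qed

section \<open>Rates of convergence\<close>

lemma joint_cdf_iid_law:
  assumes "real_distribution D"
  shows "joint_cdf k (iid_law D) t = (\<Prod>i<k. measure D {..t i})"
proof -
  interpret D: real_distribution D by fact
  interpret PD: product_prob_space "\<lambda>_::nat. D" UNIV ..
  interpret I: prob_space "iid_law D" unfolding iid_law_def by (intro prob_space_PiM D.prob_space_axioms)
  have "emeasure (iid_law D) {x \<in> space (iid_law D). \<forall>i\<in>{..<k}. x i \<in> {..t i}} = (\<Prod>i<k. emeasure D {..t i})"
    unfolding iid_law_def by (rule PD.emeasure_PiM_Collect) auto
  also have "\<dots> = ennreal (\<Prod>i<k. measure D {..t i})"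
    by (simp add: D.emeasure_eq_measure prod_ennreal)
  finally have "measure (iid_law D) {x \<in> space (iid_law D). \<forall>i\<in>{..<k}. x i \<in> {..t i}} = (\<Prod>i<k. measure D {..t i})"
    by (simp add: I.emeasure_eq_measure prod_nonneg)
  then show ?thesis by (simp add: joint_cdf_def Ball_def)
qed

lemma joint_cdf_uniform_measure_bounds:
  assumes "prob_space \<sigma>" and A: "A \<in> sets \<sigma>"
  shows "0 \<le> joint_cdf k (uniform_measure \<sigma> A) t" "joint_cdf k (uniform_measure \<sigma> A) t \<le> 1"
proof -
  interpret prob_space \<sigma> by fact
  have "emeasure (uniform_measure \<sigma> A) B \<le> 1" for B
  proof (cases "B \<in> sets \<sigma>")
    case True
    with A have "emeasure (uniform_measure \<sigma> A) B = emeasure \<sigma> (A \<inter> B) / emeasure \<sigma> A" by simp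
    also have "\<dots> \<le> emeasure \<sigma> A / emeasure \<sigma> A" using A by (intro divide_right_mono_ennreal emeasure_mono) auto
    also have "\<dots> \<le> 1" by (cases "emeasure \<sigma> A = 0") (auto simp: emeasure_eq_measure)
    finally show ?thesis .
  next
    case False
    then show ?thesis by (simp add: emeasure_notin_sets)
  qed
  then show "joint_cdf k (uniform_measure \<sigma> A) t \<le> 1"
    unfolding joint_cdf_def measure_def by (intro enn2real_leI) auto
qed (simp add: joint_cdf_def)

text \<open>
  If \<open>k * \<epsilon> \<ge> 1\<close> there is nothing to prove. Otherwise \<open>k \<le> sqrt n\<close>, so at least half of the coordinates
  remain at every step of the replacement, and the error \<open>j / n\<close> caused by the coordinates already
  used is at most \<open>\<epsilon>\<close>.
\<close>
lemma (in gibbs) joint_cdf_close: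
  assumes ex: "exchangeable n M" and n: "n \<ge> 4" and k: "k \<le> n" and e: "\<epsilon> > 0" "1 \<le> real n * \<epsilon>\<^sup>2"
    and dev: "\<And>t. (\<integral>x. count_deviation n (D.prob {..t}) t x \<partial>M) \<le> real n * \<epsilon>"
  shows "\<bar>joint_cdf k M t - joint_cdf k (iid_law D) t\<bar> \<le> 4 * real k * \<epsilon>"
proof -
  interpret M: prob_space M using ex by (simp add: exchangeable_def)
  have J: "joint_cdf k (iid_law D) t = (\<Prod>i<k. D.prob {..t i})" by (rule joint_cdf_iid_law) unfold_locales
  show ?thesis
  proof (cases "real k * \<epsilon> \<ge> 1")
    case True
    have "0 \<le> joint_cdf k M t" "joint_cdf k M t \<le> 1" by (auto simp: joint_cdf_def)
    moreover have "0 \<le> joint_cdf k (iid_law D) t" "joint_cdf k (iid_law D) t \<le> 1"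
      unfolding J by (auto intro!: prod_nonneg prod_le_1)
    ultimately show ?thesis using True by linarith
  next
    case False
    have "(real k * \<epsilon>)\<^sup>2 \<le> 1" using False e by (intro power_le_one) auto
    also have "\<dots> \<le> real n * \<epsilon>\<^sup>2" by (rule e)
    finally have "(real k)\<^sup>2 \<le> real n" using e by (simp add: power_mult_distrib)
    moreover have "4 * real n \<le> real n * real n" using n by (intro mult_right_mono) auto
    ultimately have "(2 * real k)\<^sup>2 \<le> (real n)\<^sup>2" by (simp add: power_mult_distrib power2_eq_square)
    then have k2: "2 * real k \<le> real n" by (rule power2_le_imp_le) simp
    have kn: "real k \<le> real n * \<epsilon>"
    proof -
      have "real k * \<epsilon> \<le> 1" using False by simp
      then have "(real k * \<epsilon>) * 1 \<le> 1 * (real n * \<epsilon>\<^sup>2)" using e by (intro mult_mono) auto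
      then have "real k * \<epsilon> \<le> (real n * \<epsilon>) * \<epsilon>" by (simp add: power2_eq_square)
      then show ?thesis using e by simp
    qed
    have "\<bar>joint_cdf k M t - joint_cdf k (iid_law D) t\<bar> \<le> 
      (\<Sum>j<k. ((\<integral>x. count_deviation n (D.prob {..t j}) (t j) x \<partial>M) + real j) / (real n - real j))"
      unfolding J by (rule exchangeable_joint_cdf[OF ex k]) auto
    also have "\<dots> \<le> (\<Sum>j<k. 4 * \<epsilon>)"
    proof (rule sum_mono)
      fix j assume "j \<in> {..<k}"
      then have j: "real j \<le> real k" "real n - real j \<ge> real n / 2" using k2 by auto
      have "((\<integral>x. count_deviation n (D.prob {..t j}) (t j) x \<partial>M) + real j) / (real n - real j)
        \<le> (real n * \<epsilon> + real n * \<epsilon>) / (real n / 2)"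
      proof (rule frac_le)
        show "(\<integral>x. count_deviation n (D.prob {..t j}) (t j) x \<partial>M) + real j \<le> real n * \<epsilon> + real n * \<epsilon>"
          using dev[of "t j"] j(1) kn by linarith
      qed (use j n e in auto)
      also have "\<dots> = 4 * \<epsilon>" using n by (simp add: field_simps)
      finally show "((\<integral>x. count_deviation n (D.prob {..t j}) (t j) x \<partial>M) + real j) / (real n - real j) \<le> 4 * \<epsilon>" .
    qed
    also have "\<dots> = 4 * real k * \<epsilon>" by simp
    finally show ?thesis .
  qed
qed

text \<open>
  The distance is at most 1, so the finitely many \<open>n\<close> for which the deviation bound is not available
  are absorbed into the constant.
\<close>
lemma (in gibbs) rate_from_deviation:
  fixes rate :: "nat \<Rightarrow> real"
  assumes b: "b > 1" and B: "B \<ge> 1" and rate: "\<And>n. n \<ge> 2 \<Longrightarrow> rate n > 0"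
    and rn: "eventually (\<lambda>n. 1 \<le> real n * (rate n)\<^sup>2) at_top"
    and dev: "eventually (\<lambda>n. \<forall>\<sigma>. uniform_on_sphere n b \<sigma> \<longrightarrow> emeasure \<sigma> (K n b) > 0 \<and>
        (\<forall>t. (\<integral>x. count_deviation n (D.prob {..t}) t x \<partial>uniform_measure \<sigma> (K n b)) \<le> real n * (B * rate n))) at_top"
  shows "\<exists>C. \<forall>n k \<mu>. b < real n \<longrightarrow> 1 \<le> k \<longrightarrow> k \<le> n \<longrightarrow> uniform_on_K n b \<mu> \<longrightarrow>
    cdf_distance k \<mu> (iid_law D) \<le> C * real k * rate n"
proof -
  from eventually_conj[OF rn dev] obtain n1 where n1: "\<And>n. n \<ge> n1 \<Longrightarrow> 1 \<le> real n * (rate n)\<^sup>2 \<and> (\<forall>\<sigma>. uniform_on_sphere n b \<sigma> \<longrightarrow> emeasure \<sigma> (K n b) > 0 \<and>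
        (\<forall>t. (\<integral>x. count_deviation n (D.prob {..t}) t x \<partial>uniform_measure \<sigma> (K n b)) \<le> real n * (B * rate n)))"
    by (auto simp: eventually_at_top_linorder)
  \<comment> \<open>Each summand takes care of one value of \<open>n\<close>; values below 2 are excluded by \<open>b < real n\<close>.\<close>
  define S where "S = (\<Sum>n\<in>{2..<n1 + 4}. 1 / rate n)"
  have S: "S \<ge> 0" unfolding S_def using rate by (intro sum_nonneg) (auto intro: less_imp_le)
  show ?thesis
  proof (intro exI[of _ "4 * B + S"] allI impI)
    fix n k \<mu> assume h: "b < real n" "1 \<le> k" "k \<le> n" "uniform_on_K n b \<mu>"
    have n2: "n \<ge> 2" using h(1) b by linarith
    obtain \<sigma> where u: "uniform_on_sphere n b \<sigma>" and \<mu>: "\<mu> = uniform_measure \<sigma> (K n b)"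
      using h(4) by (auto simp: uniform_on_K_def)
    have ps: "prob_space \<sigma>" using u by (simp add: uniform_on_sphere_def)
    have Ks: "K n b \<in> sets \<sigma>" using u K_measurable by (simp add: uniform_on_sphere_def sets_lam)
    have r0: "rate n > 0" by (rule rate[OF n2])
    have J: "joint_cdf k (iid_law D) t = (\<Prod>i<k. D.prob {..t i})" for t by (rule joint_cdf_iid_law) unfold_locales
    have J01: "0 \<le> joint_cdf k (iid_law D) t" "joint_cdf k (iid_law D) t \<le> 1" for t
      unfolding J by (auto intro!: prod_nonneg prod_le_1)
    have "\<bar>joint_cdf k \<mu> t - joint_cdf k (iid_law D) t\<bar> \<le> (4 * B + S) * real k * rate n" for t
    proof (cases "n \<ge> n1 + 4")
      case True
      have pos: "emeasure \<sigma> (K n b) > 0" and d: "\<And>t. (\<integral>x. count_deviation n (D.prob {..t}) t x \<partial>\<mu>) \<le> real n * (B * rate n)"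
        and r1: "1 \<le> real n * (rate n)\<^sup>2"
        using n1[of n] True u by (auto simp: \<mu>)
      have ex: "exchangeable n \<mu>" unfolding \<mu> by (rule exchangeable_uniform_on_K[OF u pos K_measurable])
      have "1 * (rate n)\<^sup>2 \<le> B\<^sup>2 * (rate n)\<^sup>2" using B by (intro mult_right_mono one_le_power) auto
      then have "real n * (rate n)\<^sup>2 \<le> real n * (B * rate n)\<^sup>2" by (intro mult_left_mono) (auto simp: power_mult_distrib)
      with r1 have r1': "1 \<le> real n * (B * rate n)\<^sup>2" by linarith
      have "\<bar>joint_cdf k \<mu> t - joint_cdf k (iid_law D) t\<bar> \<le> 4 * real k * (B * rate n)"
        by (intro joint_cdf_close[OF ex]) (use r1' B r0 True h(3) d in auto)
      also have "\<dots> = (4 * B) * (real k * rate n)" by simp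
      also have "\<dots> \<le> (4 * B + S) * (real k * rate n)" using S r0 by (intro mult_right_mono) auto
      finally have "\<bar>joint_cdf k \<mu> t - joint_cdf k (iid_law D) t\<bar> \<le> (4 * B + S) * (real k * rate n)" .
      then have "\<bar>joint_cdf k \<mu> t - joint_cdf k (iid_law D) t\<bar> \<le> (4 * B + S) * real k * rate n" by (simp only: mult.assoc)
      then show ?thesis .
    next
      case False
      have "1 / rate n \<le> S" unfolding S_def using False n2 rate by (intro member_le_sum) (auto intro: less_imp_le)
      then have "1 \<le> S * rate n" using r0 by (simp add: divide_le_eq)
      also have "\<dots> \<le> (4 * B + S) * (real k * rate n)"
        using S B r0 h(2) mult_mono[of S "4 * B + S" "rate n" "real k * rate n"] by simp
      finally have "1 \<le> (4 * B + S) * real k * rate n" by (simp only: mult.assoc)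
      moreover have "\<bar>joint_cdf k \<mu> t - joint_cdf k (iid_law D) t\<bar> \<le> 1"
        using joint_cdf_uniform_measure_bounds[OF ps Ks, of k t] J01[of t] unfolding \<mu> by linarith
      ultimately show ?thesis by linarith
    qed
    then show "cdf_distance k \<mu> (iid_law D) \<le> (4 * B + S) * real k * rate n"
      unfolding cdf_distance_def by (intro cSUP_least) auto
  qed
qed

text \<open>
  The choice \<open>\<eta> = 1 / n ^ 3\<close> makes the coordinates of the shell differ from those of \<open>K n b\<close> by a
  multiple of \<open>1 / n\<^sup>2\<close>, which is negligible compared with the rate.
\<close>
lemma (in gibbs) deviation_from_core_bound:
  assumes b: "b > 1" and rate: "\<And>n. n \<ge> 2 \<Longrightarrow> rate n > 0"
    and A: "A \<ge> 0"
    and core: "eventually (\<lambda>n. p n \<le> measure (P n) (core n b (1 / real n ^ 3))) at_top"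
    and p: "eventually (\<lambda>n. p n > 0) at_top"
    and tail: "eventually (\<lambda>n. 4 * exp (2 * (\<bar>r\<bar> + \<bar>s\<bar>)) * exp (- real n * (A * rate n)\<^sup>2 / 2) / p n \<le> rate n) at_top"
    and rr: "\<And>L. eventually (\<lambda>n. L / (real n)\<^sup>2 \<le> A * rate n / 2) at_top"
  shows "eventually (\<lambda>n. \<forall>\<sigma>. uniform_on_sphere n b \<sigma> \<longrightarrow> emeasure \<sigma> (K n b) > 0 \<and>
        (\<forall>t. (\<integral>x. count_deviation n (D.prob {..t}) t x \<partial>uniform_measure \<sigma> (K n b)) \<le> real n * ((A + 1) * rate n))) at_top"
proof -
  obtain L where L: "L > 0" "\<And>x. gibbs_weight r s x / Zc \<le> L" using weight_bounded by auto
  have e1: "eventually (\<lambda>n. (3 * b + 7) / (real n)\<^sup>2 < 1) at_top"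
    by (rule order_tendstoD) (real_asymp, simp)
  show ?thesis
    using core p tail rr[of "L * (6 + b)"] e1 eventually_ge_at_top[of 6]
  proof eventually_elim
    case (elim n)
    define \<eta> where "\<eta> = 1 / real n ^ 3"
    have \<eta>: "0 < \<eta>" "\<eta> \<le> 1/216" and n\<eta>: "real n * \<eta> = 1 / real n ^ 2" unfolding \<eta>_def by (rule eta_bounds[OF elim(6)])+
    have n0: "n > 0" using elim by simp
    have small: "real n * \<eta> * (3 * b + 7) \<le> 1" unfolding n\<eta> using elim(5) by simp
    have "L * (\<eta> * real n * (6 + b)) = L * (6 + b) * (real n * \<eta>)" by simp
    also have "\<dots> = L * (6 + b) / (real n)\<^sup>2" unfolding n\<eta> by simp
    finally have Ld: "L * (\<eta> * real n * (6 + b)) \<le> (A * rate n) / 2" using elim(4) by simp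
    have r0: "rate n > 0" using rate elim(6) by simp
    then have d0: "0 \<le> A * rate n" using A by simp
    have \<eta>8: "\<eta> \<le> 1/8" using \<eta> by simp
    have core': "p n \<le> measure (P n) (core n b \<eta>)" using elim(1) by (simp add: \<eta>_def)
    show ?case
    proof (intro allI impI conjI)
      fix \<sigma> assume u: "uniform_on_sphere n b \<sigma>"
      note * = empirical_cdf_deviation[OF n0 b \<eta>(1) \<eta>8 small L(2) d0 Ld u elim(2) core']
      show "emeasure \<sigma> (K n b) > 0" by (rule *(1))
      fix t
      have "real n * (A * rate n + 4 * exp (2 * (\<bar>r\<bar> + \<bar>s\<bar>)) * exp (- real n * (A * rate n)\<^sup>2 / 2) / p n) \<le> real n * ((A + 1) * rate n)"
        using elim(3) by (intro mult_left_mono) (auto simp: distrib_right)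
      with *(2)[of t] show "(\<integral>x. count_deviation n (D.prob {..t}) t x \<partial>uniform_measure \<sigma> (K n b)) \<le> real n * ((A + 1) * rate n)"
        by linarith
    qed
  qed
qed

lemma (in gibbs) gibbs_rate:
  assumes m: "(\<integral>z. z \<partial>D) = 1" "(\<integral>z. z\<^sup>2 \<partial>D) = b" and b: "b > 1"
  shows "\<exists>C. \<forall>n k \<mu>. b < real n \<longrightarrow> 1 \<le> k \<longrightarrow> k \<le> n \<longrightarrow> uniform_on_K n b \<mu> \<longrightarrow>
    cdf_distance k \<mu> (iid_law D) \<le> C * real k * sqrt (ln (real n) / real n)"
proof -
  define rate where "rate n = sqrt (ln (real n) / real n)" for n :: nat
  obtain c n0 where c: "c > 0" and core: "\<And>n. n \<ge> n0 \<Longrightarrow> c / real n ^ 7 \<le> measure (P n) (core n b (1 / real n ^ 3))"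
    using core_prob_polynomial[OF m b] by blast
  have rate0: "rate n > 0" if "n \<ge> 2" for n using that by (simp add: rate_def)
  have r2: "(rate n)\<^sup>2 = ln (real n) / real n" if "n \<ge> 2" for n using that by (simp add: rate_def)
  define E where "E = exp (2 * (\<bar>r\<bar> + \<bar>s\<bar>))"
  have E0: "E > 0" by (simp add: E_def)
  have "eventually (\<lambda>n. \<forall>\<sigma>. uniform_on_sphere n b \<sigma> \<longrightarrow> emeasure \<sigma> (K n b) > 0 \<and>
        (\<forall>t. (\<integral>x. count_deviation n (D.prob {..t}) t x \<partial>uniform_measure \<sigma> (K n b)) \<le> real n * ((4 + 1) * rate n))) at_top"
  \<comment> \<open>With the factor 4, \<open>exp (- n * (4 * rate n)\<^sup>2 / 2) = 1 / n ^ 8\<close> beats the probability of the core.\<close>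
  proof (rule deviation_from_core_bound[OF b rate0])
    show "eventually (\<lambda>n. c / real n ^ 7 \<le> measure (P n) (core n b (1 / real n ^ 3))) at_top"
      using core by (auto simp: eventually_at_top_linorder)
    show "eventually (\<lambda>n. c / real n ^ 7 > 0) at_top"
      using eventually_gt_at_top[of 0] by eventually_elim (simp add: c)
    have "eventually (\<lambda>n. 4 * E / c * (1 / real n) / rate n < 1) at_top"
    proof (rule order_tendstoD)
      show "((\<lambda>n. 4 * E / c * (1 / real n) / rate n) \<longlongrightarrow> 0) at_top" unfolding rate_def by real_asymp
    qed simp
    then show "eventually (\<lambda>n. 4 * exp (2 * (\<bar>r\<bar> + \<bar>s\<bar>)) * exp (- real n * (4 * rate n)\<^sup>2 / 2) / (c / real n ^ 7) \<le> rate n) at_top"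
      using eventually_ge_at_top[of 2]
    proof eventually_elim
      case (elim n)
      have n: "real n > 0" using elim by simp
      have "- real n * (4 * rate n)\<^sup>2 / 2 = - (8 * ln (real n))" using r2[OF elim(2)] n by (simp add: power_mult_distrib)
      also have "exp \<dots> = 1 / real n ^ 8"
      proof -
        have "exp (8 * ln (real n)) = real n ^ 8" using n exp_of_nat_mult[of 8 "ln (real n)"] by simp
        then show ?thesis by (simp add: exp_minus inverse_eq_divide)
      qed
      finally have "4 * E * exp (- real n * (4 * rate n)\<^sup>2 / 2) / (c / real n ^ 7) = 4 * E / c * (1 / real n)"
        using n c by (simp add: eval_nat_numeral)
      also have "\<dots> \<le> rate n" using elim(1) rate0[OF elim(2)] by (subst (asm) pos_divide_less_eq) auto
      finally show ?case by (simp add: E_def)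
    qed
    fix L :: real
    have "eventually (\<lambda>n. L / (real n)\<^sup>2 / (4 * rate n / 2) < 1) at_top"
    proof (rule order_tendstoD)
      show "((\<lambda>n. L / (real n)\<^sup>2 / (4 * rate n / 2)) \<longlongrightarrow> 0) at_top" unfolding rate_def by real_asymp
    qed simp
    then show "eventually (\<lambda>n. L / (real n)\<^sup>2 \<le> 4 * rate n / 2) at_top"
      using eventually_ge_at_top[of 2]
    proof eventually_elim
      case (elim n)
      then show ?case using rate0[OF elim(2)] by (subst (asm) pos_divide_less_eq) auto
    qed
  qed auto
  moreover have "eventually (\<lambda>n. 1 \<le> real n * (rate n)\<^sup>2) at_top"
  proof -
    have "eventually (\<lambda>n. 1 \<le> ln (real n)) at_top" by real_asymp
    then show ?thesis using eventually_ge_at_top[of 2] by eventually_elim (simp add: r2)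
  qed
  ultimately show ?thesis unfolding rate_def[symmetric]
    by (intro rate_from_deviation[OF b _ rate0, of "4 + 1"]) auto
qed

lemma exp1_rate:
  assumes b: "b > 2"
  shows "\<exists>C. \<forall>n k \<mu>. b < real n \<longrightarrow> 1 \<le> k \<longrightarrow> k \<le> n \<longrightarrow> uniform_on_K n b \<mu> \<longrightarrow>
    cdf_distance k \<mu> (iid_law exp1_measure) \<le> C * real k * real n powr (- 1 / 4)"
proof -
  have b1: "b > 1" using b by simp
  define rate where "rate n = real n powr (- 1 / 4)" for n :: nat
  obtain C n0 where C: "C > 0" and core: "\<And>n. n \<ge> n0 \<Longrightarrow> exp (- C * sqrt (real n)) \<le> measure (exp1.P n) (core n b (1 / real n ^ 3))"
    using exp1_core_prob[OF b] by blast
  have rate0: "rate n > 0" if "n \<ge> 2" for n using that by (simp add: rate_def)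
  have r2: "real n * (rate n)\<^sup>2 = sqrt (real n)" if "n \<ge> 2" for n
  proof -
    have "real n * (rate n)\<^sup>2 = real n powr 1 * real n powr (- 1 / 2)" using that by (simp add: rate_def powr_powr[symmetric] powr_realpow[symmetric] power2_eq_square powr_add[symmetric])
    also have "\<dots> = real n powr (1 / 2)" by (subst powr_add[symmetric]) simp
    finally show ?thesis by (simp add: powr_half_sqrt)
  qed
  define E where "E = exp (2 * (\<bar>0\<bar> + \<bar>1::real\<bar>))"
  \<comment> \<open>This leaves a factor \<open>exp (- sqrt n)\<close> after division by the probability of the core.\<close>
  define A where "A = sqrt (2 * (C + 1))"
  have A: "A \<ge> 0" "A\<^sup>2 = 2 * (C + 1)" using C by (auto simp: A_def)
  have A0: "A > 0" using C by (simp add: A_def)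
  have "eventually (\<lambda>n. \<forall>\<sigma>. uniform_on_sphere n b \<sigma> \<longrightarrow> emeasure \<sigma> (K n b) > 0 \<and>
        (\<forall>t. (\<integral>x. count_deviation n (exp1.D.prob {..t}) t x \<partial>uniform_measure \<sigma> (K n b)) \<le> real n * ((A + 1) * rate n))) at_top"
  proof (rule exp1.deviation_from_core_bound[OF b1 rate0 A(1)])
    show "eventually (\<lambda>n. exp (- C * sqrt (real n)) \<le> measure (exp1.P n) (core n b (1 / real n ^ 3))) at_top"
      using core by (auto simp: eventually_at_top_linorder)
    show "eventually (\<lambda>n. exp (- C * sqrt (real n)) > 0) at_top" by simp
    have "eventually (\<lambda>n. 4 * E * exp (- sqrt (real n)) / rate n < 1) at_top"
    proof (rule order_tendstoD)
      show "((\<lambda>n. 4 * E * exp (- sqrt (real n)) / rate n) \<longlongrightarrow> 0) at_top" unfolding rate_def by real_asymp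
    qed simp
    then show "eventually (\<lambda>n. 4 * exp (2 * (\<bar>0\<bar> + \<bar>1\<bar>)) * exp (- real n * (A * rate n)\<^sup>2 / 2) / exp (- C * sqrt (real n)) \<le> rate n) at_top"
      using eventually_ge_at_top[of 2]
    proof eventually_elim
      case (elim n)
      have "- real n * (A * rate n)\<^sup>2 / 2 = - (A\<^sup>2 / 2) * (real n * (rate n)\<^sup>2)" by (simp add: power_mult_distrib)
      also have "\<dots> = - C * sqrt (real n) - sqrt (real n)" unfolding r2[OF elim(2)] A(2) by (simp add: algebra_simps)
      finally have "exp (- real n * (A * rate n)\<^sup>2 / 2) / exp (- C * sqrt (real n)) = exp (- sqrt (real n))"
        by (simp only: exp_diff[symmetric]) simp
      then have "4 * E * exp (- real n * (A * rate n)\<^sup>2 / 2) / exp (- C * sqrt (real n)) = 4 * E * exp (- sqrt (real n))"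
        by (metis times_divide_eq_right)
      also have "\<dots> \<le> rate n" using elim(1) rate0[OF elim(2)] by (subst (asm) pos_divide_less_eq) auto
      finally show ?case by (simp only: E_def)
    qed
    fix L :: real
    have "eventually (\<lambda>n. L / (real n)\<^sup>2 / (A * rate n / 2) < 1) at_top"
    proof (rule order_tendstoD)
      show "((\<lambda>n. L / (real n)\<^sup>2 / (A * rate n / 2)) \<longlongrightarrow> 0) at_top" unfolding rate_def using A0 by real_asymp
    qed simp
    then show "eventually (\<lambda>n. L / (real n)\<^sup>2 \<le> A * rate n / 2) at_top"
      using eventually_ge_at_top[of 2]
    proof eventually_elim
      case (elim n)
      then show ?case using rate0[OF elim(2)] A0 by (subst (asm) pos_divide_less_eq) auto
    qed
  qed auto
  moreover have "eventually (\<lambda>n. 1 \<le> real n * (rate n)\<^sup>2) at_top"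
    using eventually_ge_at_top[of 2] by eventually_elim (simp add: r2)
  ultimately show ?thesis unfolding rate_def[symmetric] exp1_measure_gibbs
    by (intro gibbs.rate_from_deviation[OF exp1.gibbs_axioms b1 _ rate0, of "A + 1"]) (use A0 in auto)
qed

theorem theorem1p3:
  fixes b :: real
  assumes "1 < b"
  shows
    "(b \<le> 2 \<longrightarrow>
       (\<exists>C::real. \<forall>r s. gibbs_params b r s \<longrightarrow>
         (\<forall>(n::nat) (k::nat) \<mu>. b < real n \<longrightarrow> 1 \<le> k \<longrightarrow> k \<le> n \<longrightarrow> uniform_on_K n b \<mu> \<longrightarrow>
           cdf_distance k \<mu> (iid_law (gibbs_measure r s))
             \<le> C * real k * sqrt (ln (real n) / real n)))) \<and>
     (2 < b \<longrightarrow>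
       (\<exists>C::real.
         \<forall>(n::nat) (k::nat) \<mu>. b < real n \<longrightarrow> 1 \<le> k \<longrightarrow> k \<le> n \<longrightarrow> uniform_on_K n b \<mu> \<longrightarrow>
           cdf_distance k \<mu> (iid_law exp1_measure)
             \<le> C * real k * real n powr (- 1 / 4)))"
proof (intro conjI impI)
  show "\<exists>C::real. \<forall>r s. gibbs_params b r s \<longrightarrow>
         (\<forall>(n::nat) (k::nat) \<mu>. b < real n \<longrightarrow> 1 \<le> k \<longrightarrow> k \<le> n \<longrightarrow> uniform_on_K n b \<mu> \<longrightarrow>
           cdf_distance k \<mu> (iid_law (gibbs_measure r s))
             \<le> C * real k * sqrt (ln (real n) / real n))"
  proof (cases "\<exists>r s. gibbs_params b r s")
    case True
    then obtain r s where rs: "gibbs_params b r s" by auto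
    interpret gibbs r s using rs by (rule gibbs_params_gibbs)
    from gibbs_rate[OF gibbs_params_moments[OF rs] assms] obtain C where
      C: "\<forall>n k \<mu>. b < real n \<longrightarrow> 1 \<le> k \<longrightarrow> k \<le> n \<longrightarrow> uniform_on_K n b \<mu> \<longrightarrow>
        cdf_distance k \<mu> (iid_law (gibbs_measure r s)) \<le> C * real k * sqrt (ln (real n) / real n)" by auto
    show ?thesis
    proof (intro exI[of _ C] allI impI)
      fix r' s' n k \<mu>
      assume h: "gibbs_params b r' s'" "b < real n" "1 \<le> k" "k \<le> n" "uniform_on_K n b \<mu>"
      have "r' = r" "s' = s" using gibbs_params_unique[OF h(1) rs] by auto
      then show "cdf_distance k \<mu> (iid_law (gibbs_measure r' s')) \<le> C * real k * sqrt (ln (real n) / real n)"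
        using C h by simp
    qed
  qed blast
next
  assume "2 < b"
  then show "\<exists>C::real. \<forall>(n::nat) (k::nat) \<mu>. b < real n \<longrightarrow> 1 \<le> k \<longrightarrow> k \<le> n \<longrightarrow> uniform_on_K n b \<mu> \<longrightarrow>
           cdf_distance k \<mu> (iid_law exp1_measure) \<le> C * real k * real n powr (- 1 / 4)"
    by (rule exp1_rate)
qed

end
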